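(* Let $a^0,b^0$ be real $q$-periodic sequences with $a^0_n>0$ and let $v$ be a real sequence with $v_n=0$ for $n<0$ and $n>p$, and $v_0,v_p\ne0$. For $t>0$ let $H=H_t$ be the Jacobi operator $(Hy)_n=a^0_{n-1}y_{n-1}+a^0_ny_{n+1}+(b^0_n+tv_n)y_n$ (that is, $u_j=0$ for all $j$, and $v_j$ is replaced by $tv_j$). Then there exists $t_0>0$ small enough such that for all $t\in(0,t_0)$ the following statements hold. i) For each $k=1,\dots,q-1$ with $\gamma_k\neq\emptyset$, there are exactly two simple real states $\lambda_k^\pm(t)\in\gamma_k^{\rm c}$, and they satisfy $\lambda_k^-\le\lambda_k^-(t)<\alpha_k<\lambda_k^+(t)\le\lambda_k^+$. Moreover, if $\gamma_n\ne\emptyset$ and $\lambda_0$ is one of $\lambda_n^\pm(t)$ and satisfies $(-1)^{q-n+1}J(\lambda_0)>0$ (respectively $(-1)^{q-n+1}J(\lambda_0)<0$, respectively $J(\lambda_0)=0$), then $\lambda_0$ is a bound state (respectively an anti-bound state, respectively a virtual state). ii) If $\gamma_n\neq\emptyset$, the following asymptotics hold: $$\lambda_n^\pm(t)=\lambda_n^\pm+t^2\frac{J_1^2(\lambda_n^\pm)}{4(\Delta^2)'(\lambda_n^\pm)}+O(t^3),$$ where $J(\lambda_n^\pm)=tJ_1(\lambda_n^\pm)+O(t^2)$ and, if $\lambda_n^\pm\ne\mu_n$, then $$J_1(\lambda_n^\pm)=-\frac{\varphi_q(\lambda_n^\pm)}{a_0^0}\sum_{k=0}^pv_k|\psi_k^+(\lambda_n^\pm)|^2,$$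 while if $\lambda_n^+=\mu_n$ or $\lambda_n^-=\mu_n$, then $$J_1(\mu_n)=\frac{\vartheta_{q+1}(\mu_n)}{a_0^0}\sum_{k=1}^pv_k(\varphi_k(\mu_n))^2.$$
   Context: Setting. $q\ge 1$ and $p\ge 1$ are integers. $a^0_n=a^0_{n+q}>0$, $b^0_n=b^0_{n+q}\in\mathbb R$ for $n\in\mathbb Z$, and $H^0$ is the periodic Jacobi operator on $\ell^2(\mathbb Z)$, $(H^0y)_n=a^0_{n-1}y_{n-1}+a^0_ny_{n+1}+b^0_ny_n$. Periodic objects. For $\lambda\in\mathbb C$, $\varphi=(\varphi_n(\lambda))$ and $\vartheta=(\vartheta_n(\lambda))$ are the solutions of $H^0y=\lambda y$ with $\vartheta_0=\varphi_1=1$, $\vartheta_1=\varphi_0=0$. $\Delta=\frac12(\varphi_{q+1}+\vartheta_q)$, $\phi=\frac12(\varphi_{q+1}-\vartheta_q)$. The $2q$ zeros of $\Delta^2-1$ are real and are enumerated as $\lambda_0^+<\lambda_1^-\le\lambda_1^+<\dots<\lambda_{q-1}^-\le\lambda_{q-1}^+<\lambda_q^-$; set $\lambda_0^-=\lambda_0^+$, $\lambda_q^+=\lambda_q^-$. The spectrum of $H^0$ is $\bigcup_{n=1}^q[\lambda_{n-1}^+,\lambda_n^-]$ and the finite gaps are $\gamma_n=(\lambda_n^-,\lambda_n^+)$, $1\le n\le q-1$ (possibly empty). The infinite gaps are $\gamma_0=(-\infty,\lambda_0^+)$ and $\gamma_q=(\lambda_q^+,\infty)$. For $1\le k\le q-1$: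 $\mu_k\in[\lambda_k^-,\lambda_k^+]$ is the zero of the polynomial $\varphi_q$ in that interval (Dirichlet eigenvalue), and $\alpha_k\in[\lambda_k^-,\lambda_k^+]$ is the unique point with $(-1)^{q-k}\Delta(\alpha_k)=\max_{\lambda\in[\lambda_k^-,\lambda_k^+]}|\Delta(\lambda)|$. Riemann surface. $\Lambda$ is the two-sheeted Riemann surface of $\sqrt{\Delta^2-1}$ obtained by gluing crosswise two copies $\Lambda_+$ (physical sheet) and $\Lambda_-$ (nonphysical sheet) of the plane cut along the spectrum of $H^0$. $\gamma_k^\pm$ denotes the gap $\gamma_k$ on the sheet $\Lambda_\pm$, and $\gamma_k^{\rm c}=\overline{\gamma_k^+}\cup\overline{\gamma_k^-}$; points of $\gamma_k^{\rm c}$ are compared with real numbers through their projection to $\mathbb R$. $\sqrt{\Delta^2-1}$ is the function on $\Lambda$ which is negative for $\lambda>\lambda_q^-$ on $\Lambda_+$ (and takes the opposite sign on $\Lambda_-$), and $\Omega=\sqrt{1-\Delta^2}$ is determined by $i\Omega=\sqrt{\Delta^2-1}$. Jost solutions. On $\Lambda$ put $m_\pm=(\phi\pm\sqrt{\Delta^2-1})/\varphi_q$ and $\psi_n^\pm=\vartheta_n+m_\pm\varphi_n$. $f^\pm$ are the solutions of $Hy=\lambda y$ with $f_n^-=\psi_n^-$ for $n\le 0$ and $f_n^+=\psi_n^+$ for $n>p$. Wronskian: $\{x,y\}=a_n^0(x_ny_{n+1}-x_{n+1}y_n)$. Put $\alpha=\frac{\varphi_q}{2i\Omega a_0^0}\{f^-,f^+\}$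 and $\xi=2i\Omega\alpha=\frac{\varphi_q}{a_0^0}\{f^-,f^+\}$, which (after removing removable singularities) is an analytic function on $\Lambda$. The function $J$ (depending on $t$) is defined for $\lambda$ in the spectrum of $H^0$ by $J(\lambda)=2\Omega(\lambda+i0)\,\mathrm{Im}\,\alpha(\lambda+i0)$ (boundary values from $\Lambda_+$); it extends to a polynomial on $\mathbb C$, real on $\mathbb R$. States. $\Lambda_0\subset\Lambda$ is the set of the points $\lambda_k^+$, on both sheets, for those $k$ with $\gamma_k=\emptyset$ ($1\le k\le q-1$). A state of $H$ is a zero of $\xi$ on $\Lambda\setminus\Lambda_0$. A state in $\Lambda_+$ is a bound state; a state in $\Lambda_-$ is a resonance; a state $\lambda=\lambda_k^\pm$ is a virtual state; a resonance in $\bigcup_k\gamma_k^-$ is an anti-bound state. *)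

theory Defs
  imports "HOL-Complex_Analysis.Complex_Analysis" "HOL-Library.Landau_Symbols"
begin

section \<open>Jacobi operators on the integers\<close>

definition jacobi_op ::
  "(int \<Rightarrow> real) \<Rightarrow> (int \<Rightarrow> real) \<Rightarrow> (int \<Rightarrow> complex) \<Rightarrow> int \<Rightarrow> complex" where
  "jacobi_op a b y n = of_real (a (n - 1)) * y (n - 1) + of_real (a n) * y (n + 1) + of_real (b n) * y n"

definition jacobi_solution ::
  "(int \<Rightarrow> real) \<Rightarrow> (int \<Rightarrow> real) \<Rightarrow> complex \<Rightarrow> (int \<Rightarrow> complex) \<Rightarrow> bool" where
  "jacobi_solution a b l y \<longleftrightarrow> (\<forall>n. jacobi_op a b y n = l * y n)"

definition vartheta :: "(int \<Rightarrow> real) \<Rightarrow> (int \<Rightarrow> real) \<Rightarrow> int \<Rightarrow> complex \<Rightarrow> complex" where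
  "vartheta a b n l = (THE y. jacobi_solution a b l y \<and> y 0 = 1 \<and> y 1 = 0) n"

definition varphi :: "(int \<Rightarrow> real) \<Rightarrow> (int \<Rightarrow> real) \<Rightarrow> int \<Rightarrow> complex \<Rightarrow> complex" where
  "varphi a b n l = (THE y. jacobi_solution a b l y \<and> y 0 = 0 \<and> y 1 = 1) n"

definition wronskian ::
  "(int \<Rightarrow> real) \<Rightarrow> (int \<Rightarrow> complex) \<Rightarrow> (int \<Rightarrow> complex) \<Rightarrow> int \<Rightarrow> complex" where
  "wronskian a x y n = of_real (a n) * (x n * y (n + 1) - x (n + 1) * y n)"


section \<open>Periodic background\<close>

text \<open>Throughout, \<open>a\<close>, \<open>b\<close> are the coefficients of the unperturbed operator and \<open>q\<close> is
  their period.\<close>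

definition Delta :: "(int \<Rightarrow> real) \<Rightarrow> (int \<Rightarrow> real) \<Rightarrow> nat \<Rightarrow> complex \<Rightarrow> complex" where
  "Delta a b q l = (varphi a b (int q + 1) l + vartheta a b (int q) l) / 2"

definition phi :: "(int \<Rightarrow> real) \<Rightarrow> (int \<Rightarrow> real) \<Rightarrow> nat \<Rightarrow> complex \<Rightarrow> complex" where
  "phi a b q l = (varphi a b (int q + 1) l - vartheta a b (int q) l) / 2"

text \<open>The zeros of \<open>\<Delta>\<^sup>2 - 1\<close>, counted with multiplicity, are
  \<open>\<lambda>\<^sub>0\<^sup>+ < \<lambda>\<^sub>1\<^sup>- \<le> \<lambda>\<^sub>1\<^sup>+ < \<dots> < \<lambda>\<^sub>q\<^sup>-\<close>; the multiplicities are expressed by the factorization.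
  The enumeration is determined by this on the indices \<open>0, \<dots>, q\<close>, the only ones used.\<close>

definition is_edge_enumeration ::
  "(int \<Rightarrow> real) \<Rightarrow> (int \<Rightarrow> real) \<Rightarrow> nat \<Rightarrow> (nat \<Rightarrow> real) \<Rightarrow> (nat \<Rightarrow> real) \<Rightarrow> bool" where
  "is_edge_enumeration a b q lm lp \<longleftrightarrow>
     (\<exists>c. \<forall>z. (Delta a b q z)\<^sup>2 - 1
          = c * (\<Prod>k=1..q. (z - of_real (lp (k - 1))) * (z - of_real (lm k)))) \<and>
     (\<forall>k\<in>{1..q}. lp (k - 1) < lm k) \<and>
     (\<forall>k\<in>{1..q - 1}. lm k \<le> lp k) \<and>
     lm 0 = lp 0 \<and> lp q = lm q"

definition edges ::
  "(int \<Rightarrow> real) \<Rightarrow> (int \<Rightarrow> real) \<Rightarrow> nat \<Rightarrow> (nat \<Rightarrow> real) \<times> (nat \<Rightarrow> real)" where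
  "edges a b q = (SOME e. is_edge_enumeration a b q (fst e) (snd e))"

definition lam_minus :: "(int \<Rightarrow> real) \<Rightarrow> (int \<Rightarrow> real) \<Rightarrow> nat \<Rightarrow> nat \<Rightarrow> real" where
  "lam_minus a b q = fst (edges a b q)"

definition lam_plus :: "(int \<Rightarrow> real) \<Rightarrow> (int \<Rightarrow> real) \<Rightarrow> nat \<Rightarrow> nat \<Rightarrow> real" where
  "lam_plus a b q = snd (edges a b q)"

text \<open>The spectrum of the unperturbed operator, given by its bands.\<close>

definition spec0 :: "(int \<Rightarrow> real) \<Rightarrow> (int \<Rightarrow> real) \<Rightarrow> nat \<Rightarrow> real set" where
  "spec0 a b q = (\<Union>n\<in>{1..q}. {lam_plus a b q (n - 1)..lam_minus a b q n})"

definition gap :: "(int \<Rightarrow> real) \<Rightarrow> (int \<Rightarrow> real) \<Rightarrow> nat \<Rightarrow> nat \<Rightarrow> real set" where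
  "gap a b q k =
     (if k = 0 then {..<lam_plus a b q 0}
      else if k = q then {lam_plus a b q q<..}
      else {lam_minus a b q k<..<lam_plus a b q k})"

definition mu :: "(int \<Rightarrow> real) \<Rightarrow> (int \<Rightarrow> real) \<Rightarrow> nat \<Rightarrow> nat \<Rightarrow> real" where
  "mu a b q k = (THE x. x \<in> {lam_minus a b q k..lam_plus a b q k} \<and>
                        varphi a b (int q) (of_real x) = 0)"

definition alpha_pt :: "(int \<Rightarrow> real) \<Rightarrow> (int \<Rightarrow> real) \<Rightarrow> nat \<Rightarrow> nat \<Rightarrow> real" where
  "alpha_pt a b q k = (THE x. x \<in> {lam_minus a b q k..lam_plus a b q k} \<and>
     (-1) ^ (q - k) * Delta a b q (of_real x) =
       of_real (SUP y\<in>{lam_minus a b q k..lam_plus a b q k}. cmod (Delta a b q (of_real y))))"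


section \<open>The Riemann surface\<close>

text \<open>A point of \<open>\<Lambda>\<close> is a pair \<open>(\<lambda>, w)\<close>, where \<open>w\<close> is the value of \<open>\<surd>(\<Delta>\<^sup>2 - 1)\<close>; the projection to
  the \<open>\<lambda>\<close>-plane is \<^const>\<open>fst\<close>. This affine curve is smooth, and is the Riemann surface, except at
  the double zeros of \<open>\<Delta>\<^sup>2 - 1\<close> (empty gaps). There it has a node, at which it identifies the two
  points of \<open>\<Lambda>\<^sub>0\<close> over \<open>\<lambda>\<^sub>k\<^sup>+\<close>; states are only considered off \<open>\<Lambda>\<^sub>0\<close>.\<close>

definition Surf :: "(int \<Rightarrow> real) \<Rightarrow> (int \<Rightarrow> real) \<Rightarrow> nat \<Rightarrow> (complex \<times> complex) set" where
  "Surf a b q = {P. (snd P)\<^sup>2 = (Delta a b q (fst P))\<^sup>2 - 1}"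

definition Surf0 :: "(int \<Rightarrow> real) \<Rightarrow> (int \<Rightarrow> real) \<Rightarrow> nat \<Rightarrow> (complex \<times> complex) set" where
  "Surf0 a b q = {P \<in> Surf a b q. \<exists>k\<in>{1..q - 1}. gap a b q k = {} \<and>
                                     fst P = of_real (lam_plus a b q k)}"

text \<open>The branch of \<open>\<surd>(\<Delta>\<^sup>2 - 1)\<close> on the cut plane that is negative for \<open>\<lambda> > \<lambda>\<^sub>q\<^sup>-\<close>; it is unique
  off the cut, where alone it is evaluated.\<close>

definition phys_sqrt :: "(int \<Rightarrow> real) \<Rightarrow> (int \<Rightarrow> real) \<Rightarrow> nat \<Rightarrow> complex \<Rightarrow> complex" where
  "phys_sqrt a b q = (SOME R.
     R holomorphic_on (- of_real ` spec0 a b q) \<and>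
     (\<forall>z\<in>- of_real ` spec0 a b q. (R z)\<^sup>2 = (Delta a b q z)\<^sup>2 - 1) \<and>
     (\<forall>x>lam_minus a b q q. Im (R (of_real x)) = 0 \<and> Re (R (of_real x)) < 0))"

definition sheet_plus :: "(int \<Rightarrow> real) \<Rightarrow> (int \<Rightarrow> real) \<Rightarrow> nat \<Rightarrow> (complex \<times> complex) set" where
  "sheet_plus a b q = {(z, phys_sqrt a b q z) | z. z \<notin> of_real ` spec0 a b q}"

definition sheet_minus :: "(int \<Rightarrow> real) \<Rightarrow> (int \<Rightarrow> real) \<Rightarrow> nat \<Rightarrow> (complex \<times> complex) set" where
  "sheet_minus a b q = {(z, - phys_sqrt a b q z) | z. z \<notin> of_real ` spec0 a b q}"

definition gap_plus ::
  "(int \<Rightarrow> real) \<Rightarrow> (int \<Rightarrow> real) \<Rightarrow> nat \<Rightarrow> nat \<Rightarrow> (complex \<times> complex) set" where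
  "gap_plus a b q k = {P \<in> sheet_plus a b q. fst P \<in> of_real ` gap a b q k}"

definition gap_minus ::
  "(int \<Rightarrow> real) \<Rightarrow> (int \<Rightarrow> real) \<Rightarrow> nat \<Rightarrow> nat \<Rightarrow> (complex \<times> complex) set" where
  "gap_minus a b q k = {P \<in> sheet_minus a b q. fst P \<in> of_real ` gap a b q k}"

definition gap_circle ::
  "(int \<Rightarrow> real) \<Rightarrow> (int \<Rightarrow> real) \<Rightarrow> nat \<Rightarrow> nat \<Rightarrow> (complex \<times> complex) set" where
  "gap_circle a b q k = closure (gap_plus a b q k) \<union> closure (gap_minus a b q k)"

definition Omega :: "complex \<times> complex \<Rightarrow> complex" where
  "Omega P = snd P / \<i>"

text \<open>A simple zero at \<open>P\<close> is a zero of order one in a holomorphic local parameter of the surface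
  at \<open>P\<close>. Over a zero \<open>e\<close> of \<open>\<Delta>\<^sup>2 - 1\<close> with nonempty gap, such a parameter is comparable with
  \<open>\<surd>(\<lambda> - e)\<close>, not with \<open>\<lambda> - e\<close>.\<close>

definition local_parametrization ::
  "(int \<Rightarrow> real) \<Rightarrow> (int \<Rightarrow> real) \<Rightarrow> nat \<Rightarrow> complex \<times> complex \<Rightarrow> (complex \<Rightarrow> complex \<times> complex) \<Rightarrow> bool"
  where
  "local_parametrization a b q P g \<longleftrightarrow>
     (\<exists>r>0. (\<lambda>z. fst (g z)) holomorphic_on ball 0 r \<and> (\<lambda>z. snd (g z)) holomorphic_on ball 0 r \<and>
            g ` ball 0 r \<subseteq> Surf a b q) \<and>
     g 0 = P \<and>
     (deriv (\<lambda>z. fst (g z)) 0 \<noteq> 0 \<or> deriv (\<lambda>z. snd (g z)) 0 \<noteq> 0)"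

definition simple_zero ::
  "(int \<Rightarrow> real) \<Rightarrow> (int \<Rightarrow> real) \<Rightarrow> nat \<Rightarrow> (complex \<times> complex \<Rightarrow> complex) \<Rightarrow> complex \<times> complex \<Rightarrow> bool"
  where
  "simple_zero a b q F P \<longleftrightarrow> F P = 0 \<and>
     (\<exists>g d. local_parametrization a b q P g \<and>
            ((\<lambda>z. F (g z)) has_field_derivative d) (at 0) \<and> d \<noteq> 0)"


section \<open>Jost solutions and states\<close>

definition m_plus :: "(int \<Rightarrow> real) \<Rightarrow> (int \<Rightarrow> real) \<Rightarrow> nat \<Rightarrow> complex \<times> complex \<Rightarrow> complex" where
  "m_plus a b q P = (phi a b q (fst P) + snd P) / varphi a b (int q) (fst P)"

definition m_minus :: "(int \<Rightarrow> real) \<Rightarrow> (int \<Rightarrow> real) \<Rightarrow> nat \<Rightarrow> complex \<times> complex \<Rightarrow> complex" where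
  "m_minus a b q P = (phi a b q (fst P) - snd P) / varphi a b (int q) (fst P)"

definition psi_plus ::
  "(int \<Rightarrow> real) \<Rightarrow> (int \<Rightarrow> real) \<Rightarrow> nat \<Rightarrow> int \<Rightarrow> complex \<times> complex \<Rightarrow> complex" where
  "psi_plus a b q n P = vartheta a b n (fst P) + m_plus a b q P * varphi a b n (fst P)"

definition psi_minus ::
  "(int \<Rightarrow> real) \<Rightarrow> (int \<Rightarrow> real) \<Rightarrow> nat \<Rightarrow> int \<Rightarrow> complex \<times> complex \<Rightarrow> complex" where
  "psi_minus a b q n P = vartheta a b n (fst P) + m_minus a b q P * varphi a b n (fst P)"

text \<open>From here on, \<open>v\<close> is the perturbation of the diagonal, supported in \<open>{0..p}\<close>, and \<open>t\<close> is the
  coupling constant.\<close>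

definition f_minus ::
  "(int \<Rightarrow> real) \<Rightarrow> (int \<Rightarrow> real) \<Rightarrow> nat \<Rightarrow> (int \<Rightarrow> real) \<Rightarrow> real \<Rightarrow> complex \<times> complex
     \<Rightarrow> int \<Rightarrow> complex" where
  "f_minus a b q v t P =
     (THE y. jacobi_solution a (\<lambda>n. b n + t * v n) (fst P) y \<and>
             (\<forall>n\<le>0. y n = psi_minus a b q n P))"

definition f_plus ::
  "(int \<Rightarrow> real) \<Rightarrow> (int \<Rightarrow> real) \<Rightarrow> nat \<Rightarrow> nat \<Rightarrow> (int \<Rightarrow> real) \<Rightarrow> real \<Rightarrow> complex \<times> complex
     \<Rightarrow> int \<Rightarrow> complex" where
  "f_plus a b q p v t P =
     (THE y. jacobi_solution a (\<lambda>n. b n + t * v n) (fst P) y \<and>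
             (\<forall>n>int p. y n = psi_plus a b q n P))"

text \<open>The Wronskian of two solutions of the same equation does not depend on \<open>n\<close>; it is taken
  at \<open>n = 0\<close>.\<close>

definition alpha_fun ::
  "(int \<Rightarrow> real) \<Rightarrow> (int \<Rightarrow> real) \<Rightarrow> nat \<Rightarrow> nat \<Rightarrow> (int \<Rightarrow> real) \<Rightarrow> real \<Rightarrow> complex \<times> complex
     \<Rightarrow> complex" where
  "alpha_fun a b q p v t P =
     varphi a b (int q) (fst P) / (2 * \<i> * Omega P * of_real (a 0)) *
     wronskian a (f_minus a b q v t P) (f_plus a b q p v t P) 0"

definition xi_raw ::
  "(int \<Rightarrow> real) \<Rightarrow> (int \<Rightarrow> real) \<Rightarrow> nat \<Rightarrow> nat \<Rightarrow> (int \<Rightarrow> real) \<Rightarrow> real \<Rightarrow> complex \<times> complex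
     \<Rightarrow> complex" where
  "xi_raw a b q p v t P =
     varphi a b (int q) (fst P) / of_real (a 0) *
     wronskian a (f_minus a b q v t P) (f_plus a b q p v t P) 0"

text \<open>The functions \<open>m\<^sub>\<plusminus>\<close> are undefined at the zeros of \<open>varphi a b q\<close>; these singularities of \<open>\<xi>\<close> are
  removable.\<close>

definition xi ::
  "(int \<Rightarrow> real) \<Rightarrow> (int \<Rightarrow> real) \<Rightarrow> nat \<Rightarrow> nat \<Rightarrow> (int \<Rightarrow> real) \<Rightarrow> real \<Rightarrow> complex \<times> complex
     \<Rightarrow> complex" where
  "xi a b q p v t P =
     (if varphi a b (int q) (fst P) \<noteq> 0 then xi_raw a b q p v t P
      else Lim (at P within Surf a b q) (xi_raw a b q p v t))"

text \<open>The boundary value \<open>F(x + i0)\<close>, from the physical sheet, of a function on the surface.\<close>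

definition boundary_value ::
  "(int \<Rightarrow> real) \<Rightarrow> (int \<Rightarrow> real) \<Rightarrow> nat \<Rightarrow> (complex \<times> complex \<Rightarrow> complex) \<Rightarrow> real \<Rightarrow> complex" where
  "boundary_value a b q F x =
     Lim (at_right 0) (\<lambda>\<epsilon>. F (Complex x \<epsilon>, phys_sqrt a b q (Complex x \<epsilon>)))"

text \<open>The formula for \<open>J\<close> is imposed where \<open>\<Omega>(x + i0) \<noteq> 0\<close>, that is, at all but finitely many
  points of the spectrum; this determines the polynomial.\<close>

definition J_poly ::
  "(int \<Rightarrow> real) \<Rightarrow> (int \<Rightarrow> real) \<Rightarrow> nat \<Rightarrow> nat \<Rightarrow> (int \<Rightarrow> real) \<Rightarrow> real \<Rightarrow> real poly" where
  "J_poly a b q p v t = (THE J. \<forall>x\<in>spec0 a b q. (Delta a b q (of_real x))\<^sup>2 \<noteq> 1 \<longrightarrow>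
     of_real (poly J x) =
       2 * boundary_value a b q Omega x *
       of_real (Im (boundary_value a b q (alpha_fun a b q p v t) x)))"

definition is_state ::
  "(int \<Rightarrow> real) \<Rightarrow> (int \<Rightarrow> real) \<Rightarrow> nat \<Rightarrow> nat \<Rightarrow> (int \<Rightarrow> real) \<Rightarrow> real \<Rightarrow> complex \<times> complex \<Rightarrow> bool"
  where
  "is_state a b q p v t P \<longleftrightarrow> P \<in> Surf a b q - Surf0 a b q \<and> xi a b q p v t P = 0"

definition simple_state ::
  "(int \<Rightarrow> real) \<Rightarrow> (int \<Rightarrow> real) \<Rightarrow> nat \<Rightarrow> nat \<Rightarrow> (int \<Rightarrow> real) \<Rightarrow> real \<Rightarrow> complex \<times> complex \<Rightarrow> bool"
  where
  "simple_state a b q p v t P \<longleftrightarrow>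
     is_state a b q p v t P \<and> simple_zero a b q (xi a b q p v t) P"

definition bound_state ::
  "(int \<Rightarrow> real) \<Rightarrow> (int \<Rightarrow> real) \<Rightarrow> nat \<Rightarrow> nat \<Rightarrow> (int \<Rightarrow> real) \<Rightarrow> real \<Rightarrow> complex \<times> complex \<Rightarrow> bool"
  where
  "bound_state a b q p v t P \<longleftrightarrow> is_state a b q p v t P \<and> P \<in> sheet_plus a b q"

definition resonance ::
  "(int \<Rightarrow> real) \<Rightarrow> (int \<Rightarrow> real) \<Rightarrow> nat \<Rightarrow> nat \<Rightarrow> (int \<Rightarrow> real) \<Rightarrow> real \<Rightarrow> complex \<times> complex \<Rightarrow> bool"
  where
  "resonance a b q p v t P \<longleftrightarrow> is_state a b q p v t P \<and> P \<in> sheet_minus a b q"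

definition antibound_state ::
  "(int \<Rightarrow> real) \<Rightarrow> (int \<Rightarrow> real) \<Rightarrow> nat \<Rightarrow> nat \<Rightarrow> (int \<Rightarrow> real) \<Rightarrow> real \<Rightarrow> complex \<times> complex \<Rightarrow> bool"
  where
  "antibound_state a b q p v t P \<longleftrightarrow>
     resonance a b q p v t P \<and> P \<in> (\<Union>k\<in>{0..q}. gap_minus a b q k)"

definition virtual_state ::
  "(int \<Rightarrow> real) \<Rightarrow> (int \<Rightarrow> real) \<Rightarrow> nat \<Rightarrow> nat \<Rightarrow> (int \<Rightarrow> real) \<Rightarrow> real \<Rightarrow> complex \<times> complex \<Rightarrow> bool"
  where
  "virtual_state a b q p v t P \<longleftrightarrow> is_state a b q p v t P \<and>
     (\<exists>k\<in>{0..q}. fst P = of_real (lam_minus a b q k) \<or> fst P = of_real (lam_plus a b q k))"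

end

(* Write D = Delta^2 - 1 and let (z, w) with w^2 = D z be a point of the surface. Variation of the potential in
   the Wronskian of the Jost solutions gives xi = t A(z, t) + w (2 + t B(z, t)) with A, B polynomials in (z, t)
   that are real on the reals; moreover J = - t A, since w is imaginary over the spectrum. On the circle over a
   nonempty gap, states are therefore the solutions of w = - t A / (2 + t B), so |w| = O(t) and
   they lie near the edges of the gap, where w is a local parameter because the zeros of D at the edges are
   simple. A contraction estimate gives one state at each edge, D z = w^2 gives its position up to O(t^3), and
   the sign of w, that is of J, tells its sheet.

   The band structure rests on the interlacing of the zeros of the varphi_n: at the zeros of varphi_q one has
   vartheta_q varphi_{q+1} = 1, so |Delta| >= 1 there with alternating signs. Hence Delta^2 - c^2 has 2 q simple
   real zeros for 0 < c < 1, and the edges are their limits as c tends to 1. *)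

theory Submission
  imports Defs
begin

section \<open>Real polynomials and their complex values\<close>

text \<open>All spectral data are kept as real polynomials, so that sign and intermediate value
  arguments run on \<open>poly P x\<close>, and holomorphy arguments on \<open>cpoly P z\<close>,
  for one and the same object. The edges cannot be counted directly as zeros of \<Delta>^2 - 1: a
  closed gap gives a double zero, and sign changes do not see multiplicities. At a level c < 1 the
  zeros are simple and can be counted against the degree; a product formula then survives the limit
  c -> 1 whether or not two zeros merge. Most notions are descriptions (\<open>THE\<close>,
  \<open>SOME\<close>, \<open>Lim\<close>). Edges, Dirichlet eigenvalues, the points \<alpha>_k, the
  branch of the root, \<xi> and J therefore have to be shown to denote something before they can be
  computed with. That \<xi> has no poles comes from the surface: m_+ and m_- both have the
  denominator varphi_q, but their product loses one of the two factors modulo w^2 = D z, and the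
  prefactor of \<xi> cancels the other.\<close>

definition cpoly :: "real poly \<Rightarrow> complex \<Rightarrow> complex" where
  "cpoly P z = poly (map_poly of_real P) z"

lemma cpoly_pCons [simp]: "cpoly (pCons c P) z = of_real c + z * cpoly P z"
  by (simp add: cpoly_def map_poly_pCons)

lemma cpoly_0 [simp]: "cpoly 0 z = 0"
  by (simp add: cpoly_def)

lemma cpoly_1 [simp]: "cpoly 1 z = 1"
  by (simp add: cpoly_def)

lemma cpoly_numeral [simp]: "cpoly (numeral n) z = numeral n"
  by (simp add: numeral_poly)

lemma cpoly_add [simp]: "cpoly (P + Q) z = cpoly P z + cpoly Q z"
  by (induction P arbitrary: Q) (simp, case_tac Q, simp add: algebra_simps)

lemma cpoly_smult [simp]: "cpoly (smult c P) z = of_real c * cpoly P z"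
  by (induction P) (simp_all add: algebra_simps)

lemma cpoly_uminus [simp]: "cpoly (- P) z = - cpoly P z"
  using cpoly_smult[of "-1" P z] by simp

lemma cpoly_diff [simp]: "cpoly (P - Q) z = cpoly P z - cpoly Q z"
  using cpoly_add[of P "- Q" z] by simp

lemma cpoly_mult [simp]: "cpoly (P * Q) z = cpoly P z * cpoly Q z"
  by (induction P) (simp_all add: algebra_simps)

lemma cpoly_power [simp]: "cpoly (P ^ n) z = cpoly P z ^ n"
  by (induction n) simp_all

lemma cpoly_prod [simp]: "cpoly (\<Prod>i\<in>A. P i) z = (\<Prod>i\<in>A. cpoly (P i) z)"
  by (induction A rule: infinite_finite_induct) simp_all

lemma cpoly_of_real [simp]: "cpoly P (of_real x) = of_real (poly P x)"
  by (induction P) simp_all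

lemma cpoly_holomorphic: "cpoly P holomorphic_on A"
  unfolding cpoly_def by (intro holomorphic_intros)

lemma tendsto_cpoly [tendsto_intros]:
  "(f \<longlongrightarrow> l) F \<Longrightarrow> ((\<lambda>x. cpoly P (f x)) \<longlongrightarrow> cpoly P l) F"
  unfolding cpoly_def by (intro tendsto_intros)

lemma has_field_derivative_cpoly:
  "(cpoly P has_field_derivative cpoly (pderiv P) z) (at z)"
  by (induction P) (auto intro!: derivative_eq_intros simp: pderiv_pCons)

lemma cpoly_eq_0_finite:
  assumes "P \<noteq> 0"
  shows "finite {z. cpoly P z = 0}"
  unfolding cpoly_def using assms by (intro poly_roots_finite) (simp add: map_poly_eq_0_iff)

section \<open>Growth, factorization and sign changes of real polynomials\<close>

lemma poly_eventually_ge: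
  fixes P :: "real poly"
  assumes "degree P \<ge> 1" "lead_coeff P > 0"
  shows "\<exists>M. \<forall>x\<ge>M. poly P x \<ge> C"
proof -
  have "degree (P + [:-C:]) = degree P"
    using assms degree_add_eq_left[of "[:-C:]" P] by simp
  hence "lead_coeff (P + [:-C:]) = lead_coeff P"
    using assms by (cases "degree P") (auto simp: coeff_pCons)
  then obtain M where "\<And>x. x \<ge> M \<Longrightarrow> poly (P + [:-C:]) x \<ge> lead_coeff P"
    using poly_pinfty_gt_lc[of "P + [:-C:]"] assms by auto
  thus ?thesis using assms(2) by (intro exI[of _ M]) (force simp: algebra_simps)
qed

text \<open>The behaviour at minus infinity is that of the reflection \<open>Q\<close>, which by the
  factor (-1)^degree again has a positive leading coefficient.\<close>

lemma poly_large:
  fixes P :: "real poly"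
  assumes "degree P \<ge> 1" "lead_coeff P > 0"
  shows "\<exists>M. \<forall>x\<ge>M. poly P x \<ge> C \<and> (-1) ^ degree P * poly P (-x) \<ge> C"
proof -
  obtain M1 where M1: "\<And>x. x \<ge> M1 \<Longrightarrow> poly P x \<ge> C"
    using poly_eventually_ge[OF assms] by blast
  define Q where "Q = smult ((-1) ^ degree P) (P \<circ>\<^sub>p [:0, -1:])"
  have "degree Q = degree P"
    by (simp add: Q_def degree_pcompose)
  moreover have "lead_coeff Q = lead_coeff P"
    unfolding Q_def lead_coeff_smult by (subst lead_coeff_comp) simp_all
  ultimately obtain M2 where M2: "\<And>x. x \<ge> M2 \<Longrightarrow> poly Q x \<ge> C"
    using poly_eventually_ge[of Q] assms by metis
  show ?thesis
    using M1 M2 by (intro exI[of _ "max M1 M2"]) (auto simp: Q_def poly_pcompose)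
qed

text \<open>Both sides share the degree bound and the top coefficient, so as many common values as
  the degree, rather than one more, force equality.\<close>

lemma poly_eq_prod_roots:
  fixes P :: "real poly"
  assumes "finite A" "card A = degree P" "\<And>x. x \<in> A \<Longrightarrow> poly P x = 0"
  shows "P = smult (lead_coeff P) (\<Prod>x\<in>A. [:-x, 1:])"
proof (rule poly_eqI_degree_lead_coeff[where A = A and n = "degree P"])
  have m: "lead_coeff (\<Prod>x\<in>A. [:-x, 1::real:]) = 1"
    by (simp add: lead_coeff_prod)
  have d: "degree (\<Prod>x\<in>A. [:-x, 1::real:]) = degree P"
    using assms by (subst degree_prod_eq_sum_degree) auto
  show "coeff P (degree P) = coeff (smult (lead_coeff P) (\<Prod>x\<in>A. [:-x, 1:])) (degree P)"
    using m d by simp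
  show "degree (smult (lead_coeff P) (\<Prod>x\<in>A. [:- x, 1:])) \<le> degree P"
    using d degree_smult_le[of "lead_coeff P" "\<Prod>x\<in>A. [:-x, 1::real:]"] by simp
  show "poly P x = poly (smult (lead_coeff P) (\<Prod>x\<in>A. [:- x, 1:])) x" if "x \<in> A" for x
    using assms that by (auto simp: poly_prod)
qed (use assms in auto)

lemma poly_eq_prod_roots_indexed:
  fixes P :: "real poly"
  assumes "inj_on m {1..n}" "degree P = n" "\<And>k. k \<in> {1..n} \<Longrightarrow> poly P (m k) = 0"
  shows "poly P x = lead_coeff P * (\<Prod>k=1..n. x - m k)"
proof -
  have Q_eval: "poly (smult c (\<Prod>x\<in>m ` {1..n}. [:-x, 1:])) x = c * (\<Prod>y\<in>m ` {1..n}. x - y)" for c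
    by (simp add: poly_prod)
  have "P = smult (lead_coeff P) (\<Prod>x\<in>m ` {1..n}. [:-x, 1:])"
    using assms by (intro poly_eq_prod_roots) (auto simp: card_image)
  hence "poly P x = lead_coeff P * (\<Prod>y\<in>m ` {1..n}. x - y)"
    by (metis (no_types, lifting) Q_eval)
  thus ?thesis using assms(1) by (simp add: prod.reindex)
qed

text \<open>Each of the n - k negative factors contributes one sign. The index \<open>k\<close> will
  be the position of a point among ordered zeros or bands.\<close>

lemma prod_sign:
  fixes f :: "nat \<Rightarrow> real"
  assumes "k \<le> n" "\<And>j. 1 \<le> j \<Longrightarrow> j \<le> k \<Longrightarrow> f j > 0" "\<And>j. k < j \<Longrightarrow> j \<le> n \<Longrightarrow> f j < 0"
  shows "(-1) ^ (n - k) * (\<Prod>j=1..n. f j) > 0"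
  using assms
proof (induction n)
  case (Suc n)
  show ?case
  proof (cases "k \<le> n")
    case True
    have "0 < (-1) ^ (n - k) * (\<Prod>j=1..n. f j)"
      using Suc True by auto
    moreover have "f (Suc n) < 0"
      using Suc True by auto
    ultimately have "0 < ((-1) ^ (n - k) * (\<Prod>j=1..n. f j)) * (- f (Suc n))"
      by (metis mult_pos_pos neg_0_less_iff_less)
    moreover have "(-1) ^ (Suc n - k) * (\<Prod>j=1..Suc n. f j)
        = ((-1) ^ (n - k) * (\<Prod>j=1..n. f j)) * (- f (Suc n))"
      using True by (simp add: Suc_diff_le)
    ultimately show ?thesis by metis
  next
    case False
    hence "k = Suc n" using Suc by auto
    hence "(\<Prod>j=1..Suc n. f j) > 0" using Suc.prems by (intro prod_pos) auto
    thus ?thesis using \<open>k = Suc n\<close> by simp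
  qed
qed auto

text \<open>The sign is anchored at the last point, where a polynomial with positive leading
  coefficient is eventually positive; consecutive points then carry opposite signs.\<close>

lemma alternating_zeros:
  fixes P :: "real poly"
  assumes x: "strict_mono_on {0..n} x" and s: "\<And>k. k \<le> n \<Longrightarrow> (-1) ^ (n - k) * poly P (x k) > 0"
  obtains y where "\<And>k. k \<in> {1..n} \<Longrightarrow> x (k - 1) < y k \<and> y k < x k \<and> poly P (y k) = 0"
    "strict_mono_on {1..n} y"
proof -
  have "\<exists>y. x (k - 1) < y \<and> y < x k \<and> poly P y = 0" if k: "k \<in> {1..n}" for k
  proof -
    have lt: "x (k - 1) < x k"
      using x k by (auto simp: strict_mono_on_def)
    have "n - (k - 1) = Suc (n - k)" using k by auto
    hence "(-1) ^ (n - k) * poly P (x k) > 0" "(-1) ^ (n - k) * poly P (x (k - 1)) < 0"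
      using s[of k] s[of "k - 1"] k by auto
    hence "((-1) ^ (n - k) * poly P (x k)) * ((-1) ^ (n - k) * poly P (x (k - 1))) < 0"
      by (rule mult_pos_neg)
    hence "poly P (x (k - 1)) * poly P (x k) * (((-1) ^ (n - k))\<^sup>2) < 0"
      by (simp add: algebra_simps power2_eq_square)
    hence "poly P (x (k - 1)) * poly P (x k) < 0"
      by (simp add: power_mult[symmetric] mult.commute)
    from poly_IVT[OF lt this] show ?thesis by auto
  qed
  then obtain y where y: "\<And>k. k \<in> {1..n} \<Longrightarrow> x (k - 1) < y k \<and> y k < x k \<and> poly P (y k) = 0"
    by metis
  moreover have "strict_mono_on {1..n} y"
  proof (rule strict_mono_onI)
    fix i j assume ij: "i \<in> {1..n}" "j \<in> {1..n}" "i < j"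
    have "x i \<le> x (j - 1)"
    proof (cases "i = j - 1")
      case False
      thus ?thesis using strict_mono_onD[OF x, of i "j - 1"] ij by force
    qed auto
    thus "y i < y j" using y[of i] y[of j] ij by linarith
  qed
  ultimately show ?thesis by (rule that)
qed

section \<open>Solutions of the Jacobi equation\<close>

text \<open>Stated over a commutative ring, so that one recursion serves for polynomials in the
  spectral parameter and for complex sequences running in either direction.\<close>

fun lin_rec :: "(nat \<Rightarrow> 'a) \<Rightarrow> (nat \<Rightarrow> 'a) \<Rightarrow> 'a \<Rightarrow> 'a \<Rightarrow> nat \<Rightarrow> 'a::comm_ring_1" where
  "lin_rec \<alpha> \<beta> c0 c1 0 = c0"
| "lin_rec \<alpha> \<beta> c0 c1 (Suc 0) = c1"
| "lin_rec \<alpha> \<beta> c0 c1 (Suc (Suc k)) = \<alpha> k * lin_rec \<alpha> \<beta> c0 c1 (Suc k) + \<beta> k * lin_rec \<alpha> \<beta> c0 c1 k"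

text \<open>Two potentials that agree beyond \<open>m\<close> are allowed: this is how a perturbed
  Jost solution is compared with an unperturbed one off the support of the perturbation.\<close>

lemma jacobi_solution_agree_forward:
  assumes a: "\<And>n. a n > 0"
    and y: "jacobi_solution a b1 l y" "jacobi_solution a b2 l y'"
    and b: "\<And>n. n > m \<Longrightarrow> b1 n = b2 n"
    and e: "y m = y' m" "y (m + 1) = y' (m + 1)"
    and n: "n \<ge> m"
  shows "y n = y' n"
proof -
  have "y (m + int k) = y' (m + int k) \<and> y (m + int k + 1) = y' (m + int k + 1)" for k
  proof (induction k)
    case (Suc k)
    let ?n = "m + int k + 1"
    have "jacobi_op a b1 y ?n = l * y ?n" "jacobi_op a b2 y' ?n = l * y' ?n"
      using y by (auto simp: jacobi_solution_def)
    hence "of_real (a ?n) * y (?n + 1) = l * y ?n - of_real (a (?n - 1)) * y (?n - 1) - of_real (b1 ?n) * y ?n"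
      "of_real (a ?n) * y' (?n + 1) = l * y' ?n - of_real (a (?n - 1)) * y' (?n - 1) - of_real (b2 ?n) * y' ?n"
      by (simp_all add: jacobi_op_def algebra_simps)
    hence "complex_of_real (a ?n) * y (?n + 1) = of_real (a ?n) * y' (?n + 1)"
      using Suc b[of ?n] by simp
    hence "y (?n + 1) = y' (?n + 1)" using a[of ?n] by simp
    thus ?case using Suc by (simp add: add_ac)
  qed (use e in auto)
  from this[of "nat (n - m)"] n show ?thesis by simp
qed

lemma jacobi_solution_agree_backward:
  assumes a: "\<And>n. a n > 0"
    and y: "jacobi_solution a b1 l y" "jacobi_solution a b2 l y'"
    and b: "\<And>n. n \<le> m \<Longrightarrow> b1 n = b2 n"
    and e: "y m = y' m" "y (m + 1) = y' (m + 1)"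
    and n: "n \<le> m + 1"
  shows "y n = y' n"
proof -
  have "y (m + 1 - int k) = y' (m + 1 - int k) \<and> y (m - int k) = y' (m - int k)" for k
  proof (induction k)
    case (Suc k)
    let ?n = "m - int k"
    have "jacobi_op a b1 y ?n = l * y ?n" "jacobi_op a b2 y' ?n = l * y' ?n"
      using y by (auto simp: jacobi_solution_def)
    hence "of_real (a (?n - 1)) * y (?n - 1) = l * y ?n - of_real (a ?n) * y (?n + 1) - of_real (b1 ?n) * y ?n"
      "of_real (a (?n - 1)) * y' (?n - 1) = l * y' ?n - of_real (a ?n) * y' (?n + 1) - of_real (b2 ?n) * y' ?n"
      by (simp_all add: jacobi_op_def algebra_simps)
    moreover have "y (?n + 1) = y' (?n + 1)" using Suc by (simp add: algebra_simps)
    ultimately have "complex_of_real (a (?n - 1)) * y (?n - 1) = of_real (a (?n - 1)) * y' (?n - 1)"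
      using Suc b[of ?n] by simp
    hence "y (?n - 1) = y' (?n - 1)" using a[of "?n - 1"] by simp
    thus ?case using Suc by (simp add: algebra_simps)
  qed (use e in auto)
  from this[of "nat (m + 1 - n)"] n show ?thesis by simp
qed

lemma jacobi_solution_unique:
  assumes a: "\<And>n. a n > 0"
    and y: "jacobi_solution a b l y" "jacobi_solution a b l y'"
    and e: "y m = y' m" "y (m + 1) = y' (m + 1)"
  shows "y = y'"
proof
  fix n show "y n = y' n"
    using jacobi_solution_agree_forward[OF a y _ e, of n]
      jacobi_solution_agree_backward[OF a y _ e, of n] by linarith
qed

lemma jacobi_solution_exists:
  fixes c0 c1 :: complex
  assumes a: "\<And>n. a n > 0"
  shows "\<exists>y. jacobi_solution a b l y \<and> y m = c0 \<and> y (m + 1) = c1"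
proof -
  define A B where "A = (\<lambda>n. complex_of_real (a n))" and "B = (\<lambda>n. complex_of_real (b n))"
  have A: "A n \<noteq> 0" for n using a[of n] by (simp add: A_def)
  define f where "f = lin_rec (\<lambda>k. (l - B (m + int k + 1)) / A (m + int k + 1))
                              (\<lambda>k. - A (m + int k) / A (m + int k + 1)) c0 c1"
  \<comment> \<open>\<open>f\<close> runs to the right from \<open>m\<close> and \<open>g\<close> to
    the left from \<open>m + 1\<close>. They share the sites \<open>m\<close> and
    \<open>m + 1\<close>, so the equation at each site lies within one of the two
    recursions.\<close>
  define g where "g = lin_rec (\<lambda>k. (l - B (m - int k)) / A (m - int k - 1))
                              (\<lambda>k. - A (m - int k) / A (m - int k - 1)) c1 c0"
  define y where "y = (\<lambda>n. if n \<ge> m then f (nat (n - m)) else g (nat (m + 1 - n)))"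
  have f: "A (m + int k) * f k + A (m + int k + 1) * f (Suc (Suc k)) + B (m + int k + 1) * f (Suc k)
           = l * f (Suc k)" for k
    using A by (simp add: f_def field_simps)
  have g: "A (m - int k - 1) * g (Suc (Suc k)) + A (m - int k) * g k + B (m - int k) * g (Suc k)
           = l * g (Suc k)" for k
    using A by (simp add: g_def field_simps)
  have y1: "y (m + int k) = f k" for k by (simp add: y_def)
  have y2: "y (m + 1 - int k) = g k" for k
  proof -
    consider "k = 0" | "k = 1" | "k \<ge> 2" by linarith
    thus ?thesis by cases (auto simp: y_def f_def g_def)
  qed
  have "jacobi_op a b y n = l * y n" for n
  proof (cases "n > m")
    case True
    define k where "k = nat (n - m - 1)"
    have n: "n = m + int k + 1" using True by (simp add: k_def)
    show ?thesis
      using f[of k] y1[of k] y1[of "Suc k"] y1[of "Suc (Suc k)"]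
      by (simp add: jacobi_op_def n A_def B_def add_ac)
  next
    case False
    define k where "k = nat (m - n)"
    have n: "n = m - int k" using False by (simp add: k_def)
    show ?thesis
      using g[of k] y2[of k] y2[of "Suc k"] y2[of "Suc (Suc k)"]
      by (simp add: jacobi_op_def n A_def B_def algebra_simps)
  qed
  moreover have "y m = c0" "y (m + 1) = c1"
    by (auto simp: y_def f_def)
  ultimately show ?thesis by (auto simp: jacobi_solution_def)
qed

text \<open>Green's identity at one site, for potentials that differ by \<open>w\<close>. With w = 0
  it gives constancy of the Wronskian; with w = t v, summed over the support, it produces the terms
  of \<xi> that carry a factor t.\<close>

lemma wronskian_step:
  assumes "jacobi_solution a b l y" "jacobi_solution a (\<lambda>n. b n + w n) l z"
  shows "wronskian a y z n = wronskian a y z (n - 1) - of_real (w n) * y n * z n"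
proof -
  have *: "of_real (a n) * y (n + 1) = l * y n - of_real (a (n - 1)) * y (n - 1) - of_real (b n) * y n"
       "of_real (a n) * z (n + 1) = l * z n - of_real (a (n - 1)) * z (n - 1) - of_real (b n + w n) * z n"
    using assms[unfolded jacobi_solution_def jacobi_op_def, rule_format, of n] by (simp_all add: algebra_simps)
  have "wronskian a y z n = y n * (of_real (a n) * z (n + 1)) - z n * (of_real (a n) * y (n + 1))"
    by (simp add: wronskian_def algebra_simps)
  also have "\<dots> = wronskian a y z (n - 1) - of_real (w n) * y n * z n"
    unfolding * by (simp add: wronskian_def algebra_simps)
  finally show ?thesis .
qed

lemma wronskian_const:
  assumes "jacobi_solution a b l y" "jacobi_solution a b l z"
  shows "wronskian a y z (int n) = wronskian a y z 0"
proof (induction n)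
  case (Suc n)
  show ?case using wronskian_step[of a b l y "\<lambda>_. 0" z "int (Suc n)"] assms Suc by simp
qed auto

section \<open>The periodic background\<close>

locale jacobi_background =
  fixes a b :: "int \<Rightarrow> real" and q :: nat
  assumes q: "q \<ge> 1" and a_pos: "\<And>n. a n > 0" and a_per: "a (int q) = a 0"
begin

lemma a_nz [simp]: "a n \<noteq> 0"
  using a_pos[of n] by simp

definition jac_poly :: "real \<Rightarrow> real \<Rightarrow> nat \<Rightarrow> real poly" where
  "jac_poly c0 c1 = lin_rec (\<lambda>k. smult (1 / a (int k + 1)) [:- b (int k + 1), 1:])
     (\<lambda>k. [:- a (int k) / a (int k + 1):]) [:c0:] [:c1:]"

definition vphi :: "nat \<Rightarrow> real poly" where "vphi = jac_poly 0 1"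
definition vth :: "nat \<Rightarrow> real poly" where "vth = jac_poly 1 0"

lemma jac_poly_0 [simp]: "jac_poly c0 c1 0 = [:c0:]" "jac_poly c0 c1 (Suc 0) = [:c1:]"
  by (simp_all add: jac_poly_def)

lemma jac_poly_Suc_Suc: "jac_poly c0 c1 (Suc (Suc n)) =
   smult (1 / a (int n + 1)) ([:- b (int n + 1), 1:] * jac_poly c0 c1 (Suc n) - smult (a (int n)) (jac_poly c0 c1 n))"
  by (simp add: jac_poly_def smult_diff_right)

lemma jacobi_solution_jac_poly:
  assumes "jacobi_solution a b z y" "y 0 = of_real c0" "y 1 = of_real c1"
  shows "y (int n) = cpoly (jac_poly c0 c1 n) z"
proof -
  have "y (int n) = cpoly (jac_poly c0 c1 n) z \<and> y (int (Suc n)) = cpoly (jac_poly c0 c1 (Suc n)) z"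
  proof (induction n)
    case (Suc n)
    have "jacobi_op a b y (int n + 1) = z * y (int n + 1)"
      using assms(1) by (simp add: jacobi_solution_def)
    hence "of_real (a (int n + 1)) * y (int n + 2)
        = (z - of_real (b (int n + 1))) * y (int n + 1) - of_real (a (int n)) * y (int n)"
      by (simp add: jacobi_op_def algebra_simps)
    hence "y (int n + 2) = ((z - of_real (b (int n + 1))) * y (int n + 1) - of_real (a (int n)) * y (int n)) / of_real (a (int n + 1))"
      by (simp add: field_simps)
    also have "\<dots> = cpoly (jac_poly c0 c1 (Suc (Suc n))) z"
      using Suc unfolding jac_poly_Suc_Suc by (simp add: add_ac field_simps)
    finally show ?case using Suc by (simp add: algebra_simps)
  qed (use assms in auto)
  thus ?thesis by simp
qed

lemma jacobi_solution_The:
  "jacobi_solution a b z (THE y. jacobi_solution a b z y \<and> y 0 = c0 \<and> y 1 = c1) \<and>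
   (THE y. jacobi_solution a b z y \<and> y 0 = c0 \<and> y 1 = c1) 0 = c0 \<and>
   (THE y. jacobi_solution a b z y \<and> y 0 = c0 \<and> y 1 = c1) 1 = c1"
proof -
  obtain y where "jacobi_solution a b z y \<and> y 0 = c0 \<and> y 1 = c1"
    using jacobi_solution_exists[where a = a and b = b and l = z and m = 0 and ?c0.0 = c0 and ?c1.0 = c1] a_pos
    by auto
  moreover have "y' = y" if "jacobi_solution a b z y' \<and> y' 0 = c0 \<and> y' 1 = c1" for y'
    using jacobi_solution_unique[where a = a and b = b and l = z and m = 0 and y = y' and y' = y]
      a_pos calculation that by auto
  ultimately have "\<exists>!y. jacobi_solution a b z y \<and> y 0 = c0 \<and> y 1 = c1" by blast
  from theI'[OF this] show ?thesis .
qed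

lemma varphi_solution:
  "jacobi_solution a b z (\<lambda>n. varphi a b n z)" "varphi a b 0 z = 0" "varphi a b 1 z = 1"
  using jacobi_solution_The[of z 0 1] by (simp_all add: varphi_def)

lemma vartheta_solution:
  "jacobi_solution a b z (\<lambda>n. vartheta a b n z)" "vartheta a b 0 z = 1" "vartheta a b 1 z = 0"
  using jacobi_solution_The[of z 1 0] by (simp_all add: vartheta_def)

lemma varphi_eq: "varphi a b (int n) z = cpoly (vphi n) z"
  using jacobi_solution_jac_poly[of z "\<lambda>n. varphi a b n z" 0 1 n] varphi_solution[of z]
  by (simp add: vphi_def)

lemma vartheta_eq: "vartheta a b (int n) z = cpoly (vth n) z"
  using jacobi_solution_jac_poly[of z "\<lambda>n. vartheta a b n z" 1 0 n] vartheta_solution[of z]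
  by (simp add: vth_def)

lemma degree_jac_poly: "degree (jac_poly c0 c1 n) \<le> n - 1"
proof (induction n rule: induct_nat_012)
  case (ge2 n)
  have "degree ([:- b (int n + 1), 1:] * jac_poly c0 c1 (Suc n)) \<le> Suc n"
    using degree_mult_le[of "[:- b (int n + 1), 1:]" "jac_poly c0 c1 (Suc n)"] ge2 by simp
  moreover have "degree (smult (a (int n)) (jac_poly c0 c1 n)) \<le> Suc n"
    using ge2 degree_smult_le[of "a (int n)" "jac_poly c0 c1 n"] by linarith
  ultimately show ?case
    unfolding jac_poly_Suc_Suc by (simp add: degree_diff_le del: mult_pCons_left)
qed auto

text \<open>The coefficient is 1 / (a_1 ... a_n): every step of the recursion raises the degree by
  one and divides by one value of \<open>a\<close>.\<close>

lemma coeff_vphi: "coeff (vphi (Suc n)) n > 0"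
proof (induction n)
  case (Suc n)
  have "coeff (vphi (Suc n)) (Suc n) = 0" "coeff (vphi n) (Suc n) = 0"
    using degree_jac_poly[of 0 1 "Suc n"] degree_jac_poly[of 0 1 n]
    by (auto simp: vphi_def intro!: coeff_eq_0)
  hence "coeff (vphi (Suc (Suc n))) (Suc n) = coeff (vphi (Suc n)) n / a (int n + 1)"
    unfolding vphi_def jac_poly_Suc_Suc by simp
  thus ?case using Suc a_pos[of "int n + 1"] by simp
qed (simp add: vphi_def)

lemma degree_vphi [simp]: "degree (vphi (Suc n)) = n"
  using coeff_vphi[of n] degree_jac_poly[of 0 1 "Suc n"]
  by (intro antisym le_degree) (auto simp: vphi_def)

lemma vphi_nz [simp]: "vphi (Suc n) \<noteq> 0"
  using coeff_vphi[of n] by auto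

section \<open>The monodromy matrix and its discriminant\<close>

definition DeltaP :: "real poly" where "DeltaP = smult (1/2) (vphi (Suc q) + vth q)"
definition PhiP :: "real poly" where "PhiP = smult (1/2) (vphi (Suc q) - vth q)"
definition DP :: "real poly" where "DP = DeltaP\<^sup>2 - 1"

lemma Delta_eq: "Delta a b q z = cpoly DeltaP z"
  using varphi_eq[of "Suc q" z] vartheta_eq[of q z] by (simp add: Delta_def DeltaP_def add_ac)

lemma phi_eq: "phi a b q z = cpoly PhiP z"
  using varphi_eq[of "Suc q" z] vartheta_eq[of q z] by (simp add: phi_def PhiP_def add_ac)

lemma cpoly_DP: "cpoly DP z = (Delta a b q z)\<^sup>2 - 1"
  by (simp add: DP_def Delta_eq)

lemma poly_DP: "poly DP x = (poly DeltaP x)\<^sup>2 - 1"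
  by (simp add: DP_def)

lemma coeff_DeltaP: "coeff DeltaP q > 0"
  using coeff_vphi[of q] coeff_eq_0[of "vth q" q] degree_jac_poly[of 1 0 q] q
  by (simp add: DeltaP_def vth_def)

lemma degree_DeltaP [simp]: "degree DeltaP = q"
proof (rule antisym)
  show "degree DeltaP \<le> q"
    unfolding DeltaP_def using degree_jac_poly[of 1 0 q]
    by (auto simp: vth_def intro!: degree_add_le)
  show "q \<le> degree DeltaP"
    using coeff_DeltaP by (intro le_degree) auto
qed

text \<open>The matrix that sends (y_0, y_1) to (y_q, y_{q+1}) has determinant 1: the Wronskian is
  the same at 0 and at q, and carries there the equal factors a_0 and a_q.\<close>

lemma wronskian_q: "cpoly (vth q) z * cpoly (vphi (Suc q)) z - cpoly (vth (Suc q)) z * cpoly (vphi q) z = 1"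
proof -
  have 1: "vartheta a b (int q + 1) z = cpoly (vth (Suc q)) z" "varphi a b (int q + 1) z = cpoly (vphi (Suc q)) z"
    using varphi_eq[of "Suc q" z] vartheta_eq[of "Suc q" z] by (simp_all add: add.commute)
  have "wronskian a (\<lambda>n. vartheta a b n z) (\<lambda>n. varphi a b n z) (int q) = of_real (a 0)"
    using wronskian_const[OF vartheta_solution(1) varphi_solution(1), of z q]
      vartheta_solution[of z] varphi_solution[of z]
    by (simp add: wronskian_def)
  thus ?thesis
    unfolding wronskian_def 1 varphi_eq vartheta_eq a_per by simp
qed

lemma wronskian_q_real: "poly (vth q) x * poly (vphi (Suc q)) x - poly (vth (Suc q)) x * poly (vphi q) x = 1"
  using wronskian_q[of "of_real x"] unfolding cpoly_of_real
  by (metis of_real_diff of_real_mult of_real_eq_1_iff)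

text \<open>For the monodromy matrix, (trace / 2)^2 - det is the square of half the difference of
  the diagonal entries plus the product of the off-diagonal entries. \<open>DeltaP\<close> is the
  half trace and \<open>PhiP\<close> the half difference.\<close>

lemma DP_factor: "cpoly DP z = (cpoly PhiP z)\<^sup>2 + cpoly (vth (Suc q)) z * cpoly (vphi q) z"
  using wronskian_q[of z] by (simp add: DP_def DeltaP_def PhiP_def power2_eq_square field_simps)

lemma DP_factor_real: "poly DP x = (poly PhiP x)\<^sup>2 + poly (vth (Suc q)) x * poly (vphi q) x"
  using wronskian_q_real[of x] by (simp add: DP_def DeltaP_def PhiP_def power2_eq_square field_simps)

text \<open>Sturm's argument. The signs at the zeros of one polynomial, completed by the signs near
  plus and minus infinity, locate the zeros of the next. At those the recursion makes the polynomial
  after it a negative multiple of the first one, whose sign is read off by counting its zeros to the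
  left.\<close>

lemma vphi_interlacing:
  "\<exists>m. strict_mono_on {1..n} m \<and>
       (\<forall>k\<in>{1..n}. poly (vphi (Suc n)) (m k) = 0 \<and> (-1) ^ (Suc n - k) * poly (vphi (Suc (Suc n))) (m k) > 0)"
proof (induction n)
  case (Suc n)
  then obtain m where m: "strict_mono_on {1..n} m"
    and m0: "\<And>k. k \<in> {1..n} \<Longrightarrow> poly (vphi (Suc n)) (m k) = 0"
    and m1: "\<And>k. k \<in> {1..n} \<Longrightarrow> (-1) ^ (Suc n - k) * poly (vphi (Suc (Suc n))) (m k) > 0"
    by auto
  have "lead_coeff (vphi (Suc (Suc n))) > 0"
    using coeff_vphi[of "Suc n"] by simp
  then obtain M where M: "\<And>x. x \<ge> M \<Longrightarrow> poly (vphi (Suc (Suc n))) x \<ge> 1 \<and> 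
       (-1) ^ Suc n * poly (vphi (Suc (Suc n))) (-x) \<ge> 1"
    using poly_large[of "vphi (Suc (Suc n))" 1] by auto
  \<comment> \<open>\<open>B\<close> lies beyond all old zeros and in the range where the leading
    term decides the sign, so \<open>- B\<close> and \<open>B\<close> complete the list of test
    points.\<close>
  define B where "B = max 1 (max M (1 + Max (insert 0 ((\<lambda>k. \<bar>m k\<bar>) ` {1..n}))))"
  have B: "\<bar>m k\<bar> < B" if "k \<in> {1..n}" for k
  proof -
    have "\<bar>m k\<bar> \<le> Max (insert 0 ((\<lambda>k. \<bar>m k\<bar>) ` {1..n}))"
      using that by (intro Max_ge) auto
    thus ?thesis unfolding B_def by linarith
  qed
  have B': "B \<ge> M" "B \<ge> 1" by (auto simp: B_def)
  define x where "x = (\<lambda>k. if k = 0 then - B else if k = Suc n then B else m k)"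
  have x: "strict_mono_on {0..Suc n} x"
  proof (rule strict_mono_onI)
    fix i j assume ij: "i \<in> {0..Suc n}" "j \<in> {0..Suc n}" "i < j"
    show "x i < x j"
      using ij B' B[of i] B[of j] strict_mono_onD[OF m, of i j] by (auto simp: x_def)
  qed
  have sx: "(-1) ^ (Suc n - k) * poly (vphi (Suc (Suc n))) (x k) > 0" if "k \<le> Suc n" for k
    using that m1[of k] M[of B] B' by (auto simp: x_def)
  obtain y where y: "\<And>k. k \<in> {1..Suc n} \<Longrightarrow> x (k - 1) < y k \<and> y k < x k \<and> poly (vphi (Suc (Suc n))) (y k) = 0"
    and ym: "strict_mono_on {1..Suc n} y"
    using alternating_zeros[OF x sx] by blast
  have "(-1) ^ (Suc (Suc n) - k) * poly (vphi (Suc (Suc (Suc n)))) (y k) > 0" if k: "k \<in> {1..Suc n}" for k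
  proof -
    have "poly (vphi (Suc n)) (y k) = lead_coeff (vphi (Suc n)) * (\<Prod>j=1..n. y k - m j)"
      using m m0 by (intro poly_eq_prod_roots_indexed strict_mono_on_imp_inj_on) auto
    \<comment> \<open>Exactly the first k - 1 of the old zeros lie to the left of
      \<open>y k\<close>.\<close>
    moreover have "(-1) ^ (n - (k - 1)) * (\<Prod>j=1..n. y k - m j) > 0"
    proof (rule prod_sign)
      show "k - 1 \<le> n" using k by auto
      fix j :: nat assume j: "1 \<le> j"
      { assume "j \<le> k - 1"
        hence "x j \<le> x (k - 1)" 
          using j k strict_mono_onD[OF x, of j "k - 1"] by (cases "j = k - 1") force+
        moreover have "x j = m j" using j k \<open>j \<le> k - 1\<close> by (auto simp: x_def)
        ultimately show "0 < y k - m j" using y[OF k] by linarith }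
    next
      fix j :: nat assume j: "k - 1 < j" "j \<le> n"
      have "x k \<le> x j" 
        using j k strict_mono_onD[OF x, of k j] by (cases "j = k") force+
      moreover have "x j = m j" using j k by (auto simp: x_def)
      ultimately show "y k - m j < 0" using y[OF k] by linarith
    qed
    ultimately have *: "(-1) ^ (n - (k - 1)) * poly (vphi (Suc n)) (y k) > 0"
      using coeff_vphi[of n] by (simp add: mult.left_commute)
    have "poly (vphi (Suc (Suc (Suc n)))) (y k) = - (a (int (Suc n)) / a (int (Suc n) + 1)) * poly (vphi (Suc n)) (y k)"
      using y[OF k] by (subst vphi_def, subst jac_poly_Suc_Suc) (simp add: vphi_def)
    moreover have "Suc (Suc n) - k = Suc (n - (k - 1))" using k by auto
    ultimately have "(-1) ^ (Suc (Suc n) - k) * poly (vphi (Suc (Suc (Suc n)))) (y k) =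
       (a (int (Suc n)) / a (int (Suc n) + 1)) * ((-1) ^ (n - (k - 1)) * poly (vphi (Suc n)) (y k))"
      by simp
    thus ?thesis using * a_pos by (metis divide_pos_pos mult_pos_pos)
  qed
  thus ?case using y ym by blast
qed auto

text \<open>When the off-diagonal entry \<open>vphi q\<close> vanishes, the diagonal entries of the
  monodromy matrix are reciprocal, and the mean of y > 0 and 1 / y is at least 1.\<close>

lemma Delta_at_vphi_zero:
  assumes "poly (vphi q) x = 0" "s * poly (vphi (Suc q)) x > 0" "s\<^sup>2 = 1"
  shows "s * poly DeltaP x \<ge> 1"
proof -
  define y where "y = s * poly (vphi (Suc q)) x"
  have "poly (vth q) x * poly (vphi (Suc q)) x = 1"
    using wronskian_q_real[of x] assms by simp
  hence "s * poly (vth q) x * y = 1"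
    using assms(3) by (simp add: y_def power2_eq_square algebra_simps)
  moreover have "y > 0" using assms(2) by (simp add: y_def)
  ultimately have "s * poly (vth q) x = 1 / y" by (simp add: nonzero_eq_divide_eq)
  hence "s * poly DeltaP x = (y + 1 / y) / 2"
    by (simp add: DeltaP_def y_def algebra_simps)
  moreover have "y + 1 / y \<ge> 2"
  proof -
    have "(y - 1)\<^sup>2 / y \<ge> 0" using assms(2) by (simp add: y_def)
    thus ?thesis using assms(2) by (simp add: y_def[symmetric] field_simps power2_eq_square)
  qed
  ultimately show ?thesis by simp
qed

text \<open>The inner points are the zeros of \<open>vphi q\<close>; the outer two are taken where
  the leading term of \<open>DeltaP\<close> already dominates.\<close>

lemma Delta_alternation:
  obtains x where "strict_mono_on {0..q} x" "\<And>k. k \<le> q \<Longrightarrow> (-1) ^ (q - k) * poly DeltaP (x k) \<ge> 1"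
    "\<And>z. poly (vphi q) z = 0 \<longleftrightarrow> z \<in> x ` {1..q - 1}"
proof -
  obtain n where qn: "q = Suc n" using q by (cases q) auto
  obtain m where m: "strict_mono_on {1..n} m"
    and m0: "\<And>k. k \<in> {1..n} \<Longrightarrow> poly (vphi (Suc n)) (m k) = 0"
    and m1: "\<And>k. k \<in> {1..n} \<Longrightarrow> (-1) ^ (Suc n - k) * poly (vphi (Suc (Suc n))) (m k) > 0"
    using vphi_interlacing[of n] by auto
  obtain M where M: "\<And>x. x \<ge> M \<Longrightarrow> poly DeltaP x \<ge> 1 \<and> (-1) ^ q * poly DeltaP (-x) \<ge> 1"
    using poly_large[of DeltaP 1] coeff_DeltaP q by auto
  define B where "B = max 1 (max M (1 + Max (insert 0 ((\<lambda>k. \<bar>m k\<bar>) ` {1..n}))))"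
  have B: "\<bar>m k\<bar> < B" if "k \<in> {1..n}" for k
  proof -
    have "\<bar>m k\<bar> \<le> Max (insert 0 ((\<lambda>k. \<bar>m k\<bar>) ` {1..n}))"
      using that by (intro Max_ge) auto
    thus ?thesis unfolding B_def by linarith
  qed
  have B': "B \<ge> M" "B \<ge> 1" by (auto simp: B_def)
  define x where "x = (\<lambda>k. if k = 0 then - B else if k = q then B else m k)"
  have x: "strict_mono_on {0..q} x"
  proof (rule strict_mono_onI)
    fix i j assume ij: "i \<in> {0..q}" "j \<in> {0..q}" "i < j"
    show "x i < x j"
      using ij B' B[of i] B[of j] strict_mono_onD[OF m, of i j] by (auto simp: x_def qn)
  qed
  have "(-1) ^ (q - k) * poly DeltaP (x k) \<ge> 1" if k: "k \<le> q" for k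
  proof -
    consider "k = 0" | "k = q" "k \<noteq> 0" | "k \<in> {1..n}" using k unfolding qn by fastforce
    thus ?thesis
    proof cases
      case 3
      thus ?thesis using m0[OF 3] m1[OF 3] Delta_at_vphi_zero[of "m k" "(-1) ^ (q - k)"]
        by (auto simp: x_def qn power_mult[symmetric] mult.commute)
    qed (use M[of B] B' in \<open>auto simp: x_def\<close>)
  qed
  moreover have "poly (vphi q) z = 0 \<longleftrightarrow> z \<in> x ` {1..q - 1}" for z
  proof -
    have "poly (vphi q) z = lead_coeff (vphi q) * (\<Prod>j=1..n. z - m j)"
      using m m0 by (intro poly_eq_prod_roots_indexed strict_mono_on_imp_inj_on) (auto simp: qn)
    hence "poly (vphi q) z = 0 \<longleftrightarrow> z \<in> m ` {1..n}"
      using coeff_vphi[of n] by (auto simp: qn)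
    also have "m ` {1..n} = x ` {1..q - 1}" by (intro image_cong) (auto simp: x_def qn)
    finally show ?thesis .
  qed
  ultimately show ?thesis using that[OF x] by blast
qed

end

section \<open>Band edges\<close>

text \<open>Any sequence that increases to 1 inside (0, 1) would serve; the shift by 2 makes this
  one start at 1/2.\<close>

definition level :: "nat \<Rightarrow> real" where "level n = 1 - 1 / (real n + 2)"

lemma level: "0 < level n" "level n < 1" "level n < level (Suc n)"
  by (auto simp: level_def field_simps)

lemma level_tendsto: "level \<longlonglongrightarrow> 1"
proof -
  have "(\<lambda>n. 1 - inverse (real (Suc (Suc n)))) \<longlonglongrightarrow> 1 - 0"
    by (intro tendsto_intros LIMSEQ_Suc[OF LIMSEQ_inverse_real_of_nat])
  thus ?thesis by (simp add: level_def[abs_def] inverse_eq_divide add_ac)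
qed

text \<open>The next point is sought between \<open>l\<close> and the current one, where the next
  lower value must be attained. The monotonicity comes from this choice and not from
  \<open>P\<close>, and it makes the sequence convergent.\<close>

lemma level_sequence_left:
  fixes P :: "real poly"
  assumes "l < m" "poly P l \<le> -1" "poly P m = 0"
  shows "\<exists>u. decseq u \<and> (\<forall>n. l < u n \<and> u n < m \<and> poly P (u n) = - level n)"
proof -
  have "\<exists>u. \<forall>n. (l < u n \<and> u n < m \<and> poly P (u n) = - level n) \<and> u (Suc n) < u n"
  proof (rule dependent_nat_choice)
    have "\<exists>x>l. x < m \<and> poly (P + [:level 0:]) x = 0"
      using assms level[of 0] poly_IVT_pos[of l m "P + [:level 0:]"] by auto
    thus "\<exists>x. l < x \<and> x < m \<and> poly P x = - level 0" by (auto simp: add_eq_0_iff2)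
  next
    fix x n assume x: "l < x \<and> x < m \<and> poly P x = - level n"
    have "\<exists>y>l. y < x \<and> poly (P + [:level (Suc n):]) y = 0"
      using assms x level[of n] level[of "Suc n"] poly_IVT_pos[of l x "P + [:level (Suc n):]"] by auto
    thus "\<exists>y. (l < y \<and> y < m \<and> poly P y = - level (Suc n)) \<and> y < x"
      using x by (force simp: add_eq_0_iff2)
  qed
  then obtain u where u: "\<And>n. (l < u n \<and> u n < m \<and> poly P (u n) = - level n) \<and> u (Suc n) < u n"
    by blast
  hence "decseq u" by (intro decseq_SucI) (simp add: less_imp_le)
  thus ?thesis using u by blast
qed

text \<open>The reflection Q(x) = - P(- x) exchanges the two sides.\<close>

lemma level_sequence_right:
  fixes P :: "real poly"
  assumes "m < r" "poly P m = 0" "poly P r \<ge> 1"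
  shows "\<exists>w. incseq w \<and> (\<forall>n. m < w n \<and> w n < r \<and> poly P (w n) = level n)"
proof -
  define Q where "Q = - (P \<circ>\<^sub>p [:0, -1:])"
  have Q: "poly Q x = - poly P (-x)" for x by (simp add: Q_def poly_pcompose)
  obtain u where u: "decseq u" "\<And>n. - r < u n \<and> u n < - m \<and> poly Q (u n) = - level n"
    using level_sequence_left[of "-r" "-m" Q] assms Q by auto
  show ?thesis
    using u Q by (intro exI[of _ "\<lambda>n. - u n"]) (auto simp: decseq_def incseq_def minus_less_iff less_minus_iff)
qed

text \<open>A zero of \<open>P\<close> inside the interval separates the two sequences. They move
  away from each other, so that their limits, the two edges of a band, stay distinct.\<close>

lemma level_sequences:
  fixes P :: "real poly"
  assumes "l < r" "s * poly P l \<le> -1" "s * poly P r \<ge> 1" "s\<^sup>2 = 1"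
  shows "\<exists>u w. decseq u \<and> incseq w \<and> (\<forall>n. l < u n \<and> u n < w n \<and> w n < r \<and>
           (poly P (u n))\<^sup>2 = (level n)\<^sup>2 \<and> (poly P (w n))\<^sup>2 = (level n)\<^sup>2)"
proof -
  define Q where "Q = smult s P"
  have Q: "(poly Q x)\<^sup>2 = (poly P x)\<^sup>2" for x
    using assms(4) by (simp add: Q_def power_mult_distrib)
  obtain m where m: "l < m" "m < r" "poly Q m = 0"
    using poly_IVT_pos[of l r Q] assms by (auto simp: Q_def)
  obtain u where u: "decseq u" "\<And>n. l < u n \<and> u n < m \<and> poly Q (u n) = - level n"
    using level_sequence_left[of l m Q] m assms by (auto simp: Q_def)
  obtain w where w: "incseq w" "\<And>n. m < w n \<and> w n < r \<and> poly Q (w n) = level n"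
    using level_sequence_right[of m r Q] m assms by (auto simp: Q_def)
  show ?thesis
  proof (intro exI conjI allI)
    fix n
    show "u n < w n" using u(2)[of n] w(2)[of n] by linarith
    show "(poly P (u n))\<^sup>2 = (level n)\<^sup>2" "(poly P (w n))\<^sup>2 = (level n)\<^sup>2"
      using Q[of "u n"] Q[of "w n"] u(2)[of n] w(2)[of n] by simp_all
  qed (use u w in auto)
qed

context jacobi_background
begin

text \<open>For \<open>0 < c < 1\<close> the polynomial \<open>\<Delta>\<^sup>2 - c\<^sup>2\<close> has \<open>2q\<close> simple real zeros; the edges are their
  limits as \<open>c \<rightarrow> 1\<close>.\<close>

lemma edge_enumeration_exists: "\<exists>lm lp. is_edge_enumeration a b q lm lp"
proof -
  obtain x where x: "strict_mono_on {0..q} x" and xD: "\<And>k. k \<le> q \<Longrightarrow> (-1) ^ (q - k) * poly DeltaP (x k) \<ge> 1"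
    using Delta_alternation by metis
  have "\<exists>u w. decseq u \<and> incseq w \<and> (\<forall>n. x (k - 1) < u n \<and> u n < w n \<and> w n < x k \<and>
           (poly DeltaP (u n))\<^sup>2 = (level n)\<^sup>2 \<and> (poly DeltaP (w n))\<^sup>2 = (level n)\<^sup>2)"
    if k: "k \<in> {1..q}" for k
  proof (rule level_sequences)
    show "x (k - 1) < x k" using x k by (auto simp: strict_mono_on_def)
    show "1 \<le> (-1) ^ (q - k) * poly DeltaP (x k)" using xD[of k] k by auto
    have "q - (k - 1) = Suc (q - k)" using k by auto
    thus "(-1) ^ (q - k) * poly DeltaP (x (k - 1)) \<le> -1" using xD[of "k - 1"] k by auto
    show "((- 1) ^ (q - k))\<^sup>2 = (1::real)" by (simp add: power_mult[symmetric] mult.commute)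
  qed
  then obtain U W where U: "\<And>k. k \<in> {1..q} \<Longrightarrow> decseq (U k)" and W: "\<And>k. k \<in> {1..q} \<Longrightarrow> incseq (W k)"
    and UW: "\<And>k n. k \<in> {1..q} \<Longrightarrow> x (k - 1) < U k n \<and> U k n < W k n \<and> W k n < x k \<and>
           (poly DeltaP (U k n))\<^sup>2 = (level n)\<^sup>2 \<and> (poly DeltaP (W k n))\<^sup>2 = (level n)\<^sup>2"
    by metis
  have "\<exists>l. U k \<longlonglongrightarrow> l" if "k \<in> {1..q}" for k
    using decseq_convergent[OF U[OF that], of "x (k - 1)"] UW[OF that] less_imp_le by metis
  then obtain LU where LU: "\<And>k. k \<in> {1..q} \<Longrightarrow> U k \<longlonglongrightarrow> LU k" by metis
  have "\<exists>l. W k \<longlonglongrightarrow> l" if "k \<in> {1..q}" for k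
    using incseq_convergent[OF W[OF that], of "x k"] UW[OF that] less_imp_le by metis
  then obtain LW where LW: "\<And>k. k \<in> {1..q} \<Longrightarrow> W k \<longlonglongrightarrow> LW k" by metis
  have lt: "LU k < LW k" if k: "k \<in> {1..q}" for k
    using decseq_ge[OF U[OF k] LU[OF k], of 0] incseq_le[OF W[OF k] LW[OF k], of 0] UW[OF k, of 0]
    by linarith
  have LUx: "x (k - 1) \<le> LU k" if k: "k \<in> {1..q}" for k
    using LIMSEQ_le_const[OF LU[OF k], of "x (k - 1)"] UW[OF k] less_imp_le by blast
  have LWx: "LW k \<le> x k" if k: "k \<in> {1..q}" for k
    using LIMSEQ_le_const2[OF LW[OF k], of "x k"] UW[OF k] less_imp_le by blast
  \<comment> \<open>\<open>LU k\<close> and \<open>LW k\<close> are the ends of the k-th band. The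
    remaining values at 0 and q are set by the convention that the two edges with the same index
    coincide there.\<close>
  define lp where "lp = (\<lambda>k. if k < q then LU (Suc k) else LW q)"
  define lm where "lm = (\<lambda>k. if k = 0 then LU 1 else LW k)"
  define c where "c = (coeff DeltaP q)\<^sup>2"
  have fin: "(Delta a b q z)\<^sup>2 - (of_real (level n))\<^sup>2
      = of_real c * (\<Prod>k=1..q. (z - of_real (U k n)) * (z - of_real (W k n)))" for z n
  proof -
    define P where "P = DeltaP\<^sup>2 + [:- (level n)\<^sup>2:]"
    have dD: "degree (DeltaP\<^sup>2) = 2 * q"
    proof -
      have "DeltaP \<noteq> 0" using coeff_DeltaP by auto
      thus ?thesis by (simp add: degree_power_eq)
    qed
    have "degree (DeltaP\<^sup>2 + [:- (level n)\<^sup>2:]) = degree (DeltaP\<^sup>2)"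
      using q dD by (intro degree_add_eq_left) simp
    hence dP: "degree P = 2 * q" using dD by (simp add: P_def)
    have "lead_coeff P = lead_coeff (DeltaP\<^sup>2)"
      unfolding dP dD using q by (cases q) (auto simp: P_def)
    hence lP: "lead_coeff P = c" by (simp add: c_def lead_coeff_power)
    \<comment> \<open>The Boolean selects the left or the right zero in the k-th interval, so that
      one injective map lists all 2 q zeros.\<close>
    define f where "f = (\<lambda>(k, b). if b then U k n else W k n)"
    define I where "I = {1..q} \<times> (UNIV :: bool set)"
    have fk: "x (k - 1) < f (k, b) \<and> f (k, b) < x k" if "k \<in> {1..q}" for k b
      using UW[OF that, of n] by (auto simp: f_def)
    have lt': "f (i, b) < f (j, b')" if "i \<in> {1..q}" "j \<in> {1..q}" "i < j" for i j b b'
    proof -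
      have "x i \<le> x (j - 1)" using that strict_mono_onD[OF x, of i "j - 1"] by (cases "i = j - 1") force+
      thus ?thesis using fk[OF that(1), of b] fk[OF that(2), of b'] by linarith
    qed
    have inj: "inj_on f I"
    proof (rule inj_onI)
      fix y z assume yz: "y \<in> I" "z \<in> I" "f y = f z"
      obtain i b j b' where ij: "y = (i, b)" "z = (j, b')" by (cases y, cases z)
      have "i = j"
        using lt'[of i j b b'] lt'[of j i b' b] yz unfolding ij I_def by (cases i j rule: linorder_cases) auto
      thus "y = z" using yz UW[of i n] unfolding ij I_def f_def by (auto split: if_splits)
    qed
    have "P = smult (lead_coeff P) (\<Prod>y\<in>f ` I. [:-y, 1:])"
    proof (rule poly_eq_prod_roots)
      show "card (f ` I) = degree P"
        using inj dP by (simp add: card_image I_def card_cartesian_product)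
      fix y assume "y \<in> f ` I"
      thus "poly P y = 0" using UW[of _ n] by (auto simp: f_def I_def P_def)
    qed (simp add: I_def)
    hence "cpoly P z = cpoly (smult (lead_coeff P) (\<Prod>y\<in>f ` I. [:-y, 1:])) z" by simp
    also have "\<dots> = of_real c * (\<Prod>y\<in>I. z - of_real (f y))"
      by (simp add: lP prod.reindex[OF inj])
    also have "(\<Prod>y\<in>I. z - of_real (f y)) = (\<Prod>k=1..q. \<Prod>b\<in>UNIV. z - of_real (f (k, b)))"
      unfolding I_def by (simp add: prod.cartesian_product)
    also have "\<dots> = (\<Prod>k=1..q. (z - of_real (U k n)) * (z - of_real (W k n)))"
      by (intro prod.cong refl) (simp add: UNIV_bool f_def mult.commute)
    finally show ?thesis by (simp add: P_def Delta_eq)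
  qed
  \<comment> \<open>For fixed z the product depends continuously on its zeros, so the factorization
    persists in the limit, where \<open>LW k\<close> and \<open>LU (Suc k)\<close> may
    coincide.\<close>
  have "(Delta a b q z)\<^sup>2 - 1 = of_real c * (\<Prod>k=1..q. (z - of_real (lp (k - 1))) * (z - of_real (lm k)))" for z
  proof (rule LIMSEQ_unique)
    show "(\<lambda>n. (Delta a b q z)\<^sup>2 - (of_real (level n))\<^sup>2) \<longlonglongrightarrow> (Delta a b q z)\<^sup>2 - 1"
      using tendsto_diff[OF tendsto_const tendsto_power[OF tendsto_of_real[OF level_tendsto]]] by fastforce
    have "lp (k - 1) = LU k" "lm k = LW k" if "k \<in> {1..q}" for k
      using that by (auto simp: lp_def lm_def)
    thus "(\<lambda>n. (Delta a b q z)\<^sup>2 - (of_real (level n))\<^sup>2) \<longlonglongrightarrow> 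
        of_real c * (\<Prod>k=1..q. (z - of_real (lp (k - 1))) * (z - of_real (lm k)))"
      unfolding fin using LU LW by (intro tendsto_intros) auto
  qed
  moreover have "lm k \<le> lp k" if "k \<in> {1..q - 1}" for k
    using LWx[of k] LUx[of "Suc k"] that by (auto simp: lm_def lp_def)
  moreover have "lp (k - 1) < lm k" if "k \<in> {1..q}" for k
    using that lt[of k] by (auto simp: lm_def lp_def)
  ultimately show ?thesis
    using q unfolding is_edge_enumeration_def
    by (intro exI[of _ lm] exI[of _ lp] conjI exI[of _ "of_real c"]) (auto simp: lm_def lp_def)
qed

section \<open>Order of the edges and the sign of D\<close>

abbreviation lm :: "nat \<Rightarrow> real" where "lm \<equiv> lam_minus a b q"
abbreviation lp :: "nat \<Rightarrow> real" where "lp \<equiv> lam_plus a b q"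

lemma edge_enumeration: "is_edge_enumeration a b q lm lp"
proof -
  have "\<exists>e. is_edge_enumeration a b q (fst e) (snd e)"
    using edge_enumeration_exists by auto
  thus ?thesis unfolding lam_minus_def lam_plus_def edges_def by (rule someI_ex)
qed

lemma lp_lm_Suc: "k \<in> {1..q} \<Longrightarrow> lp (k - 1) < lm k"
  and lm_0: "lm 0 = lp 0" and lp_q: "lp q = lm q"
  using edge_enumeration by (auto simp: is_edge_enumeration_def)

lemma lm_le_lp: "k \<le> q \<Longrightarrow> lm k \<le> lp k"
  using edge_enumeration lm_0 lp_q by (cases "k = 0 \<or> k = q") (auto simp: is_edge_enumeration_def)

lemma lp_less_lm: "i < j \<Longrightarrow> j \<le> q \<Longrightarrow> lp i < lm j"
proof (induction j)
  case (Suc j)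
  show ?case
  proof (cases "i = j")
    case True thus ?thesis using lp_lm_Suc[of "Suc j"] Suc by auto
  next
    case False
    hence "lp i < lm j" using Suc by auto
    also have "lm j \<le> lp j" using lm_le_lp[of j] Suc by auto
    also have "lp j < lm (Suc j)" using lp_lm_Suc[of "Suc j"] Suc by auto
    finally show ?thesis .
  qed
qed auto

lemma lm_mono: "i \<le> j \<Longrightarrow> j \<le> q \<Longrightarrow> lm i \<le> lm j"
  using lp_less_lm[of i j] lm_le_lp[of i] by (cases "i = j") auto

lemma lp_mono: "i \<le> j \<Longrightarrow> j \<le> q \<Longrightarrow> lp i \<le> lp j"
  using lp_less_lm[of i j] lm_le_lp[of j] by (cases "i = j") auto

definition edge_const :: real where "edge_const = (SOME c. c > 0 \<and>
  (\<forall>z. cpoly DP z = of_real c * (\<Prod>k=1..q. (z - of_real (lp (k - 1))) * (z - of_real (lm k)))))"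

text \<open>The enumeration provides only a complex constant. At a point beyond the last edge where
  \<open>DeltaP\<close> is at least 2, both D and the product are positive, which makes the constant
  positive.\<close>

lemma edge_const: "edge_const > 0"
  and DP_prod: "cpoly DP z = of_real edge_const * (\<Prod>k=1..q. (z - of_real (lp (k - 1))) * (z - of_real (lm k)))"
proof -
  obtain c where c: "\<And>z. cpoly DP z = c * (\<Prod>k=1..q. (z - of_real (lp (k - 1))) * (z - of_real (lm k)))"
    using edge_enumeration by (auto simp: is_edge_enumeration_def cpoly_DP)
  obtain M where M: "\<And>x. x \<ge> M \<Longrightarrow> poly DeltaP x \<ge> 2"
    using poly_large[of DeltaP 2] coeff_DeltaP q by auto
  define x where "x = max M (lm q + 1)"
  define p where "p = (\<Prod>k=1..q. (x - lp (k - 1)) * (x - lm k))"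
  have p: "p > 0" unfolding p_def
  proof (intro prod_pos mult_pos_pos)
    fix k assume "k \<in> {1..q}"
    hence "lm k \<le> lm q" "lp (k - 1) < lm k" using lm_mono[of k q] lp_lm_Suc[of k] by auto
    thus "x - lp (k - 1) > 0" "x - lm k > 0" by (auto simp: x_def)
  qed
  have "poly DeltaP x \<ge> 2" using M[of x] by (simp add: x_def)
  hence "(poly DeltaP x)\<^sup>2 \<ge> 2\<^sup>2" by (intro power_mono) auto
  hence D: "poly DP x > 0" by (simp add: poly_DP)
  have "of_real (poly DP x) = c * of_real p"
    using c[of "of_real x"] unfolding cpoly_of_real p_def by simp
  hence "c = of_real (poly DP x / p)" using p by (simp add: field_simps)
  hence "\<exists>c>0. \<forall>z. cpoly DP z = of_real c * (\<Prod>k=1..q. (z - of_real (lp (k - 1))) * (z - of_real (lm k)))"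
    using c D p by (intro exI[of _ "poly DP x / p"]) auto
  from someI_ex[OF this, folded edge_const_def] show "edge_const > 0"
    "cpoly DP z = of_real edge_const * (\<Prod>k=1..q. (z - of_real (lp (k - 1))) * (z - of_real (lm k)))"
    by blast+
qed

lemma DP_prod_real: "poly DP x = edge_const * (\<Prod>k=1..q. (x - lp (k - 1)) * (x - lm k))"
proof -
  have "complex_of_real (poly DP x) = of_real (edge_const * (\<Prod>k=1..q. (x - lp (k - 1)) * (x - lm k)))"
    using DP_prod[of "of_real x"] by simp
  thus ?thesis unfolding of_real_eq_iff .
qed

text \<open>Grouped by bands, the factors of D come in pairs, and only the pair of the band
  containing x is negative.\<close>

lemma DP_neg:
  assumes k: "k \<in> {1..q}" and x: "lp (k - 1) < x" "x < lm k"
  shows "poly DP x < 0"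
proof -
  have "(\<Prod>j=1..q. (x - lp (j - 1)) * (x - lm j))
     = ((x - lp (k - 1)) * (x - lm k)) * (\<Prod>j\<in>{1..q}-{k}. (x - lp (j - 1)) * (x - lm j))"
    using k by (subst prod.remove[of _ k]) auto
  moreover have "(x - lp (j - 1)) * (x - lm j) > 0" if j: "j \<in> {1..q} - {k}" for j
  proof (cases "j < k")
    case True
    have "lm j \<le> lp j" using j by (intro lm_le_lp) auto
    also have "lp j \<le> lp (k - 1)" using True j k by (intro lp_mono) auto
    finally have "lm j \<le> lp (k - 1)" .
    thus ?thesis using x lp_lm_Suc[of j] j by (intro mult_pos_pos) auto
  next
    case False
    have "lm k \<le> lp k" using k by (intro lm_le_lp) auto
    also have "lp k \<le> lp (j - 1)" using False j k by (intro lp_mono) auto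
    finally have "lm k \<le> lp (j - 1)" .
    thus ?thesis using x lp_lm_Suc[of j] j by (intro mult_neg_neg) auto
  qed
  hence "(\<Prod>j\<in>{1..q}-{k}. (x - lp (j - 1)) * (x - lm j)) > 0" by (intro prod_pos) auto
  moreover have "(x - lp (k - 1)) * (x - lm k) < 0" using x by (intro mult_pos_neg) auto
  ultimately show ?thesis unfolding DP_prod_real using edge_const
    by (simp add: mult_less_0_iff mult_pos_neg)
qed

text \<open>The conditional bounds let one statement cover the finite gaps and the infinite gaps k =
  0 and k = q.\<close>

lemma DP_nonneg:
  assumes k: "k \<le> q" and x: "k > 0 \<Longrightarrow> lm k \<le> x" "k < q \<Longrightarrow> x \<le> lp k"
  shows "poly DP x \<ge> 0"
proof -
  have "(x - lp (j - 1)) * (x - lm j) \<ge> 0" if j: "j \<in> {1..q}" for j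
  proof (cases "j \<le> k")
    case True
    hence "lm j \<le> lm k" "k > 0" using lm_mono[of j k] j k by auto
    thus ?thesis using x lp_lm_Suc[of j] j by (intro mult_nonneg_nonneg) auto
  next
    case False
    hence "lp k \<le> lp (j - 1)" "k < q" using lp_mono[of k "j - 1"] j k by auto
    thus ?thesis using x lp_lm_Suc[of j] j by (intro mult_nonpos_nonpos) auto
  qed
  hence "(\<Prod>j=1..q. (x - lp (j - 1)) * (x - lm j)) \<ge> 0" by (intro prod_nonneg) auto
  thus ?thesis unfolding DP_prod_real using edge_const by simp
qed

lemma DP_edge: "k \<in> {1..q} \<Longrightarrow> poly DP (lm k) = 0" "k < q \<Longrightarrow> poly DP (lp k) = 0"
  unfolding DP_prod_real by (auto intro: bexI[of _ k] bexI[of _ "Suc k"])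

lemma DP_eq_0D: "poly DP x = 0 \<Longrightarrow> \<exists>k\<in>{1..q}. x = lp (k - 1) \<or> x = lm k"
  unfolding DP_prod_real using edge_const by (auto simp: prod_zero_iff)

lemma DP_pos:
  assumes k: "k \<le> q" and x: "k > 0 \<Longrightarrow> lm k < x" "k < q \<Longrightarrow> x < lp k"
  shows "poly DP x > 0"
proof -
  have "poly DP x \<noteq> 0"
  proof
    assume "poly DP x = 0"
    then obtain j where j: "j \<in> {1..q}" "x = lp (j - 1) \<or> x = lm j" using DP_eq_0D by blast
    show False
    proof (cases "j \<le> k")
      case True
      hence "lm j \<le> lm k" "k > 0" using lm_mono[of j k] j k by auto
      thus ?thesis using x lp_lm_Suc[of j] j by auto
    next
      case False
      hence "lp k \<le> lp (j - 1)" "k < q" using lp_mono[of k "j - 1"] j k by auto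
      thus ?thesis using x lp_lm_Suc[of j] j by auto
    qed
  qed
  moreover have "poly DP x \<ge> 0" using x by (intro DP_nonneg[OF k]) (auto intro: less_imp_le)
  ultimately show ?thesis by simp
qed

lemma band_or_gap:
  obtains k where "k \<in> {1..q}" "lp (k - 1) < x" "x < lm k"
  | k where "k \<le> q" "k > 0 \<Longrightarrow> lm k \<le> x" "k < q \<Longrightarrow> x \<le> lp k"
proof (cases "\<exists>k\<in>{1..q}. x < lm k")
  case False
  hence "lm q \<le> x" using q by force
  thus ?thesis using that(2)[of q] by auto
next
  case True
  define k where "k = (LEAST k. k \<in> {1..q} \<and> x < lm k)"
  have k: "k \<in> {1..q} \<and> x < lm k" unfolding k_def by (rule LeastI_ex) (use True in blast)
  have "lm (k - 1) \<le> x" if "k - 1 > 0"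
    using not_less_Least[of "k - 1" "\<lambda>k. k \<in> {1..q} \<and> x < lm k"] k that unfolding k_def[symmetric] by auto
  thus ?thesis using that(1)[of k] that(2)[of "k - 1"] k by (cases "lp (k - 1) < x") auto
qed

text \<open>Where D >= 0 one has |\<Delta>| >= 1, so there is no zero at which \<Delta> could change
  sign.\<close>

lemma Delta_same_sign:
  assumes "\<And>z. x \<le> z \<Longrightarrow> z \<le> y \<Longrightarrow> poly DP z \<ge> 0" "x \<le> y"
  shows "poly DeltaP x * poly DeltaP y > 0"
proof -
  have nz: "poly DeltaP z \<noteq> 0" if "x \<le> z" "z \<le> y" for z
    using assms(1)[OF that] by (auto simp: poly_DP)
  have "\<not> poly DeltaP x * poly DeltaP y < 0"
  proof
    assume neg: "poly DeltaP x * poly DeltaP y < 0"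
    hence "x \<noteq> y" by (auto simp: mult_less_0_iff)
    thus False using poly_IVT[of x y DeltaP] neg nz assms(2) by force
  qed
  moreover have "poly DeltaP x * poly DeltaP y \<noteq> 0" using nz[of x] nz[of y] assms(2) by simp
  ultimately show ?thesis by linarith
qed

lemma Delta_edge:
  assumes "poly DP x = 0" shows "poly DeltaP x = 1 \<or> poly DeltaP x = -1"
  using assms by (simp add: poly_DP power2_eq_1_iff)

section \<open>Critical points of \<Delta> and its values in the gaps\<close>

lemma gap_index: "k \<in> {1..q - 1} \<Longrightarrow> 1 \<le> k \<and> k < q \<and> k \<le> q \<and> Suc k \<le> q"
  by auto

text \<open>In an open gap \<Delta> has equal values at the two edges, and Rolle's theorem applies.
  At a closed gap D is negative on both sides of its double zero, so D' = 2 \<Delta> \<Delta>'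
  vanishes there, while \<Delta> is 1 or -1.\<close>

lemma critical_point_in_gap:
  assumes k: "k \<in> {1..q - 1}"
  shows "\<exists>x. lm k \<le> x \<and> x \<le> lp k \<and> poly (pderiv DeltaP) x = 0 \<and> (lm k < lp k \<longrightarrow> lm k < x \<and> x < lp k)"
proof (cases "lm k < lp k")
  case True
  have D: "poly DP z \<ge> 0" if "lm k \<le> z" "z \<le> lp k" for z
    using that k by (intro DP_nonneg[of k]) auto
  have "poly DP (lm k) = 0" "poly DP (lp k) = 0" using k by (auto intro!: DP_edge)
  hence "poly DeltaP (lm k) = poly DeltaP (lp k)"
    using Delta_same_sign[of "lm k" "lp k", OF D] True Delta_edge[of "lm k"] Delta_edge[of "lp k"] by auto
  hence "\<exists>z. lm k < z \<and> z < lp k \<and> DERIV (poly DeltaP) z :> 0"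
    using True by (intro Rolle) (auto intro!: continuous_intros poly_differentiable)
  then obtain z where z: "lm k < z" "z < lp k" "DERIV (poly DeltaP) z :> 0" by blast
  thus ?thesis using DERIV_unique[OF poly_DERIV z(3)] by (intro exI[of _ z]) auto
next
  case False
  hence eq: "lp k = lm k" using lm_le_lp[of k] k by auto
  define d where "d = min (lm k - lp (k - 1)) (lm (Suc k) - lp k)"
  have "d > 0" using lp_less_lm[of "k - 1" k] lp_less_lm[of k "Suc k"] k by (auto simp: d_def)
  moreover have E: "poly DP (lm k) = 0" using k by (auto intro!: DP_edge)
  have "poly DP y \<le> poly DP (lm k)" if "\<bar>lm k - y\<bar> < d" for y
    using DP_neg[of k y] DP_neg[of "Suc k" y] gap_index[OF k] that E eq
    by (cases y "lm k" rule: linorder_cases) (auto simp: d_def)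
  ultimately have "poly (pderiv DP) (lm k) = 0"
    by (intro DERIV_local_max[OF poly_DERIV]) auto
  hence "poly DeltaP (lm k) * poly (pderiv DeltaP) (lm k) = 0"
    by (simp add: DP_def pderiv_diff pderiv_power_Suc power2_eq_square pderiv_mult)
  thus ?thesis using Delta_edge[OF E] eq by (intro exI[of _ "lm k"]) auto
qed

definition crit :: "nat \<Rightarrow> real" where
  "crit k = (SOME x. lm k \<le> x \<and> x \<le> lp k \<and> poly (pderiv DeltaP) x = 0 \<and> (lm k < lp k \<longrightarrow> lm k < x \<and> x < lp k))"

lemma crit:
  assumes "k \<in> {1..q - 1}"
  shows "lm k \<le> crit k" "crit k \<le> lp k" "poly (pderiv DeltaP) (crit k) = 0"
    "lm k < lp k \<Longrightarrow> lm k < crit k" "lm k < lp k \<Longrightarrow> crit k < lp k"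
  using someI_ex[OF critical_point_in_gap[OF assms]] unfolding crit_def by auto

text \<open>\<open>\<Delta>'\<close> has degree \<open>q - 1\<close> and vanishes in each of the \<open>q - 1\<close> closed gaps, so it has no other
  zeros.\<close>

lemma critical_points: "poly (pderiv DeltaP) x = 0 \<Longrightarrow> x \<in> crit ` {1..q - 1}"
proof -
  assume x: "poly (pderiv DeltaP) x = 0"
  have "crit i < crit j" if "i \<in> {1..q - 1}" "j \<in> {1..q - 1}" "i < j" for i j
    using crit(2)[OF that(1)] crit(1)[OF that(2)] lp_less_lm[of i j] gap_index[OF that(2)] that by linarith
  hence "strict_mono_on {1..q - 1} crit" by (intro strict_mono_onI) auto
  hence "poly (pderiv DeltaP) x = lead_coeff (pderiv DeltaP) * (\<Prod>k=1..q - 1. x - crit k)"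
    using crit by (intro poly_eq_prod_roots_indexed strict_mono_on_imp_inj_on) (auto simp: degree_pderiv)
  moreover have "lead_coeff (pderiv DeltaP) \<noteq> 0"
    using q by (simp add: pderiv_eq_0_iff)
  ultimately show ?thesis using x by (auto simp: prod_zero_iff)
qed

lemma critical_point_unique:
  assumes "poly (pderiv DeltaP) x = 0" "lm k \<le> x" "x \<le> lp k" "k \<in> {1..q - 1}"
  shows "x = crit k"
proof -
  obtain j where j: "j \<in> {1..q - 1}" "x = crit j" using critical_points[OF assms(1)] by auto
  have "j = k"
    using lp_less_lm[of j k] lp_less_lm[of k j] crit(1,2)[OF j(1)] j assms
      gap_index[OF j(1)] gap_index[OF assms(4)]
    by (cases j k rule: linorder_cases) auto
  thus ?thesis using j by simp
qed

lemma no_critical_point_in_band: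
  assumes "k \<in> {1..q}" "lp (k - 1) < x" "x < lm k"
  shows "poly (pderiv DeltaP) x \<noteq> 0"
proof
  assume "poly (pderiv DeltaP) x = 0"
  then obtain j where j: "j \<in> {1..q - 1}" "x = crit j" using critical_points by blast
  show False
  proof (cases "j < k")
    case True
    hence "lp j \<le> lp (k - 1)" using assms(1) by (intro lp_mono) auto
    thus ?thesis using crit(2)[OF j(1)] assms j by simp
  next
    case False
    hence "lm k \<le> lm j" using gap_index[OF j(1)] by (intro lm_mono) auto
    thus ?thesis using crit(1)[OF j(1)] assms j by simp
  qed
qed

text \<open>Descent from the last edge, where the behaviour at infinity gives the sign. The sign is
  kept across a gap and flips across a band, since equal values at the ends of a band would yield a
  critical point inside it.\<close>

lemma Delta_lm: "k \<in> {1..q} \<Longrightarrow> (-1) ^ (q - k) * poly DeltaP (lm k) = 1"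
proof (induction "q - k" arbitrary: k)
  case 0
  hence k: "k = q" by auto
  obtain M where M: "\<And>x. x \<ge> M \<Longrightarrow> poly DeltaP x \<ge> 1"
    using poly_large[of DeltaP 1] coeff_DeltaP q by auto
  have "poly DeltaP (lm q) * poly DeltaP (max M (lm q)) > 0"
    by (intro Delta_same_sign DP_nonneg[of q]) auto
  moreover have "poly DeltaP (max M (lm q)) \<ge> 1" using M by auto
  ultimately have "poly DeltaP (lm q) > 0" by (simp add: zero_less_mult_iff)
  thus ?case using Delta_edge[of "lm q"] DP_edge[of q] q k by auto
next
  case (Suc d)
  hence k: "k \<in> {1..q - 1}" by auto
  have IH: "(-1) ^ (q - Suc k) * poly DeltaP (lm (Suc k)) = 1" using Suc by (intro Suc) auto
  have "poly DeltaP (lp k) \<noteq> poly DeltaP (lm (Suc k))"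
  proof
    assume eq: "poly DeltaP (lp k) = poly DeltaP (lm (Suc k))"
    have "\<exists>z. lp k < z \<and> z < lm (Suc k) \<and> DERIV (poly DeltaP) z :> 0"
      using eq lp_less_lm[of k "Suc k"] k by (intro Rolle) (auto intro!: continuous_intros poly_differentiable)
    then obtain z where z: "lp k < z" "z < lm (Suc k)" "DERIV (poly DeltaP) z :> 0" by blast
    thus False using DERIV_unique[OF poly_DERIV z(3)] no_critical_point_in_band[of "Suc k" z] gap_index[OF k] by auto
  qed
  moreover have "poly DeltaP (lm k) * poly DeltaP (lp k) > 0"
    using k lm_le_lp[of k] by (intro Delta_same_sign DP_nonneg[of k]) auto
  moreover have "poly DP (lm k) = 0" "poly DP (lp k) = 0" "poly DP (lm (Suc k)) = 0"
    using k by (auto intro!: DP_edge)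
  moreover have "q - k = Suc (q - Suc k)" using k by auto
  ultimately show ?case
    using IH Delta_edge[of "lm k"] Delta_edge[of "lp k"] Delta_edge[of "lm (Suc k)"] by auto
qed

lemma Delta_gap:
  assumes k: "k \<in> {1..q - 1}" and x: "lm k \<le> x" "x \<le> lp k"
  shows "(-1) ^ (q - k) * poly DeltaP x = \<bar>poly DeltaP x\<bar>" "\<bar>poly DeltaP x\<bar> \<ge> 1"
proof -
  have "poly DP x \<ge> 0" using k x by (intro DP_nonneg[of k]) auto
  hence "(poly DeltaP x)\<^sup>2 \<ge> 1" by (simp add: poly_DP)
  thus "\<bar>poly DeltaP x\<bar> \<ge> 1" by (simp add: abs_le_square_iff[symmetric, of 1, simplified])
  have "poly DeltaP (lm k) * poly DeltaP x > 0"
    using k x by (intro Delta_same_sign DP_nonneg[of k]) auto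
  moreover have "(-1) ^ (q - k) * poly DeltaP (lm k) = 1" using k by (intro Delta_lm) auto
  ultimately show "(-1) ^ (q - k) * poly DeltaP x = \<bar>poly DeltaP x\<bar>"
    by (cases "even (q - k)") (auto simp: abs_if)
qed

lemma gap_eq: "k \<in> {1..q - 1} \<Longrightarrow> gap a b q k = {lm k<..<lp k}"
  by (auto simp: gap_def)

text \<open>A maximizer of |\<Delta>| is not an edge, because |\<Delta>| is 1 there and exceeds 1 at
  \<open>crit k\<close>. Being interior it is critical, and the critical point of the gap is unique;
  this also makes the description of \<open>alpha_pt\<close> a proper one.\<close>

lemma alpha_pt_in_gap:
  assumes k: "k \<in> {1..q - 1}" and ne: "lm k < lp k"
  shows "lm k < alpha_pt a b q k" "alpha_pt a b q k < lp k"
proof -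
  let ?I = "{lm k..lp k}"
  define f where "f = (\<lambda>x. \<bar>poly DeltaP x\<bar>)"
  have cf: "cmod (Delta a b q (of_real x)) = f x" for x
    by (simp add: Delta_eq f_def)
  have fS: "(-1) ^ (q - k) * Delta a b q (of_real x) = of_real (f x)" if "x \<in> ?I" for x
  proof -
    have "(-1) ^ (q - k) * Delta a b q (of_real x) = of_real ((-1) ^ (q - k) * poly DeltaP x)"
      by (simp add: Delta_eq)
    also have "\<dots> = of_real (f x)" using Delta_gap(1)[OF k, of x] that by (simp add: f_def del: of_real_mult)
    finally show ?thesis .
  qed
  have "continuous_on ?I f" unfolding f_def by (intro continuous_intros)
  then obtain m where m: "m \<in> ?I" "\<And>x. x \<in> ?I \<Longrightarrow> f x \<le> f m"
    using continuous_attains_sup[of ?I f] ne by force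
  have sup: "(SUP x\<in>?I. f x) = f m"
    using m by (intro cSup_eq_maximum) auto
  have max_crit: "x = crit k \<and> lm k < x \<and> x < lp k" if x: "x \<in> ?I" "f x = f m" for x
  proof -
    have "poly DP (crit k) > 0" using crit[OF k] ne k by (intro DP_pos[of k]) auto
    hence "1\<^sup>2 < (f (crit k))\<^sup>2" by (simp add: poly_DP f_def)
    hence "1 < f (crit k)" by (rule power2_less_imp_less) (simp add: f_def)
    hence "f x > 1" using m(2)[of "crit k"] crit[OF k] x by auto
    moreover have "f (lm k) = 1" "f (lp k) = 1"
      using Delta_edge[OF DP_edge(1)[of k]] Delta_edge[OF DP_edge(2)[of k]] gap_index[OF k] k by (auto simp: f_def)
    ultimately have in1: "lm k < x" "x < lp k" using x by (auto simp: less_le)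
    have "poly (smult ((-1) ^ (q - k)) (pderiv DeltaP)) x = 0"
    proof (rule DERIV_local_max)
      show "DERIV (poly (smult ((-1) ^ (q - k)) DeltaP)) x :> poly (smult ((-1) ^ (q - k)) (pderiv DeltaP)) x"
        unfolding pderiv_smult[symmetric] by (rule poly_DERIV)
      show "0 < min (x - lm k) (lp k - x)" using in1 by auto
      show "\<forall>y. \<bar>x - y\<bar> < min (x - lm k) (lp k - x) \<longrightarrow>
          poly (smult ((- 1) ^ (q - k)) DeltaP) y \<le> poly (smult ((- 1) ^ (q - k)) DeltaP) x"
      proof (intro allI impI)
        fix y assume "\<bar>x - y\<bar> < min (x - lm k) (lp k - x)"
        hence y: "lm k \<le> y" "y \<le> lp k" by auto
        thus "poly (smult ((- 1) ^ (q - k)) DeltaP) y \<le> poly (smult ((- 1) ^ (q - k)) DeltaP) x"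
          using Delta_gap(1)[OF k y] Delta_gap(1)[OF k, of x] m(2)[of y] x by (simp add: f_def)
      qed
    qed
    thus ?thesis using critical_point_unique[of x k] k x in1 by auto
  qed
  have "alpha_pt a b q k = m"
    unfolding alpha_pt_def cf sup
  proof (rule the_equality)
    show "m \<in> ?I \<and> (-1) ^ (q - k) * Delta a b q (of_real m) = of_real (f m)"
      using m fS by auto
    fix x assume "x \<in> ?I \<and> (-1) ^ (q - k) * Delta a b q (of_real x) = of_real (f m)"
    hence xI: "x \<in> ?I" and "of_real (f x) = complex_of_real (f m)" using fS[of x] by simp_all
    hence "f x = f m" by (simp only: of_real_eq_iff)
    from max_crit[OF xI this] max_crit[OF m(1) refl] show "x = m" by simp
  qed
  thus "lm k < alpha_pt a b q k" "alpha_pt a b q k < lp k" using max_crit[OF m(1) refl] by simp_all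
qed

text \<open>The only critical point of \<Delta> in the closed gap is interior, so D' = 2 \<Delta>
  \<Delta>' does not vanish at the edges; its signs follow from D >= 0 inside the gap.\<close>

lemma pderiv_DP_nz:
  assumes k: "k \<in> {1..q - 1}" and ne: "lm k < lp k"
  shows "poly (pderiv DP) (lm k) > 0" "poly (pderiv DP) (lp k) < 0"
proof -
  have *: "poly (pderiv DP) x \<noteq> 0" if "x = lm k \<or> x = lp k" for x
  proof -
    have "poly (pderiv DeltaP) x \<noteq> 0"
      using critical_point_unique[of x k] crit[OF k] ne k that by auto
    moreover have "poly DP x = 0" using that k by (auto intro!: DP_edge)
    ultimately show ?thesis using Delta_edge[of x]
      by (auto simp: DP_def pderiv_diff power2_eq_square pderiv_mult)
  qed
  have DP0: "poly DP (lm k) = 0" "poly DP (lp k) = 0" using k by (auto intro!: DP_edge)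
  have "\<not> poly (pderiv DP) (lm k) < 0"
  proof
    assume "poly (pderiv DP) (lm k) < 0"
    from DERIV_neg_dec_right[OF poly_DERIV this] obtain d where
      d: "d > 0" "\<And>h. h > 0 \<Longrightarrow> h < d \<Longrightarrow> poly DP (lm k + h) < 0" using DP0 by auto
    define h where "h = min (d/2) (lp k - lm k)"
    have "poly DP (lm k + h) \<ge> 0" using k ne d(1) by (intro DP_nonneg[of k]) (auto simp: h_def)
    moreover have "0 < h" "h < d" using d(1) ne by (auto simp: h_def)
    ultimately show False using d(2)[of h] by simp
  qed
  thus "poly (pderiv DP) (lm k) > 0" using *[of "lm k"] by auto
  have "\<not> poly (pderiv DP) (lp k) > 0"
  proof
    assume "poly (pderiv DP) (lp k) > 0"
    from DERIV_pos_inc_left[OF poly_DERIV this] obtain d where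
      d: "d > 0" "\<And>h. h > 0 \<Longrightarrow> h < d \<Longrightarrow> poly DP (lp k - h) < 0" using DP0 by auto
    define h where "h = min (d/2) (lp k - lm k)"
    have "poly DP (lp k - h) \<ge> 0" using k ne d(1) by (intro DP_nonneg[of k]) (auto simp: h_def)
    moreover have "0 < h" "h < d" using d(1) ne by (auto simp: h_def)
    ultimately show False using d(2)[of h] by simp
  qed
  thus "poly (pderiv DP) (lp k) < 0" using *[of "lp k"] by auto
qed

text \<open>Consecutive zeros of \<open>vphi q\<close> lie in different gaps since \<open>\<Delta>\<close> changes sign between them; as
  there are \<open>q - 1\<close> of each, every gap contains exactly one.\<close>

lemma vphi_zero_in_gap:
  assumes k: "k \<in> {1..q - 1}"
  shows "\<exists>!x. x \<in> {lm k..lp k} \<and> poly (vphi q) x = 0"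
proof -
  obtain x where x: "strict_mono_on {0..q} x"
    and xD: "\<And>k. k \<le> q \<Longrightarrow> (-1) ^ (q - k) * poly DeltaP (x k) \<ge> 1"
    and x0: "\<And>z. poly (vphi q) z = 0 \<longleftrightarrow> z \<in> x ` {1..q - 1}"
    using Delta_alternation by metis
  have opp: "poly DeltaP (x i) * poly DeltaP (x (Suc i)) < 0" if "i < q" for i
  proof -
    have "q - i = Suc (q - Suc i)" using that by auto
    thus ?thesis using xD[of i] xD[of "Suc i"] that
      by (cases "even (q - Suc i)") (auto simp: mult_less_0_iff)
  qed
  have lt: "x i < x j" if "i < j" "j \<le> q" for i j
    using strict_mono_onD[OF x, of i j] that by auto
  \<comment> \<open>A zero of \<Delta> lies in some band. The zeros on either side of the inner
    points confine these to the range between \<open>lp 0\<close> and \<open>lm q\<close>, that is,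
    away from the infinite gaps.\<close>
  have zero: "\<exists>y. x i < y \<and> y < x (Suc i) \<and> lp 0 < y \<and> y < lm q" if i: "i < q" for i
  proof -
    obtain y where y: "x i < y" "y < x (Suc i)" "poly DeltaP y = 0"
      using poly_IVT[OF lt[of i "Suc i"] opp[OF i]] i by auto
    from y(3) have Dy: "poly DP y < 0" by (simp add: poly_DP)
    show ?thesis
    proof (cases rule: band_or_gap[of y])
      case (1 k)
      moreover have "lp 0 \<le> lp (k - 1)" "lm k \<le> lm q" using 1 by (auto intro!: lp_mono lm_mono)
      ultimately show ?thesis using y by (intro exI[of _ y]) auto
    next
      case (2 k)
      thus ?thesis using DP_nonneg[of k y] Dy by auto
    qed
  qed
  have "\<exists>k\<in>{1..q - 1}. lm k \<le> x j \<and> x j \<le> lp k" if j: "j \<in> {1..q - 1}" for j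
  proof -
    have "x 1 \<le> x j" "x j \<le> x (q - 1)"
      using lt[of 1 j] lt[of j "q - 1"] j by (cases "j = 1"; cases "j = q - 1"; force)+
    moreover have "x 1 > lp 0" using zero[of 0] q by auto
    moreover have "x (q - 1) < lm q" using zero[of "q - 1"] q by auto
    ultimately have xj: "lp 0 < x j" "x j < lm q" by auto
    have "(poly DeltaP (x j))\<^sup>2 \<ge> 1"
      using power_mono[OF xD[of j], of 2] j by (auto simp: power_mult_distrib power_mult[symmetric] mult.commute)
    hence D: "poly DP (x j) \<ge> 0" by (simp add: poly_DP)
    show ?thesis
    proof (cases rule: band_or_gap[of "x j"])
      case (1 k)
      thus ?thesis using DP_neg[of k "x j"] D by auto
    next
      case (2 k)
      hence "k \<noteq> 0" "k \<noteq> q" using xj q by (auto intro!: Nat.gr0I)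
      thus ?thesis using 2 by (intro bexI[of _ k]) auto
    qed
  qed
  then obtain g where g: "\<And>j. j \<in> {1..q - 1} \<Longrightarrow> g j \<in> {1..q - 1} \<and> lm (g j) \<le> x j \<and> x j \<le> lp (g j)"
    by metis
  have inj': "g i \<noteq> g j" if "i \<in> {1..q - 1}" "j \<in> {1..q - 1}" "i < j" for i j
  proof
    assume eq: "g i = g j"
    have "x (Suc i) \<le> x j" using lt[of "Suc i" j] gap_index[OF that(2)] that by (cases "Suc i = j") auto
    hence "poly DeltaP (x i) * poly DeltaP (x (Suc i)) > 0"
      using g[of i] g[of j] eq that lt[of i "Suc i"] gap_index[OF that(1)] gap_index[of "g i"]
      by (intro Delta_same_sign DP_nonneg[of "g i"]) auto
    thus False using opp[of i] gap_index[OF that(1)] by auto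
  qed
  have inj: "inj_on g {1..q - 1}"
  proof (rule inj_onI)
    fix i j assume ij: "i \<in> {1..q - 1}" "j \<in> {1..q - 1}" "g i = g j"
    show "i = j"
      using inj'[OF ij(1,2)] inj'[OF ij(2,1)] ij(3) by (cases i j rule: linorder_cases) simp_all
  qed
  hence "g ` {1..q - 1} = {1..q - 1}" using g by (intro endo_inj_surj) auto
  then obtain j where j: "j \<in> {1..q - 1}" "g j = k" using k by (metis imageE)
  show ?thesis
  proof (rule ex1I[of _ "x j"])
    show "x j \<in> {lm k..lp k} \<and> poly (vphi q) (x j) = 0" using g[of j] j x0 by auto
    fix y assume y: "y \<in> {lm k..lp k} \<and> poly (vphi q) y = 0"
    then obtain i where i: "i \<in> {1..q - 1}" "y = x i" using x0 by auto
    have "g i = k"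
      using g[OF i(1)] i y lp_less_lm[of "g i" k] lp_less_lm[of k "g i"]
        gap_index[OF k] gap_index[of "g i"]
      by (cases "g i" k rule: linorder_cases) auto
    thus "y = x j" using inj_onD[OF inj, of i j] i j by simp
  qed
qed

lemma mu:
  assumes k: "k \<in> {1..q - 1}"
  shows "poly (vphi q) (mu a b q k) = 0"
    "x \<in> {lm k..lp k} \<Longrightarrow> poly (vphi q) x = 0 \<Longrightarrow> x = mu a b q k"
proof -
  have "mu a b q k = (THE x. x \<in> {lm k..lp k} \<and> poly (vphi q) x = 0)"
    unfolding mu_def varphi_eq by simp
  moreover note theI'[OF vphi_zero_in_gap[OF k]] the1_equality[OF vphi_zero_in_gap[OF k]]
  ultimately show "poly (vphi q) (mu a b q k) = 0"
    "x \<in> {lm k..lp k} \<Longrightarrow> poly (vphi q) x = 0 \<Longrightarrow> x = mu a b q k" by metis+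
qed

end

section \<open>The branch of the square root on the physical sheet\<close>

text \<open>Both open half-planes joined through one real point off \<open>S\<close> form a
  connected set, and all the sets \<open>T x\<close> have the half-planes in common.\<close>

lemma connected_compl_real:
  assumes "x0 \<notin> S"
  shows "connected (- complex_of_real ` S)"
proof -
  define T where "T = (\<lambda>x. insert (complex_of_real x) {z. Im z > 0} \<union> insert (complex_of_real x) {z. Im z < 0})"
  have conv: "convex (insert (complex_of_real x) {z. s * Im z > 0})" for x s
  proof (rule convexI)
    fix y z :: complex and u v :: real
    assume *: "y \<in> insert (of_real x) {z. s * Im z > 0}" "z \<in> insert (of_real x) {z. s * Im z > 0}"
      "0 \<le> u" "0 \<le> v" "u + v = 1"
    have Im: "s * Im (u *\<^sub>R y + v *\<^sub>R z) = u * (s * Im y) + v * (s * Im z)"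
      by (simp add: algebra_simps)
    have ge: "s * Im y \<ge> 0" "s * Im z \<ge> 0" using * by auto
    show "u *\<^sub>R y + v *\<^sub>R z \<in> insert (of_real x) {z. s * Im z > 0}"
    proof (cases "s * Im (u *\<^sub>R y + v *\<^sub>R z) > 0")
      case False
      hence "u * (s * Im y) = 0" "v * (s * Im z) = 0"
        using ge * mult_nonneg_nonneg[of u "s * Im y"] mult_nonneg_nonneg[of v "s * Im z"] unfolding Im by linarith+
      hence "u = 0 \<or> y = of_real x" "v = 0 \<or> z = of_real x" using * by auto
      thus ?thesis using * by (auto simp: scaleR_left_distrib[symmetric])
    qed auto
  qed
  have "connected (T x)" for x
    unfolding T_def using convex_connected[OF conv[of x 1]] convex_connected[OF conv[of x "-1"]]
    by (intro connected_Un) auto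
  moreover have "\<i> \<in> (\<Inter>x\<in>-S. T x)" by (auto simp: T_def)
  hence "(\<Inter>x\<in>-S. T x) \<noteq> {}" by blast
  ultimately have "connected (\<Union>x\<in>-S. T x)" by (intro connected_Union) auto
  moreover have "(\<Union>x\<in>-S. T x) = - complex_of_real ` S"
  proof (intro equalityI subsetI)
    fix z assume z: "z \<in> - complex_of_real ` S"
    show "z \<in> (\<Union>x\<in>-S. T x)"
    proof (cases "Im z = 0")
      case True
      hence "z = of_real (Re z)" by (simp add: complex_eq_iff)
      thus ?thesis using z by (auto simp: T_def intro!: bexI[of _ "Re z"])
    next
      case False
      thus ?thesis using assms by (auto simp: T_def intro!: bexI[of _ x0])
    qed
  qed (auto simp: T_def)
  ultimately show ?thesis by simp
qed

text \<open>The quotient is continuous with values 1 and -1 on a connected set, hence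
  constant.\<close>

lemma sqrt_branch_sign:
  fixes f g :: "complex \<Rightarrow> complex"
  assumes "connected D" "continuous_on D f" "continuous_on D g"
    and "\<And>z. z \<in> D \<Longrightarrow> (f z)\<^sup>2 = (g z)\<^sup>2" "\<And>z. z \<in> D \<Longrightarrow> g z \<noteq> 0"
  shows "\<exists>s\<in>{1,-1}. \<forall>z\<in>D. f z = s * g z"
proof -
  have pm: "f z / g z \<in> {1, -1}" if "z \<in> D" for z
    using assms(4)[OF that] assms(5)[OF that] by (auto simp: power2_eq_iff)
  have "finite ((\<lambda>z. f z / g z) ` D)"
    by (rule finite_subset[of _ "{1, -1}"], rule image_subsetI, rule pm) simp_all
  hence "(\<lambda>z. f z / g z) constant_on D"
    by (intro continuous_finite_range_constant continuous_on_divide assms(1,2,3)) (use assms(5) in auto)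
  then obtain s where s: "\<And>z. z \<in> D \<Longrightarrow> f z / g z = s" by (auto simp: constant_on_def)
  show ?thesis
  proof (cases "D = {}")
    case False
    then obtain z where "z \<in> D" by auto
    hence "s \<in> {1, -1}" using s pm by metis
    moreover have "f z = s * g z" if "z \<in> D" for z using s[OF that] assms(5)[OF that] by (simp add: field_simps)
    ultimately show ?thesis by blast
  qed auto
qed

text \<open>A branch of \<open>\<surd>((z - l)(z - r))\<close> off the cut \<open>[l, r]\<close>.\<close>

definition cut_sqrt :: "real \<Rightarrow> real \<Rightarrow> complex \<Rightarrow> complex" where
  "cut_sqrt l r z = (z - of_real l) * csqrt ((z - of_real r) / (z - of_real l))"

text \<open>The quotient under \<open>csqrt\<close> is a real s <= 0 only for z = (r - s l) / (1 -
  s), a convex combination of l and r; so the cut of \<open>csqrt\<close> is met only over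
  [l, r].\<close>

lemma cut_sqrt_holomorphic:
  assumes "l < r"
  shows "cut_sqrt l r holomorphic_on (- complex_of_real ` {l..r})"
proof -
  have "(z - of_real r) / (z - of_real l) \<notin> \<real>\<^sub>\<le>\<^sub>0" if z: "z \<notin> complex_of_real ` {l..r}" for z
  proof
    assume "(z - of_real r) / (z - of_real l) \<in> \<real>\<^sub>\<le>\<^sub>0"
    then obtain s where s: "s \<le> 0" "(z - of_real r) / (z - of_real l) = of_real s"
      by (auto elim!: nonpos_Reals_cases)
    have "z \<noteq> of_real l" using z assms by auto
    hence "z - of_real r = of_real s * (z - of_real l)" using s(2) by (simp add: field_simps)
    hence "z * of_real (1 - s) = of_real (r - s * l)" by (simp add: algebra_simps)
    hence "z * of_real (1 - s) / of_real (1 - s) = of_real ((r - s * l) / (1 - s))" by simp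
    moreover have "complex_of_real (1 - s) \<noteq> 0" using s(1) unfolding of_real_eq_0_iff by simp
    ultimately have "z = of_real ((r - s * l) / (1 - s))" by simp
    moreover have "(r - s * l) / (1 - s) \<in> {l..r}"
      using s(1) assms mult_left_mono_neg[of l r s] by (simp add: field_simps)
    ultimately show False using z by blast
  qed
  thus ?thesis unfolding cut_sqrt_def using assms
    by (intro holomorphic_intros holomorphic_on_csqrt') auto
qed

lemma cut_sqrt_square: "z \<noteq> of_real l \<Longrightarrow> (cut_sqrt l r z)\<^sup>2 = (z - of_real l) * (z - of_real r)"
  unfolding cut_sqrt_def power_mult_distrib power2_csqrt by (simp add: power2_eq_square)

text \<open>The values on the real line off the cut. They are positive to the right and negative to
  the left of it, which makes the sign of the full root alternate from gap to gap.\<close>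

definition cut_sqrt_real :: "real \<Rightarrow> real \<Rightarrow> real \<Rightarrow> real" where
  "cut_sqrt_real l r x = (x - l) * sqrt ((x - r) / (x - l))"

lemma cut_sqrt_of_real:
  assumes "l < r" "x < l \<or> r < x"
  shows "cut_sqrt l r (of_real x) = of_real (cut_sqrt_real l r x)"
proof -
  have "(x - r) / (x - l) \<ge> 0" using assms by (auto simp: divide_nonpos_neg)
  hence "csqrt (of_real ((x - r) / (x - l))) = of_real (sqrt ((x - r) / (x - l)))"
    by (rule csqrt_of_real_nonneg[of "of_real _", simplified])
  thus ?thesis by (simp add: cut_sqrt_def cut_sqrt_real_def)
qed

lemma cut_sqrt_real_pos: "l < r \<Longrightarrow> r < x \<Longrightarrow> cut_sqrt_real l r x > 0"
  and cut_sqrt_real_neg: "l < r \<Longrightarrow> x < l \<Longrightarrow> cut_sqrt_real l r x < 0"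
  by (auto simp: cut_sqrt_real_def intro!: mult_pos_pos mult_neg_pos divide_neg_neg)

context jacobi_background
begin

lemma mem_spec0: "x \<in> spec0 a b q \<longleftrightarrow> (\<exists>k\<in>{1..q}. lp (k - 1) \<le> x \<and> x \<le> lm k)"
  by (auto simp: spec0_def)

lemma spec0_le: "x \<in> spec0 a b q \<Longrightarrow> x \<le> lm q"
  unfolding mem_spec0 using lm_mono[of _ q] by force

lemma edges_in_spec0: "k \<in> {1..q} \<Longrightarrow> lp (k - 1) \<in> spec0 a b q \<and> lm k \<in> spec0 a b q"
  unfolding mem_spec0 using lp_lm_Suc[of k] by (auto intro!: bexI[of _ k])

lemma DP_off_spec0:
  assumes "z \<notin> complex_of_real ` spec0 a b q"
  shows "cpoly DP z \<noteq> 0"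
proof
  assume "cpoly DP z = 0"
  then obtain k where k: "k \<in> {1..q}" "z = of_real (lp (k - 1)) \<or> z = of_real (lm k)"
    unfolding DP_prod using edge_const by (auto simp: prod_zero_iff)
  with edges_in_spec0[OF k(1)] show False using assms by blast
qed

text \<open>An explicit branch with one root for each band. Every factor is positive to the right of
  its band, so the minus sign is the normalization on the physical sheet.\<close>

definition phys :: "complex \<Rightarrow> complex" where
  "phys z = - of_real (sqrt edge_const) * (\<Prod>k=1..q. cut_sqrt (lp (k - 1)) (lm k) z)"

lemma phys_holomorphic: "phys holomorphic_on (- of_real ` spec0 a b q)"
proof -
  have "cut_sqrt (lp (k - 1)) (lm k) holomorphic_on (- of_real ` spec0 a b q)" if "k \<in> {1..q}" for k
    by (rule holomorphic_on_subset[OF cut_sqrt_holomorphic])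
       (use lp_lm_Suc[OF that] that in \<open>force simp: mem_spec0\<close>)+
  thus ?thesis unfolding phys_def[abs_def] by (intro holomorphic_intros) auto
qed

lemma phys_square:
  assumes "z \<notin> complex_of_real ` spec0 a b q"
  shows "(phys z)\<^sup>2 = cpoly DP z"
proof -
  have ne: "z \<noteq> of_real (lp (k - 1))" if "k \<in> {1..q}" for k
    using assms edges_in_spec0[OF that] by blast
  have "(phys z)\<^sup>2 = of_real edge_const * (\<Prod>k=1..q. (cut_sqrt (lp (k - 1)) (lm k) z)\<^sup>2)"
    using edge_const by (simp add: phys_def power_mult_distrib prod_power_distrib flip: of_real_power)
  also have "(\<Prod>k=1..q. (cut_sqrt (lp (k - 1)) (lm k) z)\<^sup>2)
      = (\<Prod>k=1..q. (z - of_real (lp (k - 1))) * (z - of_real (lm k)))"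
    using ne by (intro prod.cong refl cut_sqrt_square) auto
  finally show ?thesis by (simp add: DP_prod)
qed

definition phys_real :: "real \<Rightarrow> real" where
  "phys_real x = - sqrt edge_const * (\<Prod>k=1..q. cut_sqrt_real (lp (k - 1)) (lm k) x)"

lemma phys_of_real:
  assumes "x \<notin> spec0 a b q"
  shows "phys (of_real x) = of_real (phys_real x)"
proof -
  have "cut_sqrt (lp (k - 1)) (lm k) (of_real x) = of_real (cut_sqrt_real (lp (k - 1)) (lm k) x)" if "k \<in> {1..q}" for k
    using assms lp_lm_Suc[OF that] that by (intro cut_sqrt_of_real) (force simp: mem_spec0 not_le)+
  hence "(\<Prod>k=1..q. cut_sqrt (lp (k - 1)) (lm k) (of_real x)) = (\<Prod>k=1..q. of_real (cut_sqrt_real (lp (k - 1)) (lm k) x))"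
    by (intro prod.cong) auto
  thus ?thesis by (simp add: phys_def phys_real_def)
qed

lemma phys_real_sign:
  assumes k: "k \<in> {1..q}" and x: "lm k < x" "k < q \<Longrightarrow> x < lp k"
  shows "(-1) ^ (q - k) * phys_real x < 0"
proof -
  have "(-1) ^ (q - k) * (\<Prod>k=1..q. cut_sqrt_real (lp (k - 1)) (lm k) x) > 0"
  proof (rule prod_sign)
    fix j :: nat assume j: "1 \<le> j" "j \<le> k"
    have "lm j \<le> lm k" using j k by (intro lm_mono) auto
    thus "0 < cut_sqrt_real (lp (j - 1)) (lm j) x"
      using lp_lm_Suc[of j] j k x by (intro cut_sqrt_real_pos) auto
  next
    fix j :: nat assume j: "k < j" "j \<le> q"
    have "x < lp k" using x(2) j by simp
    also have "lp k \<le> lp (j - 1)" using j by (intro lp_mono) auto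
    finally show "cut_sqrt_real (lp (j - 1)) (lm j) x < 0"
      using lp_lm_Suc[of j] j by (intro cut_sqrt_real_neg) auto
  qed (use k in auto)
  hence "sqrt edge_const * ((-1) ^ (q - k) * (\<Prod>k=1..q. cut_sqrt_real (lp (k - 1)) (lm k) x)) > 0"
    using edge_const by (metis mult_pos_pos real_sqrt_gt_0_iff)
  thus ?thesis by (simp add: phys_real_def mult.left_commute)
qed

text \<open>\<open>phys\<close> witnesses the description of \<open>phys_sqrt\<close>. Two branches
  on the connected complement of the spectrum differ by a global sign, and the value at
  \<open>lm q + 1\<close> fixes it.\<close>

lemma phys_sqrt_eq:
  assumes "z \<notin> complex_of_real ` spec0 a b q"
  shows "phys_sqrt a b q z = phys z"
proof -
  let ?D = "- complex_of_real ` spec0 a b q"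
  define Q where "Q = (\<lambda>R. R holomorphic_on ?D \<and> (\<forall>z\<in>?D. (R z)\<^sup>2 = (Delta a b q z)\<^sup>2 - 1) \<and>
     (\<forall>x>lm q. Im (R (of_real x)) = 0 \<and> Re (R (of_real x)) < 0))"
  have off: "x \<notin> spec0 a b q" if "x > lm q" for x using spec0_le[of x] that by auto
  have "Q phys"
    unfolding Q_def using phys_holomorphic phys_square phys_of_real[OF off] phys_real_sign[of q] q
    by (auto simp: cpoly_DP)
  hence "Q (Eps Q)" by (rule someI[of Q])
  hence R: "Q (phys_sqrt a b q)" by (simp add: phys_sqrt_def Q_def)
  have "\<exists>s\<in>{1,-1}. \<forall>z\<in>?D. phys_sqrt a b q z = s * phys z"
  proof (rule sqrt_branch_sign)
    show "connected ?D" by (rule connected_compl_real[OF off[of "lm q + 1"]]) simp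
    show "(phys_sqrt a b q z)\<^sup>2 = (phys z)\<^sup>2" if "z \<in> ?D" for z
      using R that phys_square[of z] by (auto simp: Q_def cpoly_DP)
    show "phys z \<noteq> 0" if "z \<in> ?D" for z
      using phys_square[of z] DP_off_spec0[of z] that by force
  qed (use R phys_holomorphic in \<open>auto simp: Q_def intro: holomorphic_on_imp_continuous_on\<close>)
  then obtain s where s: "s \<in> {1, -1}" "\<And>z. z \<in> ?D \<Longrightarrow> phys_sqrt a b q z = s * phys z" by blast
  let ?x = "lm q + 1"
  have "of_real ?x \<in> ?D" using off[of ?x] by (metis ComplI imageE less_add_one of_real_eq_iff)
  hence "phys_sqrt a b q (of_real ?x) = s * of_real (phys_real ?x)"
    using s(2)[of "of_real ?x"] phys_of_real[OF off[of ?x]] by auto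
  moreover have "Re (phys_sqrt a b q (of_real ?x)) < 0" using R unfolding Q_def by (metis less_add_one)
  moreover have "phys_real ?x < 0" using phys_real_sign[of q ?x] q by auto
  ultimately have "s = 1" using s(1) by auto
  thus ?thesis using s(2)[of z] assms by auto
qed

section \<open>The two sheets over a finite gap\<close>

lemma gap_off_spec0:
  assumes "k \<in> {1..q - 1}" "lm k < x" "x < lp k"
  shows "x \<notin> spec0 a b q"
proof
  assume "x \<in> spec0 a b q"
  then obtain j where j: "j \<in> {1..q}" "lp (j - 1) \<le> x" "x \<le> lm j" by (auto simp: mem_spec0)
  show False
  proof (cases "j \<le> k")
    case True
    hence "lm j \<le> lm k" using gap_index[OF assms(1)] by (intro lm_mono) auto
    thus ?thesis using j assms by simp
  next
    case False
    hence "lp k \<le> lp (j - 1)" using j by (intro lp_mono) auto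
    thus ?thesis using j assms by simp
  qed
qed

lemma phys_sqrt_gap:
  assumes k: "k \<in> {1..q - 1}" and x: "lm k < x" "x < lp k"
  shows "phys_sqrt a b q (of_real x) = of_real ((-1) ^ (q - k + 1) * sqrt (poly DP x))"
proof -
  have off: "x \<notin> spec0 a b q" using gap_off_spec0[OF k x] .
  hence off': "complex_of_real x \<notin> of_real ` spec0 a b q" by auto
  have "of_real ((phys_real x)\<^sup>2) = complex_of_real (poly DP x)"
    using phys_square[OF off'] phys_of_real[OF off] by simp
  hence "(phys_real x)\<^sup>2 = poly DP x" by (simp only: of_real_eq_iff)
  hence "\<bar>phys_real x\<bar> = sqrt (poly DP x)" by (metis real_sqrt_abs)
  moreover have "(-1) ^ (q - k) * phys_real x < 0" using k x by (intro phys_real_sign) auto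
  ultimately have "phys_real x = (-1) ^ (q - k + 1) * sqrt (poly DP x)"
    by (cases "even (q - k)") auto
  thus ?thesis using phys_sqrt_eq[OF off'] phys_of_real[OF off] by simp
qed

lemma mem_gap_plus:
  assumes k: "k \<in> {1..q - 1}"
  shows "P \<in> gap_plus a b q k \<longleftrightarrow> (\<exists>x. lm k < x \<and> x < lp k \<and>
     P = (of_real x, of_real ((-1) ^ (q - k + 1) * sqrt (poly DP x))))"
  using gap_off_spec0[OF k] phys_sqrt_gap[OF k]
  by (auto simp: gap_plus_def sheet_plus_def gap_eq[OF k])

lemma mem_gap_minus:
  assumes k: "k \<in> {1..q - 1}"
  shows "P \<in> gap_minus a b q k \<longleftrightarrow> (\<exists>x. lm k < x \<and> x < lp k \<and>
     P = (of_real x, of_real ((-1) ^ (q - k) * sqrt (poly DP x))))"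
  using gap_off_spec0[OF k] phys_sqrt_gap[OF k]
  by (auto simp: gap_minus_def sheet_minus_def gap_eq[OF k])

definition gap_arc :: "nat \<Rightarrow> real \<Rightarrow> real \<Rightarrow> bool" where
  "gap_arc k x w \<longleftrightarrow> lm k \<le> x \<and> x \<le> lp k \<and> w\<^sup>2 = poly DP x"

text \<open>One inclusion holds because the real curve w^2 = D x over the closed gap is closed. For
  the other, the points with w = 0 are not on an open arc, but they are limits along the physical
  arc because the root vanishes there.\<close>

lemma mem_gap_circle:
  assumes k: "k \<in> {1..q - 1}" and ne: "lm k < lp k"
  shows "P \<in> gap_circle a b q k \<longleftrightarrow> (\<exists>x w. P = (of_real x, of_real w) \<and> gap_arc k x w)"
proof
  define C where "C = {P. Im (fst P) = 0 \<and> Im (snd P) = 0 \<and> lm k \<le> Re (fst P) \<and> Re (fst P) \<le> lp k \<and>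
                          (Re (snd P))\<^sup>2 = poly DP (Re (fst P))}"
  have "closed C" unfolding C_def
    by (intro closed_Collect_conj closed_Collect_eq closed_Collect_le continuous_intros)
  moreover have DP0: "poly DP x \<ge> 0" if "lm k < x" "x < lp k" for x
    using that k by (intro DP_nonneg[of k]) auto
  hence "gap_plus a b q k \<subseteq> C" "gap_minus a b q k \<subseteq> C"
    by (auto simp: mem_gap_plus[OF k] mem_gap_minus[OF k] C_def power_mult_distrib power_mult[symmetric] mult.commute)
  ultimately have "gap_circle a b q k \<subseteq> C"
    unfolding gap_circle_def by (simp add: closure_minimal)
  moreover assume "P \<in> gap_circle a b q k"
  ultimately have "P \<in> C" by auto
  thus "\<exists>x w. P = (of_real x, of_real w) \<and> gap_arc k x w"
    by (intro exI[of _ "Re (fst P)"] exI[of _ "Re (snd P)"])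
       (auto simp: C_def gap_arc_def prod_eq_iff complex_eq_iff)
next
  assume "\<exists>x w. P = (of_real x, of_real w) \<and> gap_arc k x w"
  then obtain x w where P: "P = (of_real x, of_real w)" and x: "lm k \<le> x" "x \<le> lp k" "w\<^sup>2 = poly DP x"
    by (auto simp: gap_arc_def)
  define f where "f = (\<lambda>x. (complex_of_real x, complex_of_real ((-1) ^ (q - k + 1) * sqrt (poly DP x))))"
  show "P \<in> gap_circle a b q k"
  proof (cases "poly DP x = 0")
    case False
    hence "lm k < x" "x < lp k"
      using x DP_edge(1)[of k] DP_edge(2)[of k] gap_index[OF k] by (auto simp: less_le)
    moreover have "w = sqrt (poly DP x) \<or> w = - sqrt (poly DP x)"
      using x(3) by (metis real_sqrt_abs abs_if minus_minus)
    hence "w = (-1) ^ (q - k + 1) * sqrt (poly DP x) \<or> w = (-1) ^ (q - k) * sqrt (poly DP x)"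
      by (cases "even (q - k)") auto
    ultimately have "P \<in> gap_plus a b q k \<or> P \<in> gap_minus a b q k"
      unfolding mem_gap_plus[OF k] mem_gap_minus[OF k] P by blast
    thus ?thesis using closure_subset unfolding gap_circle_def by blast
  next
    case True
    hence w: "w = 0" using x by simp
    have "continuous_on {lm k..lp k} f" unfolding f_def by (intro continuous_intros)
    moreover have "closure {lm k<..<lp k} = {lm k..lp k}" using ne by (rule closure_greaterThanLessThan)
    moreover have "f ` {lm k<..<lp k} \<subseteq> closure (gap_plus a b q k)"
      using closure_subset by (force simp: mem_gap_plus[OF k] f_def)
    ultimately have "f ` {lm k..lp k} \<subseteq> closure (gap_plus a b q k)"
      using image_closure_subset[of "{lm k<..<lp k}" f "closure (gap_plus a b q k)"] by simp
    moreover have "P = f x" using P w True by (simp add: f_def)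
    ultimately show ?thesis using x by (auto simp: gap_circle_def)
  qed
qed

text \<open>The sign of \<omega> is left undetermined; it will cancel between the two factors of
  J.\<close>

lemma phys_sqrt_boundary:
  assumes k: "k \<in> {1..q}" and x: "lp (k - 1) < x" "x < lm k"
  obtains \<omega> :: real where "((\<lambda>e. phys_sqrt a b q (Complex x e)) \<longlongrightarrow> \<i> * of_real \<omega>) (at_right 0)"
    "\<omega>\<^sup>2 = - poly DP x" "\<omega> \<noteq> 0"
proof -
  have neg: "poly DP x < 0" using DP_neg[OF k x] .
  have cC: "((\<lambda>e. Complex x e) \<longlongrightarrow> of_real x) (at_right 0)"
    by (auto simp: complex_of_real_def intro!: tendsto_Complex tendsto_intros)
  have "((\<lambda>e. Re (cpoly DP (Complex x e))) \<longlongrightarrow> Re (cpoly DP (of_real x))) (at_right 0)"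
    by (intro tendsto_intros cC)
  hence "\<forall>\<^sub>F e in at_right 0. Re (cpoly DP (Complex x e)) < 0"
    using neg by (intro order_tendstoD(2)) auto
  then obtain d where d: "d > 0" "\<And>e. 0 < e \<Longrightarrow> e < d \<Longrightarrow> Re (cpoly DP (Complex x e)) < 0"
    unfolding eventually_at_right_field by auto
  define D where "D = Complex x ` {0<..<d}"
  \<comment> \<open>Just above a point of a band \<open>- cpoly DP\<close> has positive real part
    and stays off the cut of \<open>csqrt\<close>, so this is a continuous root to compare
    with.\<close>
  define g where "g = (\<lambda>z. \<i> * csqrt (- cpoly DP z))"
  have neg': "- cpoly DP z \<notin> \<real>\<^sub>\<le>\<^sub>0" if "z \<in> D" for z
    using d(2) that by (force simp: D_def complex_nonpos_Reals_iff)
  have cCx: "continuous_on A (Complex x)" for A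
    unfolding complex_eq[abs_def] Complex_eq by (intro continuous_intros)
  have conn: "connected D" unfolding D_def by (intro connected_continuous_image cCx) auto
  have off: "z \<notin> complex_of_real ` spec0 a b q" if "z \<in> D" for z
    using that by (auto simp: D_def complex_eq_iff)
  have "\<exists>s\<in>{1,-1}. \<forall>z\<in>D. phys_sqrt a b q z = s * g z"
  proof (rule sqrt_branch_sign[OF conn])
    have "continuous_on D phys"
      by (rule continuous_on_subset[OF holomorphic_on_imp_continuous_on[OF phys_holomorphic]]) (use off in auto)
    thus "continuous_on D (phys_sqrt a b q)"
      by (rule continuous_on_eq) (use phys_sqrt_eq off in auto)
    show "continuous_on D g" unfolding g_def
      by (intro holomorphic_on_imp_continuous_on holomorphic_intros holomorphic_on_csqrt' cpoly_holomorphic neg')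
    show "(phys_sqrt a b q z)\<^sup>2 = (g z)\<^sup>2" if "z \<in> D" for z
      using phys_sqrt_eq[OF off[OF that]] phys_square[OF off[OF that]] by (simp add: g_def power_mult_distrib)
    show "g z \<noteq> 0" if "z \<in> D" for z using neg'[OF that] by (auto simp: g_def)
  qed
  then obtain s where s: "s \<in> {1, -1}" "\<And>z. z \<in> D \<Longrightarrow> phys_sqrt a b q z = s * g z" by blast
  define \<omega> where "\<omega> = Re s * sqrt (- poly DP x)"
  have sr: "s = of_real (Re s)" "(Re s)\<^sup>2 = 1" using s(1) by auto
  have "isCont csqrt (- cpoly DP (of_real x))"
    using neg by (intro continuous_at_csqrt) auto
  hence "((\<lambda>e. csqrt (- cpoly DP (Complex x e))) \<longlongrightarrow> csqrt (- cpoly DP (of_real x))) (at_right 0)"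
    by (rule isCont_tendsto_compose) (intro tendsto_intros cC)
  hence "((\<lambda>e. s * g (Complex x e)) \<longlongrightarrow> s * (\<i> * csqrt (- cpoly DP (of_real x)))) (at_right 0)"
    unfolding g_def by (intro tendsto_intros)
  note lim = this
  have "csqrt (- cpoly DP (of_real x)) = of_real (sqrt (- poly DP x))"
    using neg csqrt_of_real_nonneg[of "of_real (- poly DP x)"] by simp
  hence eq: "s * (\<i> * csqrt (- cpoly DP (of_real x))) = \<i> * of_real \<omega>"
    by (subst sr(1)) (simp add: \<omega>_def mult_ac)
  have "\<forall>\<^sub>F e in at_right 0. s * g (Complex x e) = phys_sqrt a b q (Complex x e)"
    unfolding eventually_at_right_field using d(1) s(2) by (intro exI[of _ d]) (auto simp: D_def)
  from Lim_transform_eventually[OF lim this]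
  have "((\<lambda>e. phys_sqrt a b q (Complex x e)) \<longlongrightarrow> \<i> * of_real \<omega>) (at_right 0)"
    unfolding eq .
  moreover have "\<omega>\<^sup>2 = - poly DP x" "\<omega> \<noteq> 0" using neg sr(2) by (auto simp: \<omega>_def power_mult_distrib)
  ultimately show ?thesis by (rule that)
qed

end

section \<open>Polynomial dependence on the spectral parameter and the coupling constant\<close>

text \<open>Real polynomials in the spectral parameter and the coupling constant, presented
  inductively so that reality on the real line, differentiability in z and Lipschitz bounds follow
  by induction.\<close>

inductive bipoly :: "(complex \<Rightarrow> real \<Rightarrow> complex) \<Rightarrow> bool" where
  bipoly_const: "bipoly (\<lambda>z t. of_real c)"
| bipoly_fst: "bipoly (\<lambda>z t. z)"
| bipoly_snd: "bipoly (\<lambda>z t. of_real t)"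
| bipoly_add: "bipoly F \<Longrightarrow> bipoly G \<Longrightarrow> bipoly (\<lambda>z t. F z t + G z t)"
| bipoly_mult: "bipoly F \<Longrightarrow> bipoly G \<Longrightarrow> bipoly (\<lambda>z t. F z t * G z t)"

lemma bipoly_diff: "bipoly F \<Longrightarrow> bipoly G \<Longrightarrow> bipoly (\<lambda>z t. F z t - G z t)"
  using bipoly_add[OF _ bipoly_mult[OF bipoly_const[of "-1"]]] by fastforce

lemma bipoly_cpoly: "bipoly (\<lambda>z t. cpoly P z)"
  by (induction P) (use bipoly_const[of 0] in \<open>auto intro!: bipoly.intros\<close>)

lemma bipoly_sum: "(\<And>i. i \<in> A \<Longrightarrow> bipoly (F i)) \<Longrightarrow> bipoly (\<lambda>z t. \<Sum>i\<in>A. F i z t)"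
  by (induction A rule: infinite_finite_induct)
     (use bipoly_const[of 0] in \<open>auto intro!: bipoly_add\<close>)

lemma bipoly_fixed:
  assumes "bipoly F"
  shows "\<exists>P. \<forall>z. F z t = cpoly P z"
  using assms
proof induction
  case (bipoly_const c)
  show ?case by (intro exI[of _ "[:c:]"]) simp
next
  case bipoly_fst
  show ?case by (intro exI[of _ "[:0, 1:]"]) simp
next
  case bipoly_snd
  show ?case by (intro exI[of _ "[:t:]"]) simp
next
  case (bipoly_add F G)
  thus ?case by (metis cpoly_add)
next
  case (bipoly_mult F G)
  thus ?case by (metis cpoly_mult)
qed

lemma bipoly_real:
  assumes "bipoly F"
  shows "F (of_real x) t = of_real (Re (F (of_real x) t))"
  using bipoly_fixed[OF assms, of t] by auto

lemma bipoly_deriv: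
  assumes "bipoly F"
  shows "\<exists>F'. bipoly F' \<and> (\<forall>z t. ((\<lambda>z. F z t) has_field_derivative F' z t) (at z))"
  using assms
proof induction
  case (bipoly_const c)
  show ?case
    by (rule exI[of _ "\<lambda>z t. of_real 0"], intro conjI bipoly.bipoly_const) (auto intro!: derivative_eq_intros)
next
  case bipoly_fst
  show ?case
    by (rule exI[of _ "\<lambda>z t. of_real 1"], intro conjI bipoly.bipoly_const) (auto intro!: derivative_eq_intros)
next
  case bipoly_snd
  show ?case
    by (rule exI[of _ "\<lambda>z t. of_real 0"], intro conjI bipoly.bipoly_const) (auto intro!: derivative_eq_intros)
next
  case (bipoly_add F G)
  then obtain F' G' where "bipoly F'" "\<And>z t. ((\<lambda>z. F z t) has_field_derivative F' z t) (at z)"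
    "bipoly G'" "\<And>z t. ((\<lambda>z. G z t) has_field_derivative G' z t) (at z)" by blast
  thus ?case
    by (intro exI[of _ "\<lambda>z t. F' z t + G' z t"]) (auto intro!: bipoly.bipoly_add derivative_intros)
next
  case (bipoly_mult F G)
  then obtain F' G' where *: "bipoly F'" "\<And>z t. ((\<lambda>z. F z t) has_field_derivative F' z t) (at z)"
    "bipoly G'" "\<And>z t. ((\<lambda>z. G z t) has_field_derivative G' z t) (at z)" by blast
  show ?case
  proof (intro exI[of _ "\<lambda>z t. F' z t * G z t + G' z t * F z t"] conjI allI)
    show "bipoly (\<lambda>z t. F' z t * G z t + G' z t * F z t)"
      by (rule bipoly.bipoly_add; rule bipoly.bipoly_mult) (use * bipoly_mult in auto)
    fix z t
    show "((\<lambda>z. F z t * G z t) has_field_derivative F' z t * G z t + G' z t * F z t) (at z)"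
      by (rule DERIV_mult) (rule *)+
  qed
qed

text \<open>The size and the Lipschitz bound are carried together because the product step needs
  both of them for each factor.\<close>

lemma bipoly_Lipschitz:
  assumes "bipoly F"
  shows "\<exists>C\<ge>0. \<forall>z z' s t. norm z \<le> R \<longrightarrow> norm z' \<le> R \<longrightarrow> \<bar>s\<bar> \<le> 1 \<longrightarrow> \<bar>t\<bar> \<le> 1 \<longrightarrow>
           norm (F z t) \<le> C \<and> norm (F z t - F z' s) \<le> C * (norm (z - z') + \<bar>t - s\<bar>)"
  using assms
proof induction
  case (bipoly_const c)
  show ?case by (intro exI[of _ "\<bar>c\<bar>"]) auto
next
  case bipoly_fst
  have "d \<le> (1 + \<bar>R\<bar>) * (d + e)" if "d \<ge> 0" "e \<ge> 0" for d e :: real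
    using that mult_right_mono[of 1 "1 + \<bar>R\<bar>" "d + e"] by simp
  thus ?case
    by (intro exI[of _ "1 + \<bar>R\<bar>"]) auto
next
  case bipoly_snd
  show ?case
    by (intro exI[of _ 1]) (auto simp flip: of_real_diff)
next
  case (bipoly_add F G)
  then obtain C1 C2 where C: "C1 \<ge> 0" "C2 \<ge> 0"
    and F: "\<And>z z' s t. norm z \<le> R \<Longrightarrow> norm z' \<le> R \<Longrightarrow> \<bar>s\<bar> \<le> 1 \<Longrightarrow> \<bar>t\<bar> \<le> 1 \<Longrightarrow>
           norm (F z t) \<le> C1 \<and> norm (F z t - F z' s) \<le> C1 * (norm (z - z') + \<bar>t - s\<bar>)"
    and G: "\<And>z z' s t. norm z \<le> R \<Longrightarrow> norm z' \<le> R \<Longrightarrow> \<bar>s\<bar> \<le> 1 \<Longrightarrow> \<bar>t\<bar> \<le> 1 \<Longrightarrow>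
           norm (G z t) \<le> C2 \<and> norm (G z t - G z' s) \<le> C2 * (norm (z - z') + \<bar>t - s\<bar>)"
    by metis
  show ?case
  proof (intro exI[of _ "C1 + C2"] conjI allI impI)
    fix z z' :: complex and s t :: real assume *: "norm z \<le> R" "norm z' \<le> R" "\<bar>s\<bar> \<le> 1" "\<bar>t\<bar> \<le> 1"
    show "norm (F z t + G z t) \<le> C1 + C2"
      using F[OF *] G[OF *] norm_triangle_ineq[of "F z t" "G z t"] by linarith
    have "norm ((F z t + G z t) - (F z' s + G z' s)) \<le> norm (F z t - F z' s) + norm (G z t - G z' s)"
      by (rule norm_diff_triangle_ineq)
    thus "norm ((F z t + G z t) - (F z' s + G z' s)) \<le> (C1 + C2) * (norm (z - z') + \<bar>t - s\<bar>)"
      using F[OF *] G[OF *] unfolding distrib_right by linarith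
  qed (use C in auto)
next
  case (bipoly_mult F G)
  then obtain C1 C2 where C: "C1 \<ge> 0" "C2 \<ge> 0"
    and F: "\<And>z z' s t. norm z \<le> R \<Longrightarrow> norm z' \<le> R \<Longrightarrow> \<bar>s\<bar> \<le> 1 \<Longrightarrow> \<bar>t\<bar> \<le> 1 \<Longrightarrow>
           norm (F z t) \<le> C1 \<and> norm (F z t - F z' s) \<le> C1 * (norm (z - z') + \<bar>t - s\<bar>)"
    and G: "\<And>z z' s t. norm z \<le> R \<Longrightarrow> norm z' \<le> R \<Longrightarrow> \<bar>s\<bar> \<le> 1 \<Longrightarrow> \<bar>t\<bar> \<le> 1 \<Longrightarrow>
           norm (G z t) \<le> C2 \<and> norm (G z t - G z' s) \<le> C2 * (norm (z - z') + \<bar>t - s\<bar>)"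
    by metis
  show ?case
  proof (intro exI[of _ "2 * C1 * C2"] conjI allI impI)
    fix z z' :: complex and s t :: real assume *: "norm z \<le> R" "norm z' \<le> R" "\<bar>s\<bar> \<le> 1" "\<bar>t\<bar> \<le> 1"
    define d where "d = norm (z - z') + \<bar>t - s\<bar>"
    have b: "norm (F z t) \<le> C1" "norm (F z t - F z' s) \<le> C1 * d" "norm (G z' s) \<le> C2" "norm (G z t) \<le> C2"
      "norm (G z t - G z' s) \<le> C2 * d"
      using F[OF *] G[OF *] G[OF *(2,1,4,3)] by (auto simp: d_def)
    have "norm (F z t * G z t) \<le> C1 * C2"
      unfolding norm_mult using b C by (intro mult_mono) auto
    moreover have "C1 * C2 \<ge> 0" using C by simp
    ultimately show "norm (F z t * G z t) \<le> 2 * C1 * C2" by simp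
    have "F z t * G z t - F z' s * G z' s = F z t * (G z t - G z' s) + (F z t - F z' s) * G z' s"
      by (simp add: algebra_simps)
    hence "norm (F z t * G z t - F z' s * G z' s)
        \<le> norm (F z t) * norm (G z t - G z' s) + norm (F z t - F z' s) * norm (G z' s)"
      by (metis norm_mult norm_triangle_ineq)
    also have "\<dots> \<le> C1 * (C2 * d) + (C1 * d) * C2"
      using b C by (intro add_mono mult_mono) (auto simp: d_def)
    also have "\<dots> = 2 * C1 * C2 * d" by simp
    finally show "norm (F z t * G z t - F z' s * G z' s) \<le> 2 * C1 * C2 * (norm (z - z') + \<bar>t - s\<bar>)"
      by (simp add: d_def)
  qed (use C in auto)
qed

section \<open>The Wronskian of the Jost solutions\<close>

lemma jacobi_solution_lincomb:
  assumes "jacobi_solution a b z y" "jacobi_solution a b z y'"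
  shows "jacobi_solution a b z (\<lambda>n. y n + c * y' n)"
  unfolding jacobi_solution_def
proof
  fix n
  have "jacobi_op a b (\<lambda>n. y n + c * y' n) n = jacobi_op a b y n + c * jacobi_op a b y' n"
    by (simp add: jacobi_op_def algebra_simps)
  thus "jacobi_op a b (\<lambda>n. y n + c * y' n) n = z * (y n + c * y' n)"
    using assms by (simp add: jacobi_solution_def algebra_simps)
qed

locale perturbed_jacobi = jacobi_background +
  fixes p :: nat and v :: "int \<Rightarrow> real"
  assumes v_supp: "\<And>n. n < 0 \<or> n > int p \<Longrightarrow> v n = 0"
begin

lemma psi_solution:
  "jacobi_solution a b (fst P) (\<lambda>n. psi_plus a b q n P)"
  "jacobi_solution a b (fst P) (\<lambda>n. psi_minus a b q n P)"
  unfolding psi_plus_def psi_minus_def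
  by (rule jacobi_solution_lincomb[OF vartheta_solution(1) varphi_solution(1)])+

lemma psi_initial:
  "psi_plus a b q 0 P = 1" "psi_plus a b q 1 P = m_plus a b q P"
  "psi_minus a b q 0 P = 1" "psi_minus a b q 1 P = m_minus a b q P"
  by (simp_all add: psi_plus_def psi_minus_def vartheta_solution varphi_solution)

text \<open>Agreement with \<psi>^+ is prescribed for n > p but extends to n = p: the equation at p
  + 1 is unperturbed and determines the value at p. The Wronskian at p, which involves the sites p
  and p + 1, is thereby unperturbed.\<close>

lemma f_plus:
  "jacobi_solution a (\<lambda>n. b n + t * v n) (fst P) (f_plus a b q p v t P)"
  "n \<ge> int p \<Longrightarrow> f_plus a b q p v t P n = psi_plus a b q n P"
proof -
  let ?b = "\<lambda>n. b n + t * v n"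
  obtain y where y: "jacobi_solution a ?b (fst P) y" "y (int p) = psi_plus a b q (int p) P"
    "y (int p + 1) = psi_plus a b q (int p + 1) P"
    using jacobi_solution_exists[where a = a and b = ?b and l = "fst P" and m = "int p"] a_pos by metis
  have yn: "y n = psi_plus a b q n P" if "n \<ge> int p" for n
    by (rule jacobi_solution_agree_forward[OF a_pos y(1) psi_solution(1)[of P], of "int p"])
       (use y v_supp that in auto)
  have "f_plus a b q p v t P = y"
    unfolding f_plus_def
  proof (rule the_equality)
    show "jacobi_solution a ?b (fst P) y \<and> (\<forall>n>int p. y n = psi_plus a b q n P)" using y yn by auto
    fix y' assume y': "jacobi_solution a ?b (fst P) y' \<and> (\<forall>n>int p. y' n = psi_plus a b q n P)"
    show "y' = y"
      by (rule jacobi_solution_unique[OF a_pos _ y(1), of _ "int p + 1"]) (use y' yn in auto)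
  qed
  thus "jacobi_solution a ?b (fst P) (f_plus a b q p v t P)"
    "n \<ge> int p \<Longrightarrow> f_plus a b q p v t P n = psi_plus a b q n P" using y yn by auto
qed

lemma f_minus:
  "jacobi_solution a (\<lambda>n. b n + t * v n) (fst P) (f_minus a b q v t P)"
  "n \<le> 0 \<Longrightarrow> f_minus a b q v t P n = psi_minus a b q n P"
proof -
  let ?b = "\<lambda>n. b n + t * v n"
  obtain y where y: "jacobi_solution a ?b (fst P) y" "y (-1) = psi_minus a b q (-1) P"
    "y (-1 + 1) = psi_minus a b q (-1 + 1) P"
    using jacobi_solution_exists[where a = a and b = ?b and l = "fst P" and m = "-1"] a_pos by metis
  have yn: "y n = psi_minus a b q n P" if "n \<le> 0" for n
    by (rule jacobi_solution_agree_backward[OF a_pos y(1) psi_solution(2)[of P], of "-1"])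
       (use y v_supp that in auto)
  have "f_minus a b q v t P = y"
    unfolding f_minus_def
  proof (rule the_equality)
    show "jacobi_solution a ?b (fst P) y \<and> (\<forall>n\<le>0. y n = psi_minus a b q n P)" using y yn by auto
    fix y' assume y': "jacobi_solution a ?b (fst P) y' \<and> (\<forall>n\<le>0. y' n = psi_minus a b q n P)"
    show "y' = y"
      by (rule jacobi_solution_unique[OF a_pos _ y(1), of _ "-1"]) (use y' yn in auto)
  qed
  thus "jacobi_solution a ?b (fst P) (f_minus a b q v t P)"
    "n \<le> 0 \<Longrightarrow> f_minus a b q v t P n = psi_minus a b q n P" using y yn by auto
qed

text \<open>The value at \<open>p + 1 - k\<close> of the solution of the perturbed equation which agrees with
  \<open>jac_poly c0 c1\<close> to the right of the perturbation.\<close>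

definition jac_back :: "real \<Rightarrow> real \<Rightarrow> nat \<Rightarrow> complex \<Rightarrow> real \<Rightarrow> complex" where
  "jac_back c0 c1 k z t = lin_rec
     (\<lambda>k. (z - of_real (b (int p - int k)) - of_real t * of_real (v (int p - int k))) / of_real (a (int p - int k - 1)))
     (\<lambda>k. - of_real (a (int p - int k)) / of_real (a (int p - int k - 1)))
     (cpoly (jac_poly c0 c1 (Suc p)) z) (cpoly (jac_poly c0 c1 p) z) k"

lemma jac_back_simps:
  "jac_back c0 c1 0 z t = cpoly (jac_poly c0 c1 (Suc p)) z"
  "jac_back c0 c1 (Suc 0) z t = cpoly (jac_poly c0 c1 p) z"
  "jac_back c0 c1 (Suc (Suc k)) z t =
     of_real (1 / a (int p - int k - 1)) * (z - of_real (b (int p - int k)) - of_real (v (int p - int k)) * of_real t) * jac_back c0 c1 (Suc k) z t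
     + of_real (- a (int p - int k) / a (int p - int k - 1)) * jac_back c0 c1 k z t"
  by (simp_all add: jac_back_def mult.commute)

lemma bipoly_back: "bipoly (jac_back c0 c1 k)"
proof (induction k rule: induct_nat_012)
  case (ge2 k)
  have "bipoly (\<lambda>z t. jac_back c0 c1 (Suc (Suc k)) z t)"
    unfolding jac_back_simps by (intro bipoly_add bipoly_mult bipoly_diff bipoly_const bipoly_fst bipoly_snd ge2)
  thus ?case by simp
qed (auto simp: jac_back_simps[abs_def] bipoly_cpoly)

text \<open>The recursion is linear in its data. The factor \<open>m\<close> will be
  \<open>m_plus\<close>, so that f^+ splits into two parts that are polynomial in (z, t).\<close>

lemma jac_back_solution:
  assumes y: "jacobi_solution a (\<lambda>n. b n + t * v n) z y"
    and "y (int p + 1) = cpoly (jac_poly 1 0 (Suc p)) z + m * cpoly (jac_poly 0 1 (Suc p)) z"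
    and "y (int p) = cpoly (jac_poly 1 0 p) z + m * cpoly (jac_poly 0 1 p) z"
  shows "y (int p + 1 - int k) = jac_back 1 0 k z t + m * jac_back 0 1 k z t"
proof (induction k rule: induct_nat_012)
  case (ge2 k)
  let ?n = "int p - int k"
  have n: "int p + 1 - int (Suc (Suc k)) = ?n - 1" "int p + 1 - int (Suc k) = ?n" "int p + 1 - int k = ?n + 1"
    by auto
  have "jacobi_op a (\<lambda>n. b n + t * v n) y ?n = z * y ?n" using y by (auto simp: jacobi_solution_def)
  hence "of_real (a (?n - 1)) * y (?n - 1)
      = (z - of_real (b ?n) - of_real (v ?n) * of_real t) * y ?n - of_real (a ?n) * y (?n + 1)"
    by (simp add: jacobi_op_def algebra_simps)
  hence "y (?n - 1) = ((z - of_real (b ?n) - of_real (v ?n) * of_real t) * y ?n - of_real (a ?n) * y (?n + 1)) / of_real (a (?n - 1))"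
    by (simp add: field_simps)
  also have "\<dots> = jac_back 1 0 (Suc (Suc k)) z t + m * jac_back 0 1 (Suc (Suc k)) z t"
    using ge2 unfolding n jac_back_simps by (simp add: divide_simps) (simp add: algebra_simps)
  finally show ?case unfolding n .
qed (use assms in \<open>auto simp: jac_back_simps\<close>)

text \<open>\<open>Theta\<close> and \<open>Phi\<close> are the perturbed solutions that agree with
  \<open>vartheta\<close> and \<open>varphi\<close> beyond the support, with the reversed index
  turned back into the site n.\<close>

definition Theta :: "nat \<Rightarrow> complex \<Rightarrow> real \<Rightarrow> complex" where "Theta n = jac_back 1 0 (p + 1 - n)"
definition Phi :: "nat \<Rightarrow> complex \<Rightarrow> real \<Rightarrow> complex" where "Phi n = jac_back 0 1 (p + 1 - n)"

lemma bipoly_Theta: "bipoly (Theta n)" and bipoly_Phi: "bipoly (Phi n)"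
  by (simp_all add: Theta_def Phi_def bipoly_back)

lemma f_plus_eq:
  assumes "n \<le> p"
  shows "f_plus a b q p v t P (int n) = Theta n (fst P) t + m_plus a b q P * Phi n (fst P) t"
proof -
  have "f_plus a b q p v t P (int p + 1 - int (p + 1 - n)) =
     jac_back 1 0 (p + 1 - n) (fst P) t + m_plus a b q P * jac_back 0 1 (p + 1 - n) (fst P) t"
    using vartheta_eq[of p] varphi_eq[of p] vartheta_eq[of "Suc p"] varphi_eq[of "Suc p"]
    by (intro jac_back_solution f_plus) (simp_all add: f_plus(2) psi_plus_def vth_def vphi_def add.commute)
  moreover have "int p + 1 - int (p + 1 - n) = int n" using assms by auto
  ultimately show ?thesis by (simp add: Theta_def Phi_def)
qed

lemma jac_back_0:
  assumes "k \<le> Suc p"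
  shows "jac_back 1 0 k z 0 = cpoly (vth (Suc p - k)) z" "jac_back 0 1 k z 0 = cpoly (vphi (Suc p - k)) z"
proof -
  have i: "int p + 1 - int k = int (Suc p - k)" using assms by auto
  have "vartheta a b (int p + 1 - int k) z = jac_back 1 0 k z 0 + 0 * jac_back 0 1 k z 0"
    using vartheta_eq[of p z] vartheta_eq[of "Suc p" z] vartheta_solution(1)[of z]
    by (intro jac_back_solution) (simp_all add: vth_def vphi_def add.commute)
  thus "jac_back 1 0 k z 0 = cpoly (vth (Suc p - k)) z" unfolding i vartheta_eq by simp
  \<comment> \<open>\<open>jac_back_solution\<close> has coefficient 1 at the first part, so
    \<open>varphi\<close> is reached through the sum with \<open>vartheta\<close>, that is, with m =
    1.\<close>
  have "vartheta a b (int p + 1 - int k) z + 1 * varphi a b (int p + 1 - int k) z = jac_back 1 0 k z 0 + 1 * jac_back 0 1 k z 0"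
    using vartheta_eq[of p z] vartheta_eq[of "Suc p" z] varphi_eq[of p z] varphi_eq[of "Suc p" z]
       jacobi_solution_lincomb[OF vartheta_solution(1) varphi_solution(1), of z 1]
    by (intro jac_back_solution) (simp_all add: vth_def vphi_def add.commute)
  thus "jac_back 0 1 k z 0 = cpoly (vphi (Suc p - k)) z"
    unfolding i vartheta_eq varphi_eq \<open>jac_back 1 0 k z 0 = _\<close> by simp
qed

lemma Theta_0: "n \<le> p \<Longrightarrow> Theta n z 0 = cpoly (vth n) z"
  and Phi_0: "n \<le> p \<Longrightarrow> Phi n z 0 = cpoly (vphi n) z"
  using jac_back_0[of "p + 1 - n" z] by (simp_all add: Theta_def Phi_def)

text \<open>The identity at one site is summed for the mixed pair \<psi>^-, f^+. At p the solution
  f^+ agrees with \<psi>^+ and the unperturbed Wronskian appears; at -1 the solution f^- agrees with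
  \<psi>^-.\<close>

lemma wronskian_Jost:
  "wronskian a (f_minus a b q v t P) (f_plus a b q p v t P) 0 =
     of_real (a 0) * (m_plus a b q P - m_minus a b q P)
     + of_real t * (\<Sum>n\<le>p. of_real (v (int n)) * psi_minus a b q (int n) P * f_plus a b q p v t P (int n))"
proof -
  let ?fm = "f_minus a b q v t P" and ?fp = "f_plus a b q p v t P"
  let ?sm = "\<lambda>n. psi_minus a b q n P" and ?sp = "\<lambda>n. psi_plus a b q n P"
  have step: "wronskian a ?sm ?fp n = wronskian a ?sm ?fp (n - 1) - of_real (t * v n) * ?sm n * ?fp n" for n
    using wronskian_step[OF psi_solution(2)[of P] f_plus(1)[of t P]] .
  have "wronskian a ?sm ?fp (int N) = wronskian a ?sm ?fp (-1) - (\<Sum>n\<le>N. of_real (t * v (int n)) * ?sm (int n) * ?fp (int n))" for N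
  proof (induction N)
    case 0 show ?case using step[of 0] by simp
  next
    case (Suc N) thus ?case using step[of "int (Suc N)"] by simp
  qed
  from this[of p] have 1: "wronskian a ?sm ?fp (-1) = wronskian a ?sm ?fp (int p) + 
      of_real t * (\<Sum>n\<le>p. of_real (v (int n)) * ?sm (int n) * ?fp (int n))"
    by (simp add: sum_distrib_left mult.assoc)
  have "wronskian a ?sm ?fp (int p) = wronskian a ?sm ?sp (int p)"
    by (simp add: wronskian_def f_plus(2))
  also have "\<dots> = wronskian a ?sm ?sp 0"
    by (rule wronskian_const[OF psi_solution(2,1)])
  also have "\<dots> = of_real (a 0) * (m_plus a b q P - m_minus a b q P)"
    using psi_initial by (simp add: wronskian_def)
  finally have 2: "wronskian a ?sm ?fp (int p) = of_real (a 0) * (m_plus a b q P - m_minus a b q P)" .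
  have "wronskian a ?fm ?fp (-1) = wronskian a ?sm ?fp (-1)"
    by (simp add: wronskian_def f_minus(2))
  moreover have "wronskian a ?fm ?fp 0 = wronskian a ?fm ?fp (0 - 1)"
    using wronskian_step[of a "\<lambda>n. b n + t * v n" "fst P" ?fm "\<lambda>_. 0" ?fp 0] f_minus(1)[of t P] f_plus(1)[of t P]
    by simp
  ultimately show ?thesis using 1 2 by simp
qed

text \<open>Expanding varphi_q \<psi>^- f^+ at each site and eliminating w^2 leaves an expression
  linear in w. \<open>A1\<close> collects the parts free of w and \<open>B1\<close> the coefficients
  of w, weighted by v and divided by a_0.\<close>

definition A1 :: "complex \<Rightarrow> real \<Rightarrow> complex" where
  "A1 z t = of_real (1 / a 0) * (\<Sum>n\<le>p. of_real (v (int n)) *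
     (cpoly (vphi q) z * cpoly (vth n) z * Theta n z t
      + cpoly PhiP z * (cpoly (vth n) z * Phi n z t + cpoly (vphi n) z * Theta n z t)
      - cpoly (vth (Suc q)) z * cpoly (vphi n) z * Phi n z t))"

definition B1 :: "complex \<Rightarrow> real \<Rightarrow> complex" where
  "B1 z t = of_real (1 / a 0) * (\<Sum>n\<le>p. of_real (v (int n)) *
     (cpoly (vth n) z * Phi n z t - cpoly (vphi n) z * Theta n z t))"

lemma bipoly_A1: "bipoly A1" and bipoly_B1: "bipoly B1"
  unfolding A1_def[abs_def] B1_def[abs_def]
  by (intro bipoly_mult bipoly_sum bipoly_add bipoly_diff bipoly_const bipoly_cpoly bipoly_Theta bipoly_Phi)+

definition xi_reg :: "real \<Rightarrow> complex \<times> complex \<Rightarrow> complex" where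
  "xi_reg t P = of_real t * A1 (fst P) t + snd P * (2 + of_real t * B1 (fst P) t)"

section \<open>Removing the singularities of \<xi>\<close>

lemma Surf_iff: "P \<in> Surf a b q \<longleftrightarrow> (snd P)\<^sup>2 = cpoly DP (fst P)"
  by (simp add: Surf_def cpoly_DP)

text \<open>Multiplication by \<open>vphi q\<close> clears the denominators of the terms of \<psi>^-
  f^+ with one of m_-, m_+, and by \<open>ww\<close> also that of the term with both. The
  unperturbed Wronskian contributes 2 w because m_+ - m_- = 2 w / \<open>vphi q\<close>.\<close>

lemma xi_raw_eq:
  assumes P: "P \<in> Surf a b q" and nz: "cpoly (vphi q) (fst P) \<noteq> 0"
  shows "xi_raw a b q p v t P = xi_reg t P"
proof -
  obtain z w where zw: "P = (z, w)" by (cases P)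
  define Q where "Q = cpoly (vphi q) z"
  define F where "F = cpoly PhiP z"
  have Q: "Q \<noteq> 0" using nz zw by (simp add: Q_def)
  have mp: "m_plus a b q P = (F + w) / Q" and mm: "m_minus a b q P = (F - w) / Q"
    by (simp_all add: m_plus_def m_minus_def zw phi_eq varphi_eq F_def Q_def)
  have "w\<^sup>2 = F\<^sup>2 + cpoly (vth (Suc q)) z * Q"
    using P by (simp add: Surf_iff zw DP_factor F_def Q_def)
  hence ww: "(F + w) * (F - w) = - cpoly (vth (Suc q)) z * Q" 
    by (simp add: power2_eq_square algebra_simps)
  have summand: "Q * (psi_minus a b q (int n) P * f_plus a b q p v t P (int n)) =
     (Q * cpoly (vth n) z * Theta n z t + F * (cpoly (vth n) z * Phi n z t + cpoly (vphi n) z * Theta n z t)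
      - cpoly (vth (Suc q)) z * cpoly (vphi n) z * Phi n z t)
     + w * (cpoly (vth n) z * Phi n z t - cpoly (vphi n) z * Theta n z t)" if n: "n \<le> p" for n
  proof -
    have "Q * (psi_minus a b q (int n) P * f_plus a b q p v t P (int n))
       = Q * ((cpoly (vth n) z + (F - w) / Q * cpoly (vphi n) z) * (Theta n z t + (F + w) / Q * Phi n z t))"
      unfolding f_plus_eq[OF n] psi_minus_def vartheta_eq varphi_eq mp mm by (simp add: zw)
    also have "\<dots> = Q * cpoly (vth n) z * Theta n z t + (F + w) * cpoly (vth n) z * Phi n z t
        + (F - w) * cpoly (vphi n) z * Theta n z t + ((F + w) * (F - w)) / Q * cpoly (vphi n) z * Phi n z t"
      using Q by (simp add: field_simps)
    also have "((F + w) * (F - w)) / Q = - cpoly (vth (Suc q)) z" unfolding ww using Q by simp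
    finally show ?thesis by (simp add: algebra_simps)
  qed
  have "xi_raw a b q p v t P = Q / of_real (a 0) * (of_real (a 0) * (2 * w / Q)
     + of_real t * (\<Sum>n\<le>p. of_real (v (int n)) * psi_minus a b q (int n) P * f_plus a b q p v t P (int n)))"
    unfolding xi_raw_def wronskian_Jost mp mm by (simp add: zw varphi_eq Q_def diff_divide_distrib[symmetric])
  also have "\<dots> = 2 * w + of_real t * (of_real (1 / a 0) * 
      (\<Sum>n\<le>p. of_real (v (int n)) * (Q * (psi_minus a b q (int n) P * f_plus a b q p v t P (int n)))))"
    using Q by (simp add: field_simps sum_distrib_left sum_divide_distrib)
  also have "(\<Sum>n\<le>p. of_real (v (int n)) * (Q * (psi_minus a b q (int n) P * f_plus a b q p v t P (int n))))
     = (\<Sum>n\<le>p. of_real (v (int n)) *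
         (Q * cpoly (vth n) z * Theta n z t + F * (cpoly (vth n) z * Phi n z t + cpoly (vphi n) z * Theta n z t)
          - cpoly (vth (Suc q)) z * cpoly (vphi n) z * Phi n z t))
       + w * (\<Sum>n\<le>p. of_real (v (int n)) * (cpoly (vth n) z * Phi n z t - cpoly (vphi n) z * Theta n z t))"
    unfolding sum_distrib_left sum.distrib[symmetric]
    by (intro sum.cong refl) (simp add: summand algebra_simps)
  also have "2 * w + of_real t * (of_real (1 / a 0) * \<dots>) = xi_reg t P"
    by (simp add: xi_reg_def A1_def B1_def zw Q_def F_def algebra_simps)
  finally show ?thesis .
qed

lemma xi_reg_tendsto:
  "(xi_reg t \<longlongrightarrow> xi_reg t P) (at P within S)"
proof -
  obtain PA PB where "\<And>z. A1 z t = cpoly PA z" "\<And>z. B1 z t = cpoly PB z"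
    using bipoly_fixed[OF bipoly_A1, of t] bipoly_fixed[OF bipoly_B1, of t] by metis
  thus ?thesis unfolding xi_reg_def by (auto intro!: tendsto_intros)
qed

text \<open>The limit that defines \<xi> at a removable singularity needs a nontrivial filter. Over
  points near z the root closer to w is taken; then |wn - w|^2 <= |wn - w| |wn + w| = |D(zn) -
  D(z)|.\<close>

lemma Surf_not_isolated:
  assumes P: "P \<in> Surf a b q"
  shows "at P within Surf a b q \<noteq> bot"
proof -
  obtain z w where zw: "P = (z, w)" by (cases P)
  define zn where "zn = (\<lambda>n. z + of_real (inverse (real (Suc n))))"
  define r where "r = (\<lambda>n. csqrt (cpoly DP (zn n)))"
  define wn where "wn = (\<lambda>n. if norm (r n - w) \<le> norm (r n + w) then r n else - r n)"
  have "(\<lambda>n. zn n) \<longlonglongrightarrow> z + of_real 0"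
    unfolding zn_def by (intro tendsto_intros LIMSEQ_inverse_real_of_nat)
  hence zn: "zn \<longlonglongrightarrow> z" by simp
  have "norm (wn n - w) \<le> norm (wn n + w)" for n
    by (auto simp: wn_def norm_minus_commute add.commute)
  hence "(norm (wn n - w))\<^sup>2 \<le> norm (wn n - w) * norm (wn n + w)" for n
    unfolding power2_eq_square by (intro mult_left_mono) auto
  moreover have "norm (wn n - w) * norm (wn n + w) = norm (cpoly DP (zn n) - cpoly DP z)" for n
  proof -
    have "(wn n)\<^sup>2 = cpoly DP (zn n)" by (simp add: wn_def r_def)
    moreover have "w\<^sup>2 = cpoly DP z" using P by (simp add: Surf_iff zw)
    ultimately have "cpoly DP (zn n) - cpoly DP z = (wn n - w) * (wn n + w)"
      by (simp add: power2_eq_square algebra_simps)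
    thus ?thesis by (simp add: norm_mult)
  qed
  ultimately have le: "(norm (wn n - w))\<^sup>2 \<le> norm (cpoly DP (zn n) - cpoly DP z)" for n
    by metis
  have "(\<lambda>n. norm (cpoly DP (zn n) - cpoly DP z)) \<longlonglongrightarrow> norm (cpoly DP z - cpoly DP z)"
    by (intro tendsto_intros zn)
  hence "(\<lambda>n. (norm (wn n - w))\<^sup>2) \<longlonglongrightarrow> 0"
    by (intro Lim_null_comparison[of "\<lambda>n. (norm (wn n - w))\<^sup>2"]) (use le in simp_all)
  hence "(\<lambda>n. sqrt ((norm (wn n - w))\<^sup>2)) \<longlonglongrightarrow> sqrt 0" by (rule tendsto_real_sqrt)
  hence "wn \<longlonglongrightarrow> w" by (simp add: tendsto_norm_zero_iff LIM_zero_iff)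
  hence lim: "(\<lambda>n. (zn n, wn n)) \<longlonglongrightarrow> P" unfolding zw by (intro tendsto_Pair zn)
  have "zn n \<noteq> z" for n by (simp add: zn_def del: of_nat_Suc)
  hence "(zn n, wn n) \<in> Surf a b q - {P}" for n
    by (auto simp: Surf_iff wn_def r_def zw)
  hence "P islimpt Surf a b q" unfolding islimpt_sequential using lim
    by (intro exI[of _ "\<lambda>n. (zn n, wn n)"]) simp
  thus ?thesis by (simp add: trivial_limit_within)
qed

lemma vphi_q_nz: "vphi q \<noteq> 0"
  using q by (cases q) auto

lemma Surf_eventually_vphi_nz:
  assumes P: "P \<in> Surf a b q"
  shows "\<forall>\<^sub>F P' in at P within Surf a b q. cpoly (vphi q) (fst P') \<noteq> 0"
proof -
  obtain z w where zw: "P = (z, w)" by (cases P)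
  have w2: "w\<^sup>2 = cpoly DP z" using P by (simp add: Surf_iff zw)
  define Z where "Z = {z. cpoly (vphi q) z = 0} - {z}"
  have "finite Z" using cpoly_eq_0_finite[OF vphi_q_nz] by (simp add: Z_def)
  hence "open (- Z)" by (simp add: finite_imp_closed open_Compl)
  \<comment> \<open>Besides the other zeros of \<open>vphi q\<close>, the second point (z, - w) over
    the same z has to be kept away. If w = 0 it is \<open>P\<close> itself, and nothing is
    removed.\<close>
  hence "open ((- Z) \<times> (- ({- w} - {w})))"
    by (intro open_Times open_Compl[of "{- w} - {w}"] finite_imp_closed) auto
  moreover have "P \<in> (- Z) \<times> (- ({- w} - {w}))" by (simp add: zw Z_def)
  ultimately have "\<forall>\<^sub>F P' in at P within Surf a b q. P' \<in> (- Z) \<times> (- ({- w} - {w}))"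
    unfolding eventually_at_topological by blast
  moreover have "\<forall>\<^sub>F P' in at P within Surf a b q. P' \<in> Surf a b q \<and> P' \<noteq> P"
    by (simp add: eventually_at_filter)
  ultimately show ?thesis
  proof eventually_elim
    case (elim P')
    show ?case
    proof
      assume "cpoly (vphi q) (fst P') = 0"
      hence "fst P' = z" using elim by (auto simp: Z_def mem_Times_iff)
      moreover have "snd P' = w \<or> snd P' = - w"
        using elim w2 calculation by (auto simp: Surf_iff power2_eq_iff[symmetric])
      hence "snd P' = w" using elim by (auto simp: mem_Times_iff)
      ultimately show False using elim by (auto simp: zw prod_eq_iff)
    qed
  qed
qed

lemma xi_eq:
  assumes P: "P \<in> Surf a b q"
  shows "xi a b q p v t P = xi_reg t P"
proof (cases "cpoly (vphi q) (fst P) = 0")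
  case False
  thus ?thesis using xi_raw_eq[OF P] by (simp add: xi_def varphi_eq)
next
  case True
  have "\<forall>\<^sub>F P' in at P within Surf a b q. P' \<in> Surf a b q"
    by (simp add: eventually_at_filter)
  hence "\<forall>\<^sub>F P' in at P within Surf a b q. xi_reg t P' = xi_raw a b q p v t P'"
    using Surf_eventually_vphi_nz[OF P] by eventually_elim (simp add: xi_raw_eq)
  hence "(xi_raw a b q p v t \<longlongrightarrow> xi_reg t P) (at P within Surf a b q)"
    by (rule Lim_transform_eventually[OF xi_reg_tendsto])
  hence "Lim (at P within Surf a b q) (xi_raw a b q p v t) = xi_reg t P"
    by (rule tendsto_Lim[OF Surf_not_isolated[OF P]])
  thus ?thesis using True by (simp add: xi_def varphi_eq)
qed

section \<open>The polynomial J\<close>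

text \<open>Off the zeros of \<open>vphi q\<close> the function \<open>alpha_fun\<close> is \<xi> /
  (2 w). As w tends to i \<omega>, its imaginary part tends to - t A1 / (2 \<omega>), and the factor
  2 \<Omega> = 2 \<omega> removes \<omega>.\<close>

lemma boundary_values:
  assumes k: "k \<in> {1..q}" and x: "lp (k - 1) < x" "x < lm k"
  shows "2 * boundary_value a b q Omega x *
       of_real (Im (boundary_value a b q (alpha_fun a b q p v t) x)) = - of_real t * A1 (of_real x) t"
proof -
  obtain \<omega> where lim: "((\<lambda>e. phys_sqrt a b q (Complex x e)) \<longlongrightarrow> \<i> * of_real \<omega>) (at_right 0)"
    and \<omega>: "\<omega> \<noteq> 0"
    using phys_sqrt_boundary[OF k x] by metis
  let ?P = "\<lambda>e. (Complex x e, phys_sqrt a b q (Complex x e))"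
  have cC: "((\<lambda>e. Complex x e) \<longlongrightarrow> of_real x) (at_right 0)"
    by (auto simp: complex_of_real_def intro!: tendsto_Complex tendsto_intros)
  have "((\<lambda>e. Omega (?P e)) \<longlongrightarrow> \<i> * of_real \<omega> / \<i>) (at_right 0)"
    unfolding Omega_def snd_conv by (intro tendsto_intros lim) auto
  hence 1: "boundary_value a b q Omega x = of_real \<omega>"
    unfolding boundary_value_def by (subst tendsto_Lim) auto
  \<comment> \<open>At a zero of \<open>vphi q\<close> the factorization makes D the square of
    \<open>PhiP\<close>, but D < 0 inside a band.\<close>
  have "poly (vphi q) x \<noteq> 0"
    using DP_neg[OF k x] DP_factor_real[of x] by (auto simp: not_less[symmetric])
  hence "cpoly (vphi q) (of_real x) \<noteq> 0" by simp
  moreover have "((\<lambda>e. cpoly (vphi q) (Complex x e)) \<longlongrightarrow> cpoly (vphi q) (of_real x)) (at_right 0)"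
    by (intro tendsto_intros cC)
  ultimately have nz: "\<forall>\<^sub>F e in at_right 0. cpoly (vphi q) (Complex x e) \<noteq> 0"
    by (metis tendsto_imp_eventually_ne)
  have pos: "\<forall>\<^sub>F e in at_right 0. e > (0::real)" by (rule eventually_at_right_less)
  have ev: "\<forall>\<^sub>F e in at_right 0. xi_reg t (?P e) / (2 * snd (?P e)) = alpha_fun a b q p v t (?P e)"
    using nz pos
  proof eventually_elim
    case (elim e)
    have "Complex x e \<notin> of_real ` spec0 a b q" using elim by (auto simp: complex_eq_iff)
    hence "?P e \<in> Surf a b q" using phys_square phys_sqrt_eq by (simp add: Surf_iff)
    hence "xi_reg t (?P e) = xi_raw a b q p v t (?P e)" using xi_raw_eq elim by simp
    moreover have "2 * \<i> * Omega (?P e) = 2 * snd (?P e)" by (simp add: Omega_def)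
    ultimately show ?case by (simp add: alpha_fun_def xi_raw_def mult_ac)
  qed
  define \<alpha> \<beta> where "\<alpha> = Re (A1 (of_real x) t)" and "\<beta> = Re (B1 (of_real x) t)"
  have ab: "A1 (of_real x) t = of_real \<alpha>" "B1 (of_real x) t = of_real \<beta>"
    unfolding \<alpha>_def \<beta>_def using bipoly_real[OF bipoly_A1] bipoly_real[OF bipoly_B1] by blast+
  obtain PA PB where "\<And>z. A1 z t = cpoly PA z" "\<And>z. B1 z t = cpoly PB z"
    using bipoly_fixed[OF bipoly_A1, of t] bipoly_fixed[OF bipoly_B1, of t] by metis
  hence "((\<lambda>e. xi_reg t (?P e) / (2 * snd (?P e))) \<longlongrightarrow>
      (of_real t * A1 (of_real x) t + \<i> * of_real \<omega> * (2 + of_real t * B1 (of_real x) t)) / (2 * (\<i> * of_real \<omega>))) (at_right 0)"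
    unfolding xi_reg_def using \<omega> by (auto simp del: cpoly_of_real intro!: tendsto_intros lim cC)
  from Lim_transform_eventually[OF this ev]
  have "boundary_value a b q (alpha_fun a b q p v t) x =
     (of_real t * of_real \<alpha> + \<i> * of_real \<omega> * (2 + of_real t * of_real \<beta>)) / (2 * (\<i> * of_real \<omega>))"
    unfolding boundary_value_def ab by (intro tendsto_Lim) auto
  also have "\<dots> = Complex ((2 + t * \<beta>) / 2) (- t * \<alpha> / (2 * \<omega>))"
    using \<omega> by (simp add: complex_eq_iff Re_divide Im_divide power2_eq_square field_simps)
  finally show ?thesis unfolding 1 ab using \<omega> by simp
qed

lemma J_poly_eq: "poly (J_poly a b q p v t) x = - t * Re (A1 (of_real x) t)"
proof -
  obtain PA where PA: "\<And>z. A1 z t = cpoly PA z"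
    using bipoly_fixed[OF bipoly_A1, of t] by metis
  have rhs: "2 * boundary_value a b q Omega x *
       of_real (Im (boundary_value a b q (alpha_fun a b q p v t) x)) = of_real (poly (smult (- t) PA) x)"
    if "k \<in> {1..q}" "lp (k - 1) < x" "x < lm k" for k x
    using boundary_values[OF that, of t] by (simp add: PA)
  have "J_poly a b q p v t = smult (- t) PA"
    unfolding J_poly_def
  proof (rule the_equality)
    show "\<forall>x\<in>spec0 a b q. (Delta a b q (of_real x))\<^sup>2 \<noteq> 1 \<longrightarrow>
      of_real (poly (smult (- t) PA) x) = 2 * boundary_value a b q Omega x *
        of_real (Im (boundary_value a b q (alpha_fun a b q p v t) x))"
    proof (intro ballI impI)
      fix x assume x: "x \<in> spec0 a b q" "(Delta a b q (of_real x))\<^sup>2 \<noteq> 1"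
      then obtain k where k: "k \<in> {1..q}" "lp (k - 1) \<le> x" "x \<le> lm k" by (auto simp: mem_spec0)
      have "poly DP x \<noteq> 0" using x(2) cpoly_DP[of "of_real x"] by auto
      hence "x \<noteq> lp (k - 1)" "x \<noteq> lm k" using DP_edge(1)[of k] DP_edge(2)[of "k - 1"] k by auto
      thus "of_real (poly (smult (- t) PA) x) = 2 * boundary_value a b q Omega x *
        of_real (Im (boundary_value a b q (alpha_fun a b q p v t) x))" using rhs[of k x] k by simp
    qed
    fix J assume J: "\<forall>x\<in>spec0 a b q. (Delta a b q (of_real x))\<^sup>2 \<noteq> 1 \<longrightarrow>
      of_real (poly J x) = 2 * boundary_value a b q Omega x *
        of_real (Im (boundary_value a b q (alpha_fun a b q p v t) x))"
    \<comment> \<open>The interior of the first band is infinite and so determines the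
      polynomial.\<close>
    have "poly (J - smult (- t) PA) x = 0" if x: "x \<in> {lp 0<..<lm 1}" for x
    proof -
      have "poly DP x < 0" using x q DP_neg[of 1 x] by auto
      hence "(Delta a b q (of_real x))\<^sup>2 \<noteq> 1" using cpoly_DP[of "of_real x"] by auto
      moreover have "x \<in> spec0 a b q" using x q by (auto simp: mem_spec0 intro!: bexI[of _ 1])
      ultimately have "of_real (poly J x) = complex_of_real (poly (smult (- t) PA) x)"
        using J rhs[of 1 x] x q by auto
      thus ?thesis unfolding of_real_eq_iff by simp
    qed
    moreover have "infinite {lp 0<..<lm 1}" using lp_lm_Suc[of 1] q by (simp add: infinite_Ioo)
    ultimately have "infinite {x. poly (J - smult (- t) PA) x = 0}"
      by (metis (mono_tags, lifting) infinite_super mem_Collect_eq subsetI)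
    hence "J - smult (- t) PA = 0" using poly_roots_finite by blast
    thus "J = smult (- t) PA" by (simp only: right_minus_eq)
  qed
  thus ?thesis by (simp add: PA)
qed

end

section \<open>States near a simple band edge\<close>

text \<open>The zeros of \<open>t \<alpha> + w (2 + t \<beta>)\<close> on the curve \<open>w\<^sup>2 = D x\<close> over a segment starting at a simple zero
  \<open>e\<close> of \<open>D\<close>, with \<open>d = D' e\<close>.\<close>

locale edge_problem =
  fixes D :: "real \<Rightarrow> real" and \<alpha> \<beta> :: "real \<Rightarrow> real \<Rightarrow> real" and e f C m d :: real
  assumes D_e: "D e = 0" and D_f: "D f > 0" and m: "m > 0" and C: "C > 0" and d: "d \<noteq> 0"
    and D_nonneg: "x \<in> closed_segment e f \<Longrightarrow> D x \<ge> 0"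
    and D_expand: "x \<in> closed_segment e f \<Longrightarrow> y \<in> closed_segment e f \<Longrightarrow> m * \<bar>x - y\<bar> \<le> \<bar>D x - D y\<bar>"
    and D_taylor: "x \<in> closed_segment e f \<Longrightarrow> \<bar>D x - d * (x - e)\<bar> \<le> C * (x - e)\<^sup>2"
    and D_cont: "continuous_on (closed_segment e f) D"
    and \<alpha>_bound: "x \<in> closed_segment e f \<Longrightarrow> 0 \<le> t \<Longrightarrow> t \<le> 1 \<Longrightarrow> \<bar>\<alpha> x t\<bar> \<le> C"
    and \<beta>_bound: "x \<in> closed_segment e f \<Longrightarrow> 0 \<le> t \<Longrightarrow> t \<le> 1 \<Longrightarrow> \<bar>\<beta> x t\<bar> \<le> C"
    and \<alpha>_lip: "x \<in> closed_segment e f \<Longrightarrow> y \<in> closed_segment e f \<Longrightarrow> 0 \<le> s \<Longrightarrow> s \<le> 1 \<Longrightarrow> 0 \<le> t \<Longrightarrow> t \<le> 1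
      \<Longrightarrow> \<bar>\<alpha> x t - \<alpha> y s\<bar> \<le> C * (\<bar>x - y\<bar> + \<bar>t - s\<bar>)"
    and \<beta>_lip: "x \<in> closed_segment e f \<Longrightarrow> y \<in> closed_segment e f \<Longrightarrow> 0 \<le> s \<Longrightarrow> s \<le> 1 \<Longrightarrow> 0 \<le> t \<Longrightarrow> t \<le> 1
      \<Longrightarrow> \<bar>\<beta> x t - \<beta> y s\<bar> \<le> C * (\<bar>x - y\<bar> + \<bar>t - s\<bar>)"
begin

definition state_at :: "real \<Rightarrow> real \<Rightarrow> real \<Rightarrow> bool" where
  "state_at t x w \<longleftrightarrow> x \<in> closed_segment e f \<and> w\<^sup>2 = D x \<and> t * \<alpha> x t + w * (2 + t * \<beta> x t) = 0"

lemma denominator_ge_1: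
  assumes "x \<in> closed_segment e f" "0 \<le> t" "t \<le> 1" "t * C \<le> 1"
  shows "2 + t * \<beta> x t \<ge> 1"
proof -
  have "\<bar>t * \<beta> x t\<bar> \<le> t * C"
    using \<beta>_bound[of x t] assms by (simp add: abs_mult mult_left_mono)
  thus ?thesis using assms by linarith
qed

lemma state_at_bound:
  assumes t: "0 \<le> t" "t \<le> 1" "t * C \<le> 1" and s: "state_at t x w"
  shows "\<bar>w\<bar> \<le> t * C"
proof -
  have x: "x \<in> closed_segment e f" and eq: "w * (2 + t * \<beta> x t) = - (t * \<alpha> x t)"
    using s by (auto simp: state_at_def)
  have "\<bar>w\<bar> * 1 \<le> \<bar>w\<bar> * \<bar>2 + t * \<beta> x t\<bar>"
    using denominator_ge_1[OF x t] by (intro mult_left_mono) auto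
  also have "\<dots> = \<bar>t * \<alpha> x t\<bar>" using eq by (simp add: abs_mult[symmetric])
  also have "\<dots> \<le> t * C" using \<alpha>_bound[OF x t(1,2)] t by (simp add: abs_mult mult_left_mono)
  finally show ?thesis by simp
qed

text \<open>A contraction estimate: |x1 - x2| is at most (2 C / m) \<delta> with \<delta> = |w1 -
  w2|, and the equation for the states then gives 2 \<delta> <= t K \<delta> <= \<delta>. The
  bracket in the last smallness condition is this K.\<close>

lemma state_at_unique:
  assumes t: "0 \<le> t" "t \<le> 1" "t * C \<le> 1" "t * (2 * C\<^sup>2 / m + C + 2 * C ^ 3 / m) \<le> 1"
    and s1: "state_at t x1 w1" and s2: "state_at t x2 w2"
  shows "x1 = x2 \<and> w1 = w2"
proof -
  have x: "x1 \<in> closed_segment e f" "x2 \<in> closed_segment e f" using s1 s2 by (auto simp: state_at_def)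
  define \<delta> where "\<delta> = \<bar>w1 - w2\<bar>"
  have w: "\<bar>w1\<bar> \<le> t * C" "\<bar>w2\<bar> \<le> t * C" using state_at_bound[OF t(1-3)] s1 s2 by auto
  have wC: "\<bar>w1\<bar> \<le> C" "\<bar>w2\<bar> \<le> C" using w t C mult_right_mono[of t 1 C] by linarith+
  have "m * \<bar>x1 - x2\<bar> \<le> \<bar>w1\<^sup>2 - w2\<^sup>2\<bar>"
    using D_expand[OF x] s1 s2 by (auto simp: state_at_def)
  also have "\<bar>w1\<^sup>2 - w2\<^sup>2\<bar> = \<delta> * \<bar>w1 + w2\<bar>"
    by (simp add: \<delta>_def abs_mult[symmetric] power2_eq_square algebra_simps)
  also have "\<dots> \<le> \<delta> * (2 * C)" using wC by (intro mult_left_mono) (auto simp: \<delta>_def)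
  finally have dx: "\<bar>x1 - x2\<bar> \<le> 2 * C / m * \<delta>" using m by (simp add: field_simps)
  have Cdx: "C * \<bar>x1 - x2\<bar> \<le> C * (2 * C / m * \<delta>)" using dx C by (intro mult_left_mono) auto
  have 1: "\<bar>\<alpha> x1 t - \<alpha> x2 t\<bar> \<le> C * (2 * C / m * \<delta>)"
    using order_trans[OF _ Cdx] \<alpha>_lip[OF x, of t t] t by simp
  have b: "\<bar>\<beta> x1 t - \<beta> x2 t\<bar> \<le> C * (2 * C / m * \<delta>)"
    using order_trans[OF _ Cdx] \<beta>_lip[OF x, of t t] t by simp
  have "\<bar>w1 * \<beta> x1 t - w2 * \<beta> x2 t\<bar> = \<bar>(w1 - w2) * \<beta> x1 t + w2 * (\<beta> x1 t - \<beta> x2 t)\<bar>"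
    by (simp add: algebra_simps)
  also have "\<dots> \<le> \<bar>w1 - w2\<bar> * \<bar>\<beta> x1 t\<bar> + \<bar>w2\<bar> * \<bar>\<beta> x1 t - \<beta> x2 t\<bar>"
    by (metis abs_mult abs_triangle_ineq)
  also have "\<dots> \<le> \<delta> * C + C * (C * (2 * C / m * \<delta>))"
    using b wC C m \<beta>_bound[OF x(1) t(1,2)] by (intro add_mono mult_mono) (auto simp: \<delta>_def)
  finally have 2: "\<bar>w1 * \<beta> x1 t - w2 * \<beta> x2 t\<bar> \<le> \<delta> * C + C * (C * (2 * C / m * \<delta>))" .
  have "2 * (w1 - w2) = - (t * ((\<alpha> x1 t - \<alpha> x2 t) + (w1 * \<beta> x1 t - w2 * \<beta> x2 t)))"
    using s1 s2 unfolding state_at_def by (simp add: algebra_simps)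
  hence "\<bar>2 * (w1 - w2)\<bar> = \<bar>t\<bar> * \<bar>(\<alpha> x1 t - \<alpha> x2 t) + (w1 * \<beta> x1 t - w2 * \<beta> x2 t)\<bar>"
    by (simp only: abs_minus_cancel abs_mult)
  moreover have "\<bar>2 * (w1 - w2)\<bar> = 2 * \<delta>" by (simp only: \<delta>_def abs_mult abs_numeral)
  ultimately have "2 * \<delta> = t * \<bar>(\<alpha> x1 t - \<alpha> x2 t) + (w1 * \<beta> x1 t - w2 * \<beta> x2 t)\<bar>"
    using t(1) by (simp only: abs_of_nonneg)
  also have "\<dots> \<le> t * (C * (2 * C / m * \<delta>) + (\<delta> * C + C * (C * (2 * C / m * \<delta>))))"
    using 1 2 t by (intro mult_left_mono) linarith+
  also have "\<dots> = (t * (2 * C\<^sup>2 / m + C + 2 * C ^ 3 / m)) * \<delta>"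
    by (simp add: algebra_simps power2_eq_square power3_eq_cube)
  also have "\<dots> \<le> 1 * \<delta>" using t by (intro mult_right_mono) (auto simp: \<delta>_def)
  finally have "\<delta> = 0" by (simp add: \<delta>_def)
  thus ?thesis using dx by (auto simp: \<delta>_def)
qed

text \<open>Eliminating w leaves the real equation \<open>F x = 0\<close>. Here \<open>F\<close> is
  at most 0 at the edge, where D vanishes, and at least 0 at \<open>f\<close>, where D exceeds (t
  C)^2. The sign of w lost by squaring is recovered from the linear equation.\<close>

lemma state_at_exists:
  assumes t: "0 \<le> t" "t \<le> 1" "t * C \<le> 1" "(t * C)\<^sup>2 < D f"
  shows "\<exists>x w. state_at t x w"
proof -
  let ?S = "closed_segment e f"
  define F where "F = (\<lambda>x. (2 + t * \<beta> x t)\<^sup>2 * D x - (t * \<alpha> x t)\<^sup>2)"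
  have lip: "continuous_on ?S g"
    if "\<And>x y. x \<in> ?S \<Longrightarrow> y \<in> ?S \<Longrightarrow> \<bar>g x - g y\<bar> \<le> C * \<bar>x - y\<bar>" for g :: "real \<Rightarrow> real"
    by (rule lipschitz_on_continuous_on[of C])
       (use that C in \<open>auto simp: lipschitz_on_def dist_real_def\<close>)
  have "continuous_on ?S (\<lambda>x. \<alpha> x t)" "continuous_on ?S (\<lambda>x. \<beta> x t)"
    using \<alpha>_lip[of _ _ t t] \<beta>_lip[of _ _ t t] t by (auto intro!: lip)
  hence "continuous_on ?S F" unfolding F_def by (intro continuous_intros D_cont)
  hence "connected (F ` ?S)" by (intro connected_continuous_image) auto
  moreover have "F e \<in> F ` ?S" "F f \<in> F ` ?S" by auto
  moreover have "F e \<le> 0" by (simp add: F_def D_e)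
  moreover have "F f \<ge> 0"
  proof -
    have "1\<^sup>2 \<le> (2 + t * \<beta> f t)\<^sup>2" using denominator_ge_1[of f t] t by (intro power_mono) auto
    hence "1 * D f \<le> (2 + t * \<beta> f t)\<^sup>2 * D f" using D_f by (intro mult_right_mono) auto
    moreover have "\<bar>t * \<alpha> f t\<bar> \<le> t * C"
      using \<alpha>_bound[of f t] t by (simp add: abs_mult mult_left_mono)
    hence "(t * \<alpha> f t)\<^sup>2 \<le> (t * C)\<^sup>2" by (metis abs_ge_zero power2_abs power_mono)
    ultimately show ?thesis using t(4) by (simp add: F_def)
  qed
  ultimately have "0 \<in> F ` ?S" using connected_contains_Icc[of "F ` ?S" "F e" "F f"] by auto
  then obtain x where x: "x \<in> ?S" "F x = 0" by auto
  define w where "w = - (t * \<alpha> x t) / (2 + t * \<beta> x t)"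
  have nz: "2 + t * \<beta> x t \<noteq> 0" using denominator_ge_1[OF x(1) t(1-3)] by linarith
  hence "t * \<alpha> x t + w * (2 + t * \<beta> x t) = 0" by (simp add: w_def)
  moreover have "w\<^sup>2 = D x" using x(2) nz by (simp add: w_def F_def power_divide field_simps)
  ultimately show ?thesis using x by (auto simp: state_at_def)
qed

text \<open>To leading order w is \<open>w0\<close> = - t \<alpha>(e, 0) / 2, with an error O(t^2),
  so w^2 is known up to O(t^3). As x - e = O(t^2), the Taylor remainder of D is O(t^4), and D x =
  w^2 can be solved for x.\<close>

lemma state_at_asymptotics:
  assumes t: "0 \<le> t" "t \<le> 1" "t * C \<le> 1" and s: "state_at t x w"
  shows "\<bar>x - (e + t\<^sup>2 * (\<alpha> e 0)\<^sup>2 / (4 * d))\<bar>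
    \<le> ((C * (C\<^sup>2 / m) + C + C\<^sup>2) * (2 * C) + C * (C\<^sup>2 / m)\<^sup>2) / \<bar>d\<bar> * t ^ 3"
proof -
  have x: "x \<in> closed_segment e f" and Dx: "D x = w\<^sup>2"
    and eq: "t * \<alpha> x t + w * (2 + t * \<beta> x t) = 0" using s by (auto simp: state_at_def)
  have e: "e \<in> closed_segment e f" by simp
  \<comment> \<open>The estimates to come are |x - e| <= c1 t^2 and |w - w0| <= c2 t^2.\<close>
  define c1 where "c1 = C\<^sup>2 / m"
  define c2 where "c2 = C * c1 + C + C\<^sup>2"
  have c: "c1 \<ge> 0" "c2 \<ge> 0" using C m by (auto simp: c1_def c2_def)
  have w: "\<bar>w\<bar> \<le> t * C" by (rule state_at_bound[OF t s])
  hence w2: "w\<^sup>2 \<le> (t * C)\<^sup>2" by (metis abs_ge_zero power2_abs power_mono)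
  have "m * \<bar>x - e\<bar> \<le> \<bar>D x - D e\<bar>" by (rule D_expand[OF x e])
  hence "m * \<bar>x - e\<bar> \<le> (t * C)\<^sup>2" using w2 by (simp add: Dx D_e)
  hence xe: "\<bar>x - e\<bar> \<le> t\<^sup>2 * c1" using m by (simp add: c1_def field_simps)
  have t2: "t\<^sup>2 \<le> t" "t ^ 4 \<le> t ^ 3" using t by (auto simp: power2_eq_square mult_left_le power_decreasing)
  define w0 where "w0 = - (t * \<alpha> e 0) / 2"
  have a0: "\<bar>\<alpha> e 0\<bar> \<le> C" using \<alpha>_bound[OF e, of 0] by simp
  have "\<bar>t * \<alpha> e 0\<bar> \<le> t * C" using a0 t by (simp add: abs_mult mult_left_mono)
  hence w0: "\<bar>w0\<bar> \<le> t * C" by (simp add: w0_def)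
  have "\<bar>\<alpha> x t - \<alpha> e 0\<bar> \<le> C * (\<bar>x - e\<bar> + \<bar>t - 0\<bar>)" using t by (intro \<alpha>_lip x e) auto
  also have "\<dots> \<le> C * (t * c1 + t)"
    using xe t2 c mult_right_mono[of "t\<^sup>2" t c1] C t by (intro mult_left_mono) auto
  finally have 1: "\<bar>\<alpha> x t - \<alpha> e 0\<bar> \<le> t * (C * c1 + C)" by (simp add: algebra_simps)
  have "\<bar>w * \<beta> x t\<bar> \<le> (t * C) * C"
    unfolding abs_mult using w \<beta>_bound[OF x t(1,2)] t C by (intro mult_mono) auto
  hence 2: "\<bar>w * \<beta> x t\<bar> \<le> t * C\<^sup>2" by (simp add: power2_eq_square)
  have "2 * (w - w0) = - (t * ((\<alpha> x t - \<alpha> e 0) + w * \<beta> x t))"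
    using eq by (simp add: w0_def algebra_simps)
  hence "2 * \<bar>w - w0\<bar> = t * \<bar>(\<alpha> x t - \<alpha> e 0) + w * \<beta> x t\<bar>"
    using t by (metis abs_minus_cancel abs_mult abs_numeral abs_of_nonneg)
  also have "\<dots> \<le> t * (t * (C * c1 + C) + t * C\<^sup>2)" using 1 2 t by (intro mult_left_mono) linarith+
  also have "\<dots> = t\<^sup>2 * c2" by (simp add: c2_def power2_eq_square algebra_simps)
  finally have ww0: "\<bar>w - w0\<bar> \<le> t\<^sup>2 * c2" by (rule order_trans[rotated]) simp
  have "\<bar>w\<^sup>2 - w0\<^sup>2\<bar> = \<bar>w - w0\<bar> * \<bar>w + w0\<bar>"
    by (simp add: abs_mult[symmetric] power2_eq_square algebra_simps)
  also have "\<dots> \<le> (t\<^sup>2 * c2) * (2 * (t * C))"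
    using ww0 w w0 c by (intro mult_mono) auto
  also have "\<dots> = c2 * (2 * C) * t ^ 3" by (simp add: power2_eq_square power3_eq_cube)
  finally have 3: "\<bar>w\<^sup>2 - w0\<^sup>2\<bar> \<le> c2 * (2 * C) * t ^ 3" .
  have "(x - e)\<^sup>2 \<le> (t\<^sup>2 * c1)\<^sup>2" using xe by (metis abs_ge_zero power2_abs power_mono)
  also have "\<dots> = t ^ 4 * c1\<^sup>2" by (simp add: power_mult_distrib power_mult[symmetric])
  also have "\<dots> \<le> t ^ 3 * c1\<^sup>2" using t2 by (intro mult_right_mono) auto
  finally have "C * (x - e)\<^sup>2 \<le> C * (t ^ 3 * c1\<^sup>2)" using C by simp
  with D_taylor[OF x] have "\<bar>w\<^sup>2 - d * (x - e)\<bar> \<le> C * c1\<^sup>2 * t ^ 3" by (simp add: Dx mult_ac)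
  with 3 have 4: "\<bar>d * (x - e) - w0\<^sup>2\<bar> \<le> (c2 * (2 * C) + C * c1\<^sup>2) * t ^ 3"
    unfolding distrib_right by linarith
  have "w0\<^sup>2 = t\<^sup>2 * (\<alpha> e 0)\<^sup>2 / 4" by (simp add: w0_def power_divide power_mult_distrib)
  hence "d * (x - (e + t\<^sup>2 * (\<alpha> e 0)\<^sup>2 / (4 * d))) = d * (x - e) - w0\<^sup>2" using d by (simp add: field_simps)
  hence "\<bar>d\<bar> * \<bar>x - (e + t\<^sup>2 * (\<alpha> e 0)\<^sup>2 / (4 * d))\<bar> \<le> (c2 * (2 * C) + C * c1\<^sup>2) * t ^ 3"
    using 4 by (simp add: abs_mult[symmetric])
  thus ?thesis using d unfolding c1_def[symmetric] c2_def[symmetric] by (simp add: field_simps)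
qed

end

section \<open>Estimates and states over one nonempty gap\<close>

context perturbed_jacobi
begin

abbreviation \<alpha>r :: "real \<Rightarrow> real \<Rightarrow> real" where "\<alpha>r x t \<equiv> Re (A1 (of_real x) t)"
abbreviation \<beta>r :: "real \<Rightarrow> real \<Rightarrow> real" where "\<beta>r x t \<equiv> Re (B1 (of_real x) t)"

lemma A1_real: "A1 (of_real x) t = of_real (\<alpha>r x t)" and B1_real: "B1 (of_real x) t = of_real (\<beta>r x t)"
  using bipoly_real[OF bipoly_A1] bipoly_real[OF bipoly_B1] by blast+

lemma xi_reg_real: "xi_reg t (of_real x, of_real w) = of_real (t * \<alpha>r x t + w * (2 + t * \<beta>r x t))"
proof -
  have "xi_reg t (of_real x, of_real w) = of_real t * of_real (\<alpha>r x t) + of_real w * (2 + of_real t * of_real (\<beta>r x t))"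
    unfolding xi_reg_def fst_conv snd_conv A1_real[symmetric] B1_real[symmetric] ..
  thus ?thesis by simp
qed

definition A1' :: "complex \<Rightarrow> real \<Rightarrow> complex" where "A1' z t = deriv (\<lambda>z. A1 z t) z"
definition B1' :: "complex \<Rightarrow> real \<Rightarrow> complex" where "B1' z t = deriv (\<lambda>z. B1 z t) z"

lemma A1': "((\<lambda>z. A1 z t) has_field_derivative A1' z t) (at z)" "bipoly A1'"
  and B1': "((\<lambda>z. B1 z t) has_field_derivative B1' z t) (at z)" "bipoly B1'"
proof -
  obtain F where F: "bipoly F" "\<And>z t. ((\<lambda>z. A1 z t) has_field_derivative F z t) (at z)"
    using bipoly_deriv[OF bipoly_A1] by blast
  have "A1' = F" using DERIV_imp_deriv[OF F(2)] by (simp add: A1'_def fun_eq_iff)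
  thus "((\<lambda>z. A1 z t) has_field_derivative A1' z t) (at z)" "bipoly A1'" using F by auto
  obtain G where G: "bipoly G" "\<And>z t. ((\<lambda>z. B1 z t) has_field_derivative G z t) (at z)"
    using bipoly_deriv[OF bipoly_B1] by blast
  have "B1' = G" using DERIV_imp_deriv[OF G(2)] by (simp add: B1'_def fun_eq_iff)
  thus "((\<lambda>z. B1 z t) has_field_derivative B1' z t) (at z)" "bipoly B1'" using G by auto
qed

lemma Surf_real_iff: "(of_real x, of_real w) \<in> Surf a b q \<longleftrightarrow> w\<^sup>2 = poly DP x"
proof -
  have "(of_real x, of_real w) \<in> Surf a b q \<longleftrightarrow> complex_of_real (w\<^sup>2) = of_real (poly DP x)"
    by (simp add: Surf_iff)
  thus ?thesis unfolding of_real_eq_iff .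
qed

text \<open>Near a simple band edge the second coordinate \<open>w\<close> is a local parameter of the surface.\<close>

lemma simple_zero_xi:
  assumes w2: "w\<^sup>2 = poly DP x" and D': "m \<le> \<bar>poly (pderiv DP) x\<bar>" "m > 0"
    and t: "0 \<le> t" "t \<le> 1" "t * (2 * C\<^sup>2 / m + C + 2 * C ^ 3 / m) \<le> 1" and w: "\<bar>w\<bar> \<le> t * C" and C: "C > 0"
    and bnd: "norm (B1 (of_real x) t) \<le> C" "norm (A1' (of_real x) t) \<le> C" "norm (B1' (of_real x) t) \<le> C"
    and zero: "t * \<alpha>r x t + w * (2 + t * \<beta>r x t) = 0"
  shows "simple_zero a b q (xi a b q p v t) (of_real x, of_real w)"
proof -
  let ?P = "(complex_of_real x, complex_of_real w)"
  define z0 where "z0 = complex_of_real x"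
  define W where "W = complex_of_real w"
  have P: "?P \<in> Surf a b q" using w2 by (simp add: Surf_real_iff)
  have dz0: "deriv (cpoly DP) z0 = of_real (poly (pderiv DP) x)"
    using DERIV_imp_deriv[OF has_field_derivative_cpoly[of DP z0]] by (simp add: z0_def)
  hence nz: "deriv (cpoly DP) z0 \<noteq> 0" using D' by auto
  \<comment> \<open>A local inverse \<open>h\<close> of D solves D = (W + z)^2 for the spectral
    parameter; the resulting parametrization has as its variable z the increment of w.\<close>
  obtain r where r: "r > 0" "open (cpoly DP ` ball z0 r)" "inj_on (cpoly DP) (ball z0 r)"
    using has_complex_derivative_locally_invertible[OF cpoly_holomorphic[of DP UNIV] UNIV_I open_UNIV nz] by metis
  obtain h where h: "h holomorphic_on (cpoly DP ` ball z0 r)"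
    "\<And>z. z \<in> ball z0 r \<Longrightarrow> deriv (cpoly DP) z * deriv h (cpoly DP z) = 1"
    "\<And>z. z \<in> ball z0 r \<Longrightarrow> h (cpoly DP z) = z"
    using holomorphic_has_inverse[OF cpoly_holomorphic[of DP] open_ball r(3)] by metis
  let ?T = "cpoly DP ` ball z0 r"
  have Dz0: "cpoly DP z0 = W\<^sup>2" using w2 by (simp add: z0_def W_def flip: of_real_power)
  have WT: "W\<^sup>2 \<in> ?T" unfolding Dz0[symmetric] using r by auto
  have DPh: "cpoly DP (h u) = u" if "u \<in> ?T" for u using that h(3) by auto
  have "open ((\<lambda>z. (W + z)\<^sup>2) -` ?T)"
    by (rule open_vimage[OF r(2)]) (intro continuous_intros)
  moreover have "0 \<in> (\<lambda>z. (W + z)\<^sup>2) -` ?T" using WT by simp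
  ultimately obtain s where s: "s > 0" "\<And>z. z \<in> ball 0 s \<Longrightarrow> (W + z)\<^sup>2 \<in> ?T"
    using open_contains_ball by (metis (no_types, lifting) subset_iff vimageD)
  define g where "g = (\<lambda>z. (h ((W + z)\<^sup>2), W + z))"
  have gS: "g z \<in> Surf a b q" if "z \<in> ball 0 s" for z
    using DPh[OF s(2)[OF that]] by (simp add: Surf_iff g_def)
  have "(h \<circ> (\<lambda>z. (W + z)\<^sup>2)) holomorphic_on ball 0 s"
    by (rule holomorphic_on_compose_gen[OF _ h(1)]) (use s in \<open>auto intro!: holomorphic_intros\<close>)
  hence hol: "(\<lambda>z. fst (g z)) holomorphic_on ball 0 s" by (simp add: g_def o_def)
  have h0: "h (W\<^sup>2) = z0" using h(3)[of z0] r Dz0 by simp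
  have lp: "local_parametrization a b q ?P g"
    unfolding local_parametrization_def
  proof (intro conjI exI[of _ s])
    show "(\<lambda>z. snd (g z)) holomorphic_on ball 0 s" by (auto simp: g_def intro!: holomorphic_intros)
    show "g 0 = ?P" using h0 by (simp add: g_def z0_def W_def)
    have "((\<lambda>z. snd (g z)) has_field_derivative 1) (at 0)"
      unfolding g_def snd_conv by (auto intro!: derivative_eq_intros)
    hence "deriv (\<lambda>z. snd (g z)) 0 = 1" by (rule DERIV_imp_deriv)
    thus "deriv (\<lambda>z. fst (g z)) 0 \<noteq> 0 \<or> deriv (\<lambda>z. snd (g z)) 0 \<noteq> 0" by simp
  qed (use s gS hol in auto)
  define h' where "h' = deriv h (W\<^sup>2)"
  have dh: "(h has_field_derivative h') (at (W\<^sup>2))"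
    unfolding h'_def by (rule holomorphic_derivI[OF h(1) r(2) WT])
  have "deriv (cpoly DP) z0 * h' = 1" using h(2)[of z0] r Dz0 by (simp add: h'_def)
  hence "\<bar>poly (pderiv DP) x\<bar> * norm h' = 1" unfolding dz0 by (metis norm_mult norm_of_real norm_one)
  hence "m * norm h' \<le> 1" using D'(1) mult_right_mono[of m _ "norm h'"] by (metis norm_ge_zero)
  hence nh: "norm h' \<le> 1 / m" using D'(2) by (simp add: field_simps)
  define e where "e = h' * (2 * W)"
  have de: "((\<lambda>z. h ((W + z)\<^sup>2)) has_field_derivative e) (at 0)"
  proof -
    have "((\<lambda>z. (W + z)\<^sup>2) has_field_derivative 2 * W) (at 0)" by (auto intro!: derivative_eq_intros)
    from DERIV_chain2[of h h' "\<lambda>z. (W + z)\<^sup>2" 0, OF _ this] dh show ?thesis by (simp add: e_def)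
  qed
  have dA: "((\<lambda>z. A1 (h ((W + z)\<^sup>2)) t) has_field_derivative A1' z0 t * e) (at 0)"
    using DERIV_chain2[OF _ de, of "\<lambda>z. A1 z t" "A1' z0 t"] A1'(1)[of t z0] h0 by simp
  have dB: "((\<lambda>z. B1 (h ((W + z)\<^sup>2)) t) has_field_derivative B1' z0 t * e) (at 0)"
    using DERIV_chain2[OF _ de, of "\<lambda>z. B1 z t" "B1' z0 t"] B1'(1)[of t z0] h0 by simp
  \<comment> \<open>Along \<open>g\<close> the term 2 w has derivative 2 and all other terms carry a
    factor t. The smallness condition, with the same bracket as for uniqueness, bounds their
    derivative \<open>E\<close> by 1, so 2 + E cannot vanish.\<close>
  define E where "E = of_real t * (A1' z0 t * e) + of_real t * B1 z0 t + W * (of_real t * (B1' z0 t * e))"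
  have "((\<lambda>z. xi_reg t (g z)) has_field_derivative 2 + E) (at 0)"
    unfolding xi_reg_def g_def fst_conv snd_conv
    by (rule derivative_eq_intros dA dB refl)+ (simp add: E_def h0 algebra_simps)
  note der0 = this
  have ev: "eventually (\<lambda>z. xi_reg t (g z) = xi a b q p v t (g z)) (nhds 0)"
    using xi_eq[OF gS] s(1) unfolding eventually_nhds by (intro exI[of _ "ball 0 s"]) auto
  have der: "((\<lambda>z. xi a b q p v t (g z)) has_field_derivative 2 + E) (at 0)"
    using der0 DERIV_cong_ev[OF refl ev refl] by simp
  have tC: "\<bar>w\<bar> \<le> C" using w t C mult_right_mono[of t 1 C] by linarith
  have ne: "norm e \<le> 2 * C / m"
  proof -
    have "norm e = norm h' * (2 * \<bar>w\<bar>)" by (simp add: e_def W_def norm_mult)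
    also have "\<dots> \<le> 1 / m * (2 * C)" using nh tC D'(2) by (intro mult_mono) auto
    finally show ?thesis by simp
  qed
  have b1: "norm (A1' z0 t * e) \<le> C * (2 * C / m)"
    unfolding norm_mult using bnd ne C by (intro mult_mono) (auto simp: z0_def)
  have b2: "norm (B1' z0 t * e) \<le> C * (2 * C / m)"
    unfolding norm_mult using bnd ne C by (intro mult_mono) (auto simp: z0_def)
  have b3: "norm (W * (B1' z0 t * e)) \<le> C * (C * (2 * C / m))"
    unfolding norm_mult[of W] using b2 tC C by (intro mult_mono) (auto simp: W_def)
  have "E = of_real t * (A1' z0 t * e + B1 z0 t + W * (B1' z0 t * e))"
    by (simp add: E_def algebra_simps)
  hence "norm E = t * norm (A1' z0 t * e + B1 z0 t + W * (B1' z0 t * e))"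
    using t by (simp add: norm_mult)
  also have "\<dots> \<le> t * (C * (2 * C / m) + C + C * (C * (2 * C / m)))"
    using b1 b3 bnd(1) t unfolding z0_def[symmetric]
    by (intro mult_left_mono norm_triangle_le add_mono) auto
  also have "\<dots> = t * (2 * C\<^sup>2 / m + C + 2 * C ^ 3 / m)"
    by (simp add: power2_eq_square power3_eq_cube algebra_simps)
  finally have "norm E \<le> 1" using t by simp
  hence "2 + E \<noteq> 0" by (auto simp: add_eq_0_iff)
  moreover have "xi a b q p v t ?P = 0" unfolding xi_eq[OF P] xi_reg_real zero by simp
  ultimately show ?thesis unfolding simple_zero_def using lp der by blast
qed

text \<open>One constant for a whole closed gap and all t in [0, 1]. The bounds on \<open>A1\<close>
  and \<open>B1\<close> feed the edge problems, the derivatives \<open>A1'\<close> and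
  \<open>B1'\<close> the simplicity of zeros, and the Lipschitz bound on D' gives both a lower bound
  of |D'| near an edge and the Taylor remainder of D.\<close>

definition gap_bound :: "nat \<Rightarrow> real \<Rightarrow> bool" where
  "gap_bound k C \<longleftrightarrow> C > 0 \<and> (\<forall>x\<in>{lm k..lp k}. \<forall>y\<in>{lm k..lp k}. \<forall>s\<in>{0..1}. \<forall>t\<in>{0..1}.
     \<bar>\<alpha>r x t\<bar> \<le> C \<and> norm (B1 (of_real x) t) \<le> C \<and> norm (A1' (of_real x) t) \<le> C \<and> norm (B1' (of_real x) t) \<le> C \<and>
     \<bar>\<alpha>r x t - \<alpha>r y s\<bar> \<le> C * (\<bar>x - y\<bar> + \<bar>t - s\<bar>) \<and> \<bar>\<beta>r x t - \<beta>r y s\<bar> \<le> C * (\<bar>x - y\<bar> + \<bar>t - s\<bar>) \<and>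
     \<bar>poly (pderiv DP) x - poly (pderiv DP) y\<bar> \<le> C * \<bar>x - y\<bar>)"

lemma gap_bound_exists: "\<exists>C. gap_bound k C"
proof -
  define R where "R = max \<bar>lm k\<bar> \<bar>lp k\<bar>"
  define lip where "lip = (\<lambda>(F :: complex \<Rightarrow> real \<Rightarrow> complex) C. C \<ge> 0 \<and>
     (\<forall>x\<in>{lm k..lp k}. \<forall>y\<in>{lm k..lp k}. \<forall>s\<in>{0..1}. \<forall>t\<in>{0..1}.
     norm (F (of_real x) t) \<le> C \<and> norm (F (of_real x) t - F (of_real y) s) \<le> C * (\<bar>x - y\<bar> + \<bar>t - s\<bar>)))"
  have lip: "\<exists>C. lip F C"
    if F: "bipoly F" for F
  proof -
    obtain C where C: "C \<ge> 0" "\<And>z z' s t. norm z \<le> R \<Longrightarrow> norm z' \<le> R \<Longrightarrow> \<bar>s\<bar> \<le> 1 \<Longrightarrow> \<bar>t\<bar> \<le> 1 \<Longrightarrow>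
           norm (F z t) \<le> C \<and> norm (F z t - F z' s) \<le> C * (norm (z - z') + \<bar>t - s\<bar>)"
      using bipoly_Lipschitz[OF F, of R] by blast
    show ?thesis unfolding lip_def
    proof (intro exI[of _ C] conjI ballI)
      fix x y s t :: real assume *: "x \<in> {lm k..lp k}" "y \<in> {lm k..lp k}" "s \<in> {0..1}" "t \<in> {0..1}"
      have "norm (complex_of_real x) \<le> R" "norm (complex_of_real y) \<le> R" using * by (auto simp: R_def)
      from C(2)[OF this, of s t] * show "norm (F (complex_of_real x) t) \<le> C"
        "norm (F (of_real x) t - F (of_real y) s) \<le> C * (\<bar>x - y\<bar> + \<bar>t - s\<bar>)"
        by (simp_all flip: of_real_diff)
    qed (use C in auto)
  qed
  obtain C1 C2 C3 C4 C5 where "lip A1 C1" "lip B1 C2" "lip A1' C3" "lip B1' C4"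
    "lip (\<lambda>z t. cpoly (pderiv DP) z) C5"
    using lip[OF bipoly_A1] lip[OF bipoly_B1] lip[OF A1'(2)] lip[OF B1'(2)] lip[OF bipoly_cpoly[of "pderiv DP"]]
    by blast
  note C1 = this(1)[unfolded lip_def] and C2 = this(2)[unfolded lip_def] and C3 = this(3)[unfolded lip_def]
    and C4 = this(4)[unfolded lip_def] and C5 = this(5)[unfolded lip_def]
  define C where "C = C1 + C2 + C3 + C4 + C5 + 1"
  have le: "C1 \<le> C" "C2 \<le> C" "C3 \<le> C" "C4 \<le> C" "C5 \<le> C" "C > 0"
    using C1 C2 C3 C4 C5 by (auto simp: C_def)
  have "gap_bound k C" unfolding gap_bound_def
  proof (intro conjI ballI)
    fix x y s t :: real assume *: "x \<in> {lm k..lp k}" "y \<in> {lm k..lp k}" "s \<in> {0..1}" "t \<in> {0..1}"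
    define u where "u = \<bar>x - y\<bar> + \<bar>t - s\<bar>"
    have u: "u \<ge> 0" by (simp add: u_def)
    note b1 = conjunct2[OF C1, rule_format, OF *, folded u_def] and b2 = conjunct2[OF C2, rule_format, OF *, folded u_def]
    show "\<bar>\<alpha>r x t\<bar> \<le> C" "norm (B1 (of_real x) t) \<le> C" "norm (A1' (of_real x) t) \<le> C" "norm (B1' (of_real x) t) \<le> C"
      using b1 b2 conjunct2[OF C3, rule_format, OF *] conjunct2[OF C4, rule_format, OF *] le abs_Re_le_cmod[of "A1 (of_real x) t"]
      by linarith+
    have "\<bar>\<alpha>r x t - \<alpha>r y s\<bar> \<le> norm (A1 (of_real x) t - A1 (of_real y) s)"
      using abs_Re_le_cmod[of "A1 (of_real x) t - A1 (of_real y) s"] by simp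
    also have "\<dots> \<le> C1 * u" using b1 by simp
    also have "\<dots> \<le> C * u" using le u by (intro mult_right_mono) auto
    finally show "\<bar>\<alpha>r x t - \<alpha>r y s\<bar> \<le> C * (\<bar>x - y\<bar> + \<bar>t - s\<bar>)" by (simp add: u_def)
    have "\<bar>\<beta>r x t - \<beta>r y s\<bar> \<le> norm (B1 (of_real x) t - B1 (of_real y) s)"
      using abs_Re_le_cmod[of "B1 (of_real x) t - B1 (of_real y) s"] by simp
    also have "\<dots> \<le> C2 * u" using b2 by simp
    also have "\<dots> \<le> C * u" using le u by (intro mult_right_mono) auto
    finally show "\<bar>\<beta>r x t - \<beta>r y s\<bar> \<le> C * (\<bar>x - y\<bar> + \<bar>t - s\<bar>)" by (simp add: u_def)
    have "\<bar>poly (pderiv DP) x - poly (pderiv DP) y\<bar> \<le> C5 * (\<bar>x - y\<bar> + \<bar>0 - 0\<bar>)"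
      using conjunct2[OF C5, rule_format, OF *(1,2), of 0 0] by (simp flip: of_real_diff)
    also have "\<dots> \<le> C * \<bar>x - y\<bar>" using le by (auto intro: mult_right_mono)
    finally show "\<bar>poly (pderiv DP) x - poly (pderiv DP) y\<bar> \<le> C * \<bar>x - y\<bar>" .
  qed (use le in auto)
  thus ?thesis ..
qed

text \<open>Segments are used in place of intervals so that the lower edge, with \<open>f\<close> to
  its right, and the upper edge, with \<open>f\<close> to its left, are treated at once.\<close>

lemma closed_segment_gap:
  assumes k: "k \<in> {1..q - 1}" and ne: "lm k < lp k" and e: "e = lm k \<or> e = lp k"
    and f: "f \<in> open_segment e (alpha_pt a b q k)"
  shows "closed_segment e f \<subseteq> {lm k..lp k}" "lm k < f" "f < lp k"
  using alpha_pt_in_gap[OF k ne] e f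
  by (auto simp: closed_segment_eq_real_ivl open_segment_eq_real_ivl split: if_splits)

lemma edge_problem_exists:
  assumes k: "k \<in> {1..q - 1}" and ne: "lm k < lp k" and e: "e = lm k \<or> e = lp k"
    and C: "gap_bound k C"
  obtains f m where "f \<in> open_segment e (alpha_pt a b q k)"
    "edge_problem (poly DP) \<alpha>r \<beta>r e f C m (poly (pderiv DP) e)"
    "\<And>x. x \<in> closed_segment e f \<Longrightarrow> m \<le> \<bar>poly (pderiv DP) x\<bar>"
proof -
  let ?d = "poly (pderiv DP)" and ?al = "alpha_pt a b q k"
  have de: "?d e \<noteq> 0" using pderiv_DP_nz[OF k ne] e by auto
  define m where "m = \<bar>?d e\<bar> / 2"
  have m: "m > 0" using de by (simp add: m_def)
  have al: "lm k < ?al" "?al < lp k" by (rule alpha_pt_in_gap[OF k ne])+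
  have C0: "C > 0" using C by (simp add: gap_bound_def)
  \<comment> \<open>The fraction \<open>u\<close> of the way from \<open>e\<close> to
    \<open>alpha_pt\<close> is so small that, by the Lipschitz bound, D' changes by at most m =
    |D'(e)| / 2 on the segment; hence |D'| >= m there. The bound 1/2 keeps \<open>f\<close> short of
    \<open>alpha_pt\<close>.\<close>
  define u where "u = min (1 / 2) (m / (C * \<bar>?al - e\<bar>))"
  have ae: "\<bar>?al - e\<bar> > 0" using al e by auto
  have u: "0 < u" "u < 1" using m C0 ae by (auto simp: u_def)
  have uC: "C * (u * \<bar>?al - e\<bar>) \<le> m"
  proof -
    have "u \<le> m / (C * \<bar>?al - e\<bar>)" by (simp add: u_def)
    thus ?thesis using C0 ae by (simp add: field_simps)
  qed
  define f where "f = (1 - u) * e + u * ?al"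
  have f: "f \<in> open_segment e ?al"
    using u ae unfolding in_segment f_def by auto
  note seg = closed_segment_gap[OF k ne e f]
  have dist: "\<bar>x - e\<bar> \<le> u * \<bar>?al - e\<bar>" if "x \<in> closed_segment e f" for x
  proof -
    have "\<bar>x - e\<bar> \<le> \<bar>f - e\<bar>" using that by (auto simp: closed_segment_eq_real_ivl split: if_splits)
    also have "f - e = u * (?al - e)" by (simp add: f_def algebra_simps)
    finally show ?thesis using u by (simp add: abs_mult)
  qed
  have eI: "e \<in> {lm k..lp k}" using e ne by auto
  have lip: "\<bar>?d x - ?d y\<bar> \<le> C * \<bar>x - y\<bar>" if "x \<in> {lm k..lp k}" "y \<in> {lm k..lp k}" for x y
    using C that unfolding gap_bound_def by (meson atLeastAtMost_iff order_refl zero_le_one)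
  have md: "m \<le> \<bar>?d x\<bar>" if x: "x \<in> closed_segment e f" for x
  proof -
    have "\<bar>?d x - ?d e\<bar> \<le> C * \<bar>x - e\<bar>" using lip[of x e] seg(1) x eI by auto
    also have "\<dots> \<le> C * (u * \<bar>?al - e\<bar>)" using dist[OF x] C0 by (intro mult_left_mono) auto
    finally have "\<bar>?d x - ?d e\<bar> \<le> m" using uC by linarith
    thus ?thesis unfolding m_def by linarith
  qed
  have MVT: "\<exists>z\<in>closed_segment x y. poly DP x - poly DP y = (x - y) * ?d z" for x y
  proof (cases x y rule: linorder_cases)
    case less
    then obtain z where "x < z" "z < y" "poly DP y - poly DP x = (y - x) * ?d z"
      using poly_MVT[of x y DP] by auto
    thus ?thesis by (intro bexI[of _ z]) (auto simp: closed_segment_eq_real_ivl algebra_simps)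
  next
    case greater
    then obtain z where "y < z" "z < x" "poly DP x - poly DP y = (x - y) * ?d z"
      using poly_MVT[of y x DP] by auto
    thus ?thesis by (intro bexI[of _ z]) (auto simp: closed_segment_eq_real_ivl algebra_simps)
  qed auto
  have De: "poly DP e = 0" using e DP_edge(1)[of k] DP_edge(2)[of k] gap_index[OF k] by auto
  have ab: "\<bar>\<alpha>r x t\<bar> \<le> C" "\<bar>\<beta>r x t\<bar> \<le> C" "\<bar>\<alpha>r x t - \<alpha>r y s\<bar> \<le> C * (\<bar>x - y\<bar> + \<bar>t - s\<bar>)"
       "\<bar>\<beta>r x t - \<beta>r y s\<bar> \<le> C * (\<bar>x - y\<bar> + \<bar>t - s\<bar>)"
    if "x \<in> closed_segment e f" "y \<in> closed_segment e f" "0 \<le> s" "s \<le> 1" "0 \<le> t" "t \<le> 1" for x y s t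
  proof -
    have xy: "x \<in> {lm k..lp k}" "y \<in> {lm k..lp k}" "s \<in> {0..1}" "t \<in> {0..1}" using that seg(1) by auto
    from C xy show "\<bar>\<alpha>r x t\<bar> \<le> C" "\<bar>\<alpha>r x t - \<alpha>r y s\<bar> \<le> C * (\<bar>x - y\<bar> + \<bar>t - s\<bar>)"
       "\<bar>\<beta>r x t - \<beta>r y s\<bar> \<le> C * (\<bar>x - y\<bar> + \<bar>t - s\<bar>)" unfolding gap_bound_def by blast+
    have "norm (B1 (of_real x) t) \<le> C" using C xy unfolding gap_bound_def by blast
    thus "\<bar>\<beta>r x t\<bar> \<le> C" using abs_Re_le_cmod[of "B1 (of_real x) t"] by linarith
  qed
  have "edge_problem (poly DP) \<alpha>r \<beta>r e f C m (?d e)"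
  proof
    show "poly DP f > 0" using seg gap_index[OF k] by (intro DP_pos[of k]) auto
    show "poly DP x \<ge> 0" if "x \<in> closed_segment e f" for x
      using seg(1) that gap_index[OF k] by (intro DP_nonneg[of k]) auto
    show "m * \<bar>x - y\<bar> \<le> \<bar>poly DP x - poly DP y\<bar>" if xy: "x \<in> closed_segment e f" "y \<in> closed_segment e f" for x y
    proof -
      obtain z where z: "z \<in> closed_segment x y" "poly DP x - poly DP y = (x - y) * ?d z" using MVT by blast
      have "z \<in> closed_segment e f"
        using z(1) xy by (meson closed_segment_subset convex_closed_segment subsetD)
      hence "\<bar>x - y\<bar> * m \<le> \<bar>x - y\<bar> * \<bar>?d z\<bar>" using md by (intro mult_left_mono) auto
      thus ?thesis by (simp add: z(2) abs_mult mult.commute)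
    qed
    show "\<bar>poly DP x - ?d e * (x - e)\<bar> \<le> C * (x - e)\<^sup>2" if x: "x \<in> closed_segment e f" for x
    proof -
      obtain z where z: "z \<in> closed_segment x e" "poly DP x - poly DP e = (x - e) * ?d z" using MVT by blast
      have "z \<in> closed_segment e f"
        using z(1) x by (meson closed_segment_subset convex_closed_segment subsetD ends_in_segment(1))
      hence "\<bar>?d z - ?d e\<bar> \<le> C * \<bar>z - e\<bar>" using lip[of z e] seg(1) eI by auto
      also have "\<dots> \<le> C * \<bar>x - e\<bar>"
        using z(1) C0 by (intro mult_left_mono) (auto simp: closed_segment_eq_real_ivl split: if_splits)
      finally have "\<bar>x - e\<bar> * \<bar>?d z - ?d e\<bar> \<le> \<bar>x - e\<bar> * (C * \<bar>x - e\<bar>)" by (intro mult_left_mono) auto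
      moreover have "poly DP x - ?d e * (x - e) = (x - e) * (?d z - ?d e)" using z(2) De by (simp add: algebra_simps)
      ultimately show ?thesis by (simp add: abs_mult power2_eq_square mult_ac)
    qed
    show "continuous_on (closed_segment e f) (poly DP)" by (intro continuous_intros)
  qed (use De m C0 de ab ends_in_segment in auto)
  thus ?thesis using that f md by blast
qed

text \<open>Distinct gaps are separated by bands, so no point of \<open>Surf0\<close> lies over a
  nonempty gap. What remains of being a state is \<xi> = 0, an equation with real data.\<close>

lemma is_state_gap_arc:
  assumes k: "k \<in> {1..q - 1}" and ne: "lm k < lp k" and arc: "gap_arc k x w"
  shows "is_state a b q p v t (of_real x, of_real w) \<longleftrightarrow> t * \<alpha>r x t + w * (2 + t * \<beta>r x t) = 0"
proof -
  have S: "(of_real x, of_real w) \<in> Surf a b q" using arc by (simp add: Surf_real_iff gap_arc_def)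
  have "(of_real x, of_real w) \<notin> Surf0 a b q"
  proof
    assume "(of_real x, of_real w) \<in> Surf0 a b q"
    then obtain j where j: "j \<in> {1..q - 1}" "gap a b q j = {}" "x = lp j" by (auto simp: Surf0_def)
    have "lm j = lp j" using j(2) gap_eq[OF j(1)] lm_le_lp[of j] gap_index[OF j(1)] by (simp add: not_less)
    moreover from this have "j \<noteq> k" using ne by auto
    ultimately show False
      using arc j(3) lp_less_lm[of j k] lp_less_lm[of k j] gap_index[OF k] gap_index[OF j(1)]
      by (auto simp: gap_arc_def neq_iff)
  qed
  thus ?thesis using S unfolding is_state_def xi_eq[OF S] xi_reg_real of_real_eq_0_iff by blast
qed

text \<open>At a state J = - t \<alpha> = w (2 + t \<beta>), so J has the sign of w, and (-1)^(q - k
  + 1) is the sign of w on the physical sheet over the k-th gap.\<close>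

lemma state_classification:
  assumes k: "k \<in> {1..q - 1}" and ne: "lm k < lp k" and arc: "gap_arc k x w"
    and zero: "t * \<alpha>r x t + w * (2 + t * \<beta>r x t) = 0" and ge: "2 + t * \<beta>r x t \<ge> 1"
  defines "s \<equiv> (-1) ^ (q - k + 1) * poly (J_poly a b q p v t) x"
  shows "s > 0 \<Longrightarrow> bound_state a b q p v t (of_real x, of_real w)"
    "s < 0 \<Longrightarrow> antibound_state a b q p v t (of_real x, of_real w)"
    "s = 0 \<Longrightarrow> virtual_state a b q p v t (of_real x, of_real w)"
proof -
  have st: "is_state a b q p v t (of_real x, of_real w)" using is_state_gap_arc[OF k ne arc] zero by simp
  have "poly (J_poly a b q p v t) x = w * (2 + t * \<beta>r x t)" using zero by (simp add: J_poly_eq)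
  hence s: "s = ((-1) ^ (q - k + 1) * w) * (2 + t * \<beta>r x t)" by (simp add: s_def)
  have w2: "w\<^sup>2 = poly DP x" and x: "lm k \<le> x" "x \<le> lp k" using arc by (auto simp: gap_arc_def)
  hence sq: "\<bar>w\<bar> = sqrt (poly DP x)" by (metis real_sqrt_abs)
  have inner: "lm k < x \<and> x < lp k" if "w \<noteq> 0"
    using that w2 x DP_edge(1)[of k] DP_edge(2)[of k] gap_index[OF k] by (auto simp: less_le)
  show "bound_state a b q p v t (of_real x, of_real w)" if "s > 0"
  proof -
    have pos: "(-1) ^ (q - k + 1) * w > 0"
    proof (rule ccontr)
      assume "\<not> (-1) ^ (q - k + 1) * w > 0"
      hence "s \<le> 0" using ge unfolding s by (intro mult_nonpos_nonneg[of "(-1) ^ (q - k + 1) * w"]) auto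
      thus False using that by simp
    qed
    hence "w = (-1) ^ (q - k + 1) * sqrt (poly DP x)"
      unfolding sq[symmetric] by (cases "even (q - k)") auto
    moreover have "w \<noteq> 0" using pos by auto
    ultimately have "(of_real x, of_real w) \<in> gap_plus a b q k"
      using inner mem_gap_plus[OF k] by blast
    thus ?thesis using st by (simp add: bound_state_def gap_plus_def)
  qed
  show "antibound_state a b q p v t (of_real x, of_real w)" if "s < 0"
  proof -
    have neg: "(-1) ^ (q - k + 1) * w < 0"
    proof (rule ccontr)
      assume "\<not> (-1) ^ (q - k + 1) * w < 0"
      hence "s \<ge> 0" using ge unfolding s by (intro mult_nonneg_nonneg[of "(-1) ^ (q - k + 1) * w"]) auto
      thus False using that by simp
    qed
    hence "w = (-1) ^ (q - k) * sqrt (poly DP x)"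
      unfolding sq[symmetric] by (cases "even (q - k)") auto
    moreover have "w \<noteq> 0" using neg by auto
    ultimately have "(of_real x, of_real w) \<in> gap_minus a b q k"
      using inner mem_gap_minus[OF k] by blast
    thus ?thesis using st gap_index[OF k]
      by (auto simp: antibound_state_def resonance_def gap_minus_def)
  qed
  show "virtual_state a b q p v t (of_real x, of_real w)" if "s = 0"
  proof -
    have "w = 0" using that ge unfolding s by auto
    hence "poly DP x = 0" using w2 by simp
    hence "x = lm k \<or> x = lp k" using DP_pos[of k x] x gap_index[OF k] by force
    thus ?thesis using st gap_index[OF k] by (auto simp: virtual_state_def intro!: bexI[of _ k])
  qed
qed

text \<open>At an edge D = 0 means F^2 = - T Q, so the quadratic form in \<open>A1\<close> at t = 0
  is Q times a perfect square, that of \<psi>^+ with m_+ = F / Q. If Q = 0 then also F = 0, and only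
  the term with T survives.\<close>

lemma edge_formula:
  assumes k: "k \<in> {1..q - 1}" and ne: "lm k < lp k" and e: "e = lm k \<or> e = lp k"
  defines "J1 \<equiv> - \<alpha>r e 0"
  shows "e \<noteq> mu a b q k \<Longrightarrow> complex_of_real J1 =
      - (varphi a b (int q) (of_real e) / of_real (a 0)) *
        (\<Sum>j\<in>{0..int p}. of_real (v j * (cmod (psi_plus a b q j (of_real e, 0)))\<^sup>2))"
    "e = mu a b q k \<Longrightarrow> complex_of_real J1 =
      vartheta a b (int q + 1) (of_real e) / of_real (a 0) *
        (\<Sum>j\<in>{1..int p}. of_real (v j) * (varphi a b j (of_real e))\<^sup>2)"
proof -
  define Q F T where "Q = poly (vphi q) e" and "F = poly PhiP e" and "T = poly (vth (Suc q)) e"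
  define \<theta> \<phi> where "\<theta> = (\<lambda>n. poly (vth n) e)" and "\<phi> = (\<lambda>n. poly (vphi n) e)"
  have "poly DP e = 0" using e DP_edge(1)[of k] DP_edge(2)[of k] gap_index[OF k] by auto
  hence FT: "F\<^sup>2 = - (T * Q)" using DP_factor_real[of e] by (simp add: F_def T_def Q_def)
  have "A1 (of_real e) 0 = of_real (1 / a 0 * (\<Sum>n\<le>p. v (int n) * (Q * \<theta> n * \<theta> n + F * (\<theta> n * \<phi> n + \<phi> n * \<theta> n) - T * \<phi> n * \<phi> n)))"
    unfolding A1_def of_real_mult of_real_sum
    by (intro arg_cong2[of _ _ _ _ "(*)"] sum.cong refl)
       (auto simp: Theta_0 Phi_0 Q_def F_def T_def \<theta>_def \<phi>_def)
  hence J1: "J1 = - (1 / a 0 * (\<Sum>n\<le>p. v (int n) * (Q * (\<theta> n)\<^sup>2 + 2 * F * \<theta> n * \<phi> n - T * (\<phi> n)\<^sup>2)))"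
    by (simp add: J1_def power2_eq_square algebra_simps)
  have img: "{0..int p} = int ` {..p}" "{1..int p} = int ` {1..p}"
    using image_int_atLeastAtMost[of 0 p] image_int_atLeastAtMost[of 1 p] by (simp_all add: atMost_atLeast0)
  show "complex_of_real J1 = - (varphi a b (int q) (of_real e) / of_real (a 0)) *
        (\<Sum>j\<in>{0..int p}. of_real (v j * (cmod (psi_plus a b q j (of_real e, 0)))\<^sup>2))" if "e \<noteq> mu a b q k"
  proof -
    have Q: "Q \<noteq> 0" using mu(2)[OF k, of e] that e ne by (auto simp: Q_def)
    have psi: "(cmod (psi_plus a b q (int n) (of_real e, 0)))\<^sup>2 = (\<theta> n + F / Q * \<phi> n)\<^sup>2" for n
    proof -
      have "psi_plus a b q (int n) (of_real e, 0) = of_real (\<theta> n + F / Q * \<phi> n)"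
        by (simp add: psi_plus_def m_plus_def phi_eq varphi_eq vartheta_eq Q_def F_def \<theta>_def \<phi>_def)
      thus ?thesis by (simp only: norm_of_real power2_abs)
    qed
    have QQ: "Q * (\<theta> n + F / Q * \<phi> n)\<^sup>2 = Q * (\<theta> n)\<^sup>2 + 2 * F * \<theta> n * \<phi> n - T * (\<phi> n)\<^sup>2" for n
    proof -
      have "Q * (\<theta> n + F / Q * \<phi> n)\<^sup>2 = Q * (\<theta> n)\<^sup>2 + 2 * F * \<theta> n * \<phi> n + F\<^sup>2 / Q * (\<phi> n)\<^sup>2"
        using Q by (simp add: power2_eq_square field_simps)
      also have "F\<^sup>2 / Q = - T" unfolding FT using Q by simp
      finally show ?thesis by simp
    qed
    have "J1 = - (Q / a 0 * (\<Sum>n\<le>p. v (int n) * (\<theta> n + F / Q * \<phi> n)\<^sup>2))"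
      unfolding J1 QQ[symmetric] by (simp add: sum_distrib_left mult_ac)
    hence "complex_of_real J1 = - (of_real Q / of_real (a 0) * (\<Sum>n\<le>p. of_real (v (int n) * (\<theta> n + F / Q * \<phi> n)\<^sup>2)))"
      by simp
    also have "(\<Sum>n\<le>p. complex_of_real (v (int n) * (\<theta> n + F / Q * \<phi> n)\<^sup>2)) =
      (\<Sum>j\<in>{0..int p}. of_real (v j * (cmod (psi_plus a b q j (of_real e, 0)))\<^sup>2))"
      unfolding img by (subst sum.reindex) (simp_all add: psi del: of_real_mult of_real_power)
    finally show ?thesis by (simp add: varphi_eq Q_def)
  qed
  show "complex_of_real J1 = vartheta a b (int q + 1) (of_real e) / of_real (a 0) *
        (\<Sum>j\<in>{1..int p}. of_real (v j) * (varphi a b j (of_real e))\<^sup>2)" if "e = mu a b q k"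
  proof -
    have Q: "Q = 0" using mu(1)[OF k] that by (simp add: Q_def)
    hence F: "F = 0" using FT by simp
    have "J1 = T / a 0 * (\<Sum>n\<le>p. v (int n) * (\<phi> n)\<^sup>2)"
      unfolding J1 Q F by (simp add: sum_negf sum_distrib_left mult_ac)
    \<comment> \<open>The term n = 0 drops out because \<open>varphi\<close> vanishes at site
      0.\<close>
    also have "(\<Sum>n\<le>p. v (int n) * (\<phi> n)\<^sup>2) = (\<Sum>n\<in>{1..p}. v (int n) * (\<phi> n)\<^sup>2)"
      by (rule sum.mono_neutral_right) (auto simp: \<phi>_def vphi_def not_le)
    finally have "complex_of_real J1 = of_real T / of_real (a 0) * (\<Sum>n\<in>{1..p}. of_real (v (int n)) * (of_real (\<phi> n))\<^sup>2)"
      by simp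
    also have "(\<Sum>n\<in>{1..p}. of_real (v (int n)) * (complex_of_real (\<phi> n))\<^sup>2)
        = (\<Sum>j\<in>{1..int p}. of_real (v j) * (varphi a b j (of_real e))\<^sup>2)"
      unfolding img by (subst sum.reindex) (simp_all add: varphi_eq \<phi>_def)
    moreover have "complex_of_real T = vartheta a b (int q + 1) (of_real e)"
      using vartheta_eq[of "Suc q" "of_real e"] by (simp add: T_def add.commute)
    ultimately show ?thesis by simp
  qed
qed

section \<open>Both edges of a gap together\<close>

lemma deriv_Delta_square: "deriv (\<lambda>z. (Delta a b q z)\<^sup>2) (of_real e) = of_real (poly (pderiv DP) e)"
proof -
  have "(\<lambda>z. (Delta a b q z)\<^sup>2) = (\<lambda>z. cpoly DP z + 1)" by (simp add: cpoly_DP)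
  moreover have "((\<lambda>z. cpoly DP z + 1) has_field_derivative cpoly (pderiv DP) (of_real e) + 0) (at (of_real e))"
    by (intro derivative_intros has_field_derivative_cpoly)
  ultimately show ?thesis using DERIV_imp_deriv by fastforce
qed

text \<open>The share of a single gap in the first half of the theorem, as
  \<open>edge_expansion\<close> is that of a single edge in the second. The gaps can then be treated
  separately, and only the range of t has to be made common.\<close>

definition gap_state_pair :: "nat \<Rightarrow> real \<Rightarrow> complex \<times> complex \<Rightarrow> complex \<times> complex \<Rightarrow> bool" where
  "gap_state_pair k t Pm Pp \<longleftrightarrow>
     {P \<in> gap_circle a b q k. is_state a b q p v t P} = {Pm, Pp} \<and>
     simple_state a b q p v t Pm \<and> simple_state a b q p v t Pp \<and>
     lm k \<le> Re (fst Pm) \<and> Re (fst Pm) < alpha_pt a b q k \<and>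
     alpha_pt a b q k < Re (fst Pp) \<and> Re (fst Pp) \<le> lp k \<and>
     (\<forall>P\<in>{Pm, Pp}.
        let s = (-1) ^ (q - k + 1) * poly (J_poly a b q p v t) (Re (fst P)) in
          (s > 0 \<longrightarrow> bound_state a b q p v t P) \<and>
          (s < 0 \<longrightarrow> antibound_state a b q p v t P) \<and>
          (s = 0 \<longrightarrow> virtual_state a b q p v t P))"

definition edge_expansion :: "nat \<Rightarrow> real \<Rightarrow> (real \<Rightarrow> complex \<times> complex) \<Rightarrow> bool" where
  "edge_expansion k e S \<longleftrightarrow>
     (\<exists>J1 :: real.
       (\<lambda>t. fst (S t) - (complex_of_real e + complex_of_real (t\<^sup>2 * J1\<^sup>2) /
              (4 * deriv (\<lambda>z. (Delta a b q z)\<^sup>2) (complex_of_real e))))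
         \<in> O[at_right 0](\<lambda>t. complex_of_real (t ^ 3)) \<and>
       (\<lambda>t. poly (J_poly a b q p v t) e - t * J1) \<in> O[at_right 0](\<lambda>t. t\<^sup>2) \<and>
       (e \<noteq> mu a b q k \<longrightarrow>
          complex_of_real J1 = - (varphi a b (int q) (complex_of_real e) / complex_of_real (a 0)) *
            (\<Sum>j\<in>{0..int p}. complex_of_real (v j * (cmod (psi_plus a b q j (complex_of_real e, 0)))\<^sup>2))) \<and>
       (e = mu a b q k \<longrightarrow>
          complex_of_real J1 = vartheta a b (int q + 1) (complex_of_real e) / complex_of_real (a 0) *
            (\<Sum>j\<in>{1..int p}. complex_of_real (v j) * (varphi a b j (complex_of_real e))\<^sup>2)))"

text \<open>The two edge problems cover the ends of the gap. Between \<open>f1\<close> and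
  \<open>f2\<close> there is no state, since D >= \<delta> there, while a state has D = w^2 <= (t
  C)^2 < \<delta>.\<close>

lemma gap_states:
  assumes k: "k \<in> {1..q - 1}" and ne: "lm k < lp k"
  shows "\<exists>t0 Sm Sp. t0 > 0 \<and> (\<forall>t\<in>{0<..<t0}. gap_state_pair k t (Sm t) (Sp t)) \<and>
    edge_expansion k (lm k) Sm \<and> edge_expansion k (lp k) Sp"
proof -
  obtain C where gb: "gap_bound k C" using gap_bound_exists by blast
  hence C: "C > 0" by (simp add: gap_bound_def)
  note al = alpha_pt_in_gap[OF k ne]
  obtain f1 m1 where f1: "f1 \<in> open_segment (lm k) (alpha_pt a b q k)"
    and L: "edge_problem (poly DP) \<alpha>r \<beta>r (lm k) f1 C m1 (poly (pderiv DP) (lm k))"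
    and D1: "\<And>x. x \<in> closed_segment (lm k) f1 \<Longrightarrow> m1 \<le> \<bar>poly (pderiv DP) x\<bar>"
    using edge_problem_exists[OF k ne _ gb, of "lm k"] by blast
  obtain f2 m2 where f2: "f2 \<in> open_segment (lp k) (alpha_pt a b q k)"
    and R: "edge_problem (poly DP) \<alpha>r \<beta>r (lp k) f2 C m2 (poly (pderiv DP) (lp k))"
    and D2: "\<And>x. x \<in> closed_segment (lp k) f2 \<Longrightarrow> m2 \<le> \<bar>poly (pderiv DP) x\<bar>"
    using edge_problem_exists[OF k ne _ gb, of "lp k"] by blast
  interpret L: edge_problem "poly DP" \<alpha>r \<beta>r "lm k" f1 C m1 "poly (pderiv DP) (lm k)" by (rule L)
  interpret R: edge_problem "poly DP" \<alpha>r \<beta>r "lp k" f2 C m2 "poly (pderiv DP) (lp k)" by (rule R)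
  have f1': "lm k < f1" "f1 < alpha_pt a b q k" and f2': "alpha_pt a b q k < f2" "f2 < lp k"
    using f1 f2 al by (auto simp: open_segment_eq_real_ivl)
  have seg1: "closed_segment (lm k) f1 = {lm k..f1}" and seg2: "closed_segment (lp k) f2 = {f2..lp k}"
    using f1' f2' by (auto simp: closed_segment_eq_real_ivl)
  obtain x0 where x0: "x0 \<in> {f1..f2}" "\<And>x. x \<in> {f1..f2} \<Longrightarrow> poly DP x0 \<le> poly DP x"
    using continuous_attains_inf[of "{f1..f2}" "poly DP"] f1' f2' by (force intro: continuous_intros)
  define \<delta> where "\<delta> = poly DP x0"
  have \<delta>: "\<delta> > 0" unfolding \<delta>_def using x0(1) f1' f2' gap_index[OF k] by (intro DP_pos[of k]) auto
  define M where "M = (\<lambda>m. 2 * C\<^sup>2 / m + C + 2 * C ^ 3 / m)"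
  have M: "M m1 > 0" "M m2 > 0" using C L.m R.m by (auto simp: M_def intro!: add_pos_pos)
  \<comment> \<open>The entry 1 keeps t in the range of the bounds, 1 / C gives 2 + t \<beta> >= 1,
    the two entries with \<open>M\<close> give uniqueness and simplicity at the two edges, and the
    last one gives (t C)^2 <= t C^2 < \<delta>.\<close>
  define t0 where "t0 = Min {1, 1 / C, 1 / M m1, 1 / M m2, \<delta> / C\<^sup>2}"
  have t0: "t0 > 0" using C M \<delta> by (simp add: t0_def)
  have small: "t \<le> 1" "t * C \<le> 1" "t * M m1 \<le> 1" "t * M m2 \<le> 1" "(t * C)\<^sup>2 < \<delta>"
    if t: "0 < t" "t < t0" for t
  proof -
    have *: "t < 1" "t < 1 / C" "t < 1 / M m1" "t < 1 / M m2" "t < \<delta> / C\<^sup>2"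
      using t(2) by (simp_all add: t0_def)
    thus "t \<le> 1" "t * C \<le> 1" "t * M m1 \<le> 1" "t * M m2 \<le> 1" using C M by (simp_all add: field_simps)
    have "(t * C)\<^sup>2 = t * t * C\<^sup>2" by (simp add: power2_eq_square)
    also have "\<dots> \<le> 1 * t * C\<^sup>2" using * t by (intro mult_right_mono) auto
    also have "\<dots> < \<delta>" using *(5) C by (simp add: field_simps)
    finally show "(t * C)\<^sup>2 < \<delta>" .
  qed
  have "\<exists>x w. L.state_at t x w" if t: "0 < t" "t < t0" for t
    using small[OF t] t x0(2)[of f1] f1' f2' by (intro L.state_at_exists) (auto simp: \<delta>_def)
  then obtain xm wm where Lst: "\<And>t. 0 < t \<Longrightarrow> t < t0 \<Longrightarrow> L.state_at t (xm t) (wm t)" by metis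
  have "\<exists>x w. R.state_at t x w" if t: "0 < t" "t < t0" for t
    using small[OF t] t x0(2)[of f2] f1' f2' by (intro R.state_at_exists) (auto simp: \<delta>_def)
  then obtain xp wp where Rst: "\<And>t. 0 < t \<Longrightarrow> t < t0 \<Longrightarrow> R.state_at t (xp t) (wp t)" by metis
  define Sm Sp where "Sm = (\<lambda>t. (complex_of_real (xm t), complex_of_real (wm t)))"
    and "Sp = (\<lambda>t. (complex_of_real (xp t), complex_of_real (wp t)))"
  have gbx: "\<bar>\<alpha>r x t\<bar> \<le> C" "norm (B1 (of_real x) t) \<le> C" "norm (A1' (of_real x) t) \<le> C" "norm (B1' (of_real x) t) \<le> C"
    if "lm k \<le> x" "x \<le> lp k" "0 \<le> t" "t \<le> 1" for x t
    using gb that unfolding gap_bound_def by (meson atLeastAtMost_iff)+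
  have den: "2 + t * \<beta>r x t \<ge> 1" if "lm k \<le> x" "x \<le> lp k" "0 < t" "t < t0" for x t
  proof -
    have "\<bar>\<beta>r x t\<bar> \<le> C" using gbx(2)[of x t] small[OF that(3,4)] that abs_Re_le_cmod[of "B1 (of_real x) t"] by linarith
    hence "\<bar>t * \<beta>r x t\<bar> \<le> t * C" using that by (simp add: abs_mult mult_left_mono)
    thus ?thesis using small[OF that(3,4)] by linarith
  qed
  have Larc: "gap_arc k x w \<and> t * \<alpha>r x t + w * (2 + t * \<beta>r x t) = 0 \<and> lm k \<le> x \<and> x \<le> lp k \<and> x \<le> f1" if "L.state_at t x w" for t x w
    using that f1' f2' unfolding L.state_at_def seg1 gap_arc_def by auto
  have Rarc: "gap_arc k x w \<and> t * \<alpha>r x t + w * (2 + t * \<beta>r x t) = 0 \<and> lm k \<le> x \<and> x \<le> lp k \<and> f2 \<le> x" if "R.state_at t x w" for t x w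
    using that f1' f2' unfolding R.state_at_def seg2 gap_arc_def by auto
  have states: "{P \<in> gap_circle a b q k. is_state a b q p v t P} = {Sm t, Sp t}" if t: "0 < t" "t < t0" for t
  proof (intro equalityI subsetI)
    fix P assume "P \<in> {P \<in> gap_circle a b q k. is_state a b q p v t P}"
    then obtain x w where P: "P = (of_real x, of_real w)" "gap_arc k x w" "is_state a b q p v t P"
      using mem_gap_circle[OF k ne] by auto
    have zero: "t * \<alpha>r x t + w * (2 + t * \<beta>r x t) = 0"
      using P is_state_gap_arc[OF k ne P(2)] by simp
    have x: "lm k \<le> x" "x \<le> lp k" "w\<^sup>2 = poly DP x" using P(2) by (auto simp: gap_arc_def)
    have "\<bar>w\<bar> * 1 \<le> \<bar>w\<bar> * \<bar>2 + t * \<beta>r x t\<bar>" using den[OF x(1,2) t] by (intro mult_left_mono) auto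
    also have "\<dots> = \<bar>w * (2 + t * \<beta>r x t)\<bar>" by (simp add: abs_mult)
    also have "w * (2 + t * \<beta>r x t) = - (t * \<alpha>r x t)" using zero by linarith
    also have "\<bar>- (t * \<alpha>r x t)\<bar> \<le> t * C"
      using gbx(1)[OF x(1,2), of t] t small[OF t] by (simp add: abs_mult mult_left_mono)
    finally have "w\<^sup>2 \<le> (t * C)\<^sup>2" by (metis abs_ge_zero mult.right_neutral power2_abs power_mono)
    hence "poly DP x < \<delta>" using small(5)[OF t] x(3) by simp
    hence "x \<notin> {f1..f2}" using x0(2)[of x] by (auto simp: \<delta>_def)
    then consider "x < f1" | "f2 < x" by force
    thus "P \<in> {Sm t, Sp t}"
    proof cases
      case 1
      hence "L.state_at t x w" using x zero by (auto simp: L.state_at_def seg1)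
      from L.state_at_unique[OF _ _ _ _ this Lst[OF t]] small[OF t] t show ?thesis
        by (simp add: P Sm_def M_def)
    next
      case 2
      hence "R.state_at t x w" using x zero by (auto simp: R.state_at_def seg2)
      from R.state_at_unique[OF _ _ _ _ this Rst[OF t]] small[OF t] t show ?thesis
        by (simp add: P Sp_def M_def)
    qed
  next
    fix P assume "P \<in> {Sm t, Sp t}"
    thus "P \<in> {P \<in> gap_circle a b q k. is_state a b q p v t P}"
      using Larc[OF Lst[OF t]] Rarc[OF Rst[OF t]] is_state_gap_arc[OF k ne] mem_gap_circle[OF k ne]
      unfolding Sm_def Sp_def by blast
  qed
  have wL: "\<bar>wm t\<bar> \<le> t * C" and wR: "\<bar>wp t\<bar> \<le> t * C" if t: "0 < t" "t < t0" for t
    using L.state_at_bound[OF _ _ _ Lst[OF t]] R.state_at_bound[OF _ _ _ Rst[OF t]] small[OF t] t by auto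
  have simpleL: "simple_zero a b q (xi a b q p v t) (Sm t)" if t: "0 < t" "t < t0" for t
    unfolding Sm_def
  proof (rule simple_zero_xi[where m = m1 and C = C])
    show "m1 \<le> \<bar>poly (pderiv DP) (xm t)\<bar>" using Lst[OF t] by (intro D1) (simp add: L.state_at_def)
    show "t * (2 * C\<^sup>2 / m1 + C + 2 * C ^ 3 / m1) \<le> 1" using small[OF t] by (simp add: M_def)
  qed (use L.m C t small(1)[OF t] wL[OF t] Larc[OF Lst[OF t]] gbx[of "xm t" t] in \<open>auto simp: gap_arc_def\<close>)
  have simpleR: "simple_zero a b q (xi a b q p v t) (Sp t)" if t: "0 < t" "t < t0" for t
    unfolding Sp_def
  proof (rule simple_zero_xi[where m = m2 and C = C])
    show "m2 \<le> \<bar>poly (pderiv DP) (xp t)\<bar>" using Rst[OF t] by (intro D2) (simp add: R.state_at_def)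
    show "t * (2 * C\<^sup>2 / m2 + C + 2 * C ^ 3 / m2) \<le> 1" using small[OF t] by (simp add: M_def)
  qed (use R.m C t small(1)[OF t] wR[OF t] Rarc[OF Rst[OF t]] gbx[of "xp t" t] in \<open>auto simp: gap_arc_def\<close>)
  have kind: "let s = (-1) ^ (q - k + 1) * poly (J_poly a b q p v t) (Re (fst P)) in
             (s > 0 \<longrightarrow> bound_state a b q p v t P) \<and>
             (s < 0 \<longrightarrow> antibound_state a b q p v t P) \<and>
             (s = 0 \<longrightarrow> virtual_state a b q p v t P)" if t: "0 < t" "t < t0" and P: "P \<in> {Sm t, Sp t}" for t P
  proof -
    obtain x w where xw: "P = (of_real x, of_real w)" "gap_arc k x w" "t * \<alpha>r x t + w * (2 + t * \<beta>r x t) = 0"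
      using P Larc[OF Lst[OF t]] Rarc[OF Rst[OF t]] unfolding Sm_def Sp_def by blast
    have "2 + t * \<beta>r x t \<ge> 1" using den t xw(2) by (simp add: gap_arc_def)
    from state_classification[OF k ne xw(2,3) this] show ?thesis by (simp add: xw(1) Let_def)
  qed
  have part1: "\<forall>t\<in>{0<..<t0}. gap_state_pair k t (Sm t) (Sp t)"
    unfolding gap_state_pair_def
  proof (intro ballI conjI)
    fix t assume "t \<in> {0<..<t0}"
    hence t: "0 < t" "t < t0" by auto
    show st: "{P \<in> gap_circle a b q k. is_state a b q p v t P} = {Sm t, Sp t}" by (rule states[OF t])
    show "simple_state a b q p v t (Sm t)" "simple_state a b q p v t (Sp t)"
      using st simpleL[OF t] simpleR[OF t] unfolding simple_state_def by blast+
    show "lm k \<le> Re (fst (Sm t))" "Re (fst (Sm t)) < alpha_pt a b q k"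
      "alpha_pt a b q k < Re (fst (Sp t))" "Re (fst (Sp t)) \<le> lp k"
      using Larc[OF Lst[OF t]] Rarc[OF Rst[OF t]] f1' f2' by (auto simp: Sm_def Sp_def)
  qed (use kind in auto)
  have ev: "\<forall>\<^sub>F t in at_right 0. 0 < t \<and> t < t0"
    unfolding eventually_at_right_field using t0 by auto
  have asym: "edge_expansion k e (\<lambda>t. (of_real (x t), w t))"
    if e: "e = lm k \<or> e = lp k" and K: "\<And>t. 0 < t \<Longrightarrow> t < t0 \<Longrightarrow>
      \<bar>x t - (e + t\<^sup>2 * (\<alpha>r e 0)\<^sup>2 / (4 * poly (pderiv DP) e))\<bar> \<le> K * t ^ 3" for e x w K
    unfolding edge_expansion_def fst_conv
  \<comment> \<open>Since J(x) = - t \<alpha>(x, t), its first coefficient at \<open>e\<close> is -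
    \<alpha>(e, 0).\<close>
  proof (intro exI[of _ "- \<alpha>r e 0"] conjI impI)
    show "(\<lambda>t. of_real (x t) - (complex_of_real e + complex_of_real (t\<^sup>2 * (- \<alpha>r e 0)\<^sup>2) /
              (4 * deriv (\<lambda>z. (Delta a b q z)\<^sup>2) (complex_of_real e))))
         \<in> O[at_right 0](\<lambda>t. complex_of_real (t ^ 3))"
    proof (rule bigoI[of _ K])
      show "\<forall>\<^sub>F t in at_right 0. norm (of_real (x t) - (complex_of_real e + complex_of_real (t\<^sup>2 * (- \<alpha>r e 0)\<^sup>2) /
              (4 * deriv (\<lambda>z. (Delta a b q z)\<^sup>2) (complex_of_real e)))) \<le> K * norm (complex_of_real (t ^ 3))"
        using ev
      proof eventually_elim
        case (elim t)
        have "of_real (x t) - (complex_of_real e + complex_of_real (t\<^sup>2 * (- \<alpha>r e 0)\<^sup>2) /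
              (4 * deriv (\<lambda>z. (Delta a b q z)\<^sup>2) (complex_of_real e)))
            = of_real (x t - (e + t\<^sup>2 * (\<alpha>r e 0)\<^sup>2 / (4 * poly (pderiv DP) e)))"
          unfolding deriv_Delta_square by simp
        hence "norm (of_real (x t) - (complex_of_real e + complex_of_real (t\<^sup>2 * (- \<alpha>r e 0)\<^sup>2) /
              (4 * deriv (\<lambda>z. (Delta a b q z)\<^sup>2) (complex_of_real e))))
            = \<bar>x t - (e + t\<^sup>2 * (\<alpha>r e 0)\<^sup>2 / (4 * poly (pderiv DP) e))\<bar>"
          by (simp only: norm_of_real)
        moreover have "norm (complex_of_real (t ^ 3)) = t ^ 3" using elim by (simp only: norm_of_real) simp
        ultimately show ?case using K[of t] elim by simp
      qed
    qed
    show "(\<lambda>t. poly (J_poly a b q p v t) e - t * - \<alpha>r e 0) \<in> O[at_right 0](\<lambda>t. t\<^sup>2)"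
    proof (rule bigoI[of _ C])
      show "\<forall>\<^sub>F t in at_right 0. norm (poly (J_poly a b q p v t) e - t * - \<alpha>r e 0) \<le> C * norm (t\<^sup>2)"
        using ev
      proof eventually_elim
        case (elim t)
        have "e \<in> {lm k..lp k}" "t \<in> {0..1}" "(0::real) \<in> {0..1}" using e ne elim small(1)[of t] by auto
        hence "\<bar>\<alpha>r e t - \<alpha>r e 0\<bar> \<le> C * (\<bar>e - e\<bar> + \<bar>t - 0\<bar>)"
          using gb unfolding gap_bound_def by blast
        hence "t * \<bar>\<alpha>r e t - \<alpha>r e 0\<bar> \<le> t * (C * t)" using elim by (intro mult_left_mono) auto
        moreover have "poly (J_poly a b q p v t) e - t * - \<alpha>r e 0 = - (t * (\<alpha>r e t - \<alpha>r e 0))"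
          by (simp add: J_poly_eq algebra_simps)
        hence "norm (poly (J_poly a b q p v t) e - t * - \<alpha>r e 0) = t * \<bar>\<alpha>r e t - \<alpha>r e 0\<bar>"
          using elim by (simp only: real_norm_def abs_minus_cancel abs_mult abs_of_pos)
        ultimately show ?case by (simp add: power2_eq_square mult_ac)
      qed
    qed
  qed (rule edge_formula[OF k ne e]; assumption)+
  have "edge_expansion k (lm k) Sm" "edge_expansion k (lp k) Sp"
    using asym[OF disjI1[OF refl] L.state_at_asymptotics[OF _ small(1,2) Lst]]
      asym[OF disjI2[OF refl] R.state_at_asymptotics[OF _ small(1,2) Rst]]
    unfolding Sm_def Sp_def by simp_all
  thus ?thesis using part1 t0 by blast
qed

end

theorem theorem1p3:
  fixes q p :: nat and a b v :: "int \<Rightarrow> real"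
  assumes "q \<ge> 1" and "p \<ge> 1"
    and "\<And>n. a (n + int q) = a n" and "\<And>n. b (n + int q) = b n" and "\<And>n. a n > 0"
    and "\<And>n. n < 0 \<or> n > int p \<Longrightarrow> v n = 0" and "v 0 \<noteq> 0" and "v (int p) \<noteq> 0"
  shows "\<exists>t0>0. \<exists>Sm Sp :: nat \<Rightarrow> real \<Rightarrow> complex \<times> complex.
    (\<forall>t\<in>{0<..<t0}. \<forall>k\<in>{1..q - 1}. gap a b q k \<noteq> {} \<longrightarrow>
        {P \<in> gap_circle a b q k. is_state a b q p v t P} = {Sm k t, Sp k t} \<and>
        simple_state a b q p v t (Sm k t) \<and> simple_state a b q p v t (Sp k t) \<and>
        lam_minus a b q k \<le> Re (fst (Sm k t)) \<and> Re (fst (Sm k t)) < alpha_pt a b q k \<and>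
        alpha_pt a b q k < Re (fst (Sp k t)) \<and> Re (fst (Sp k t)) \<le> lam_plus a b q k \<and>
        (\<forall>P\<in>{Sm k t, Sp k t}.
           let s = (-1) ^ (q - k + 1) * poly (J_poly a b q p v t) (Re (fst P)) in
             (s > 0 \<longrightarrow> bound_state a b q p v t P) \<and>
             (s < 0 \<longrightarrow> antibound_state a b q p v t P) \<and>
             (s = 0 \<longrightarrow> virtual_state a b q p v t P))) \<and>
    (\<forall>n\<in>{1..q - 1}. gap a b q n \<noteq> {} \<longrightarrow>
        (\<forall>(e, S)\<in>{(lam_minus a b q n, Sm n), (lam_plus a b q n, Sp n)}. \<exists>J1 :: real.
           (\<lambda>t. fst (S t) - (complex_of_real e + complex_of_real (t\<^sup>2 * J1\<^sup>2) /
                  (4 * deriv (\<lambda>z. (Delta a b q z)\<^sup>2) (complex_of_real e))))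
             \<in> O[at_right 0](\<lambda>t. complex_of_real (t ^ 3)) \<and>
           (\<lambda>t. poly (J_poly a b q p v t) e - t * J1) \<in> O[at_right 0](\<lambda>t. t\<^sup>2) \<and>
           (e \<noteq> mu a b q n \<longrightarrow>
              complex_of_real J1 = - (varphi a b (int q) (complex_of_real e) / complex_of_real (a 0)) *
                (\<Sum>k\<in>{0..int p}. complex_of_real (v k * (cmod (psi_plus a b q k (complex_of_real e, 0)))\<^sup>2))) \<and>
           (e = mu a b q n \<longrightarrow>
              complex_of_real J1 = vartheta a b (int q + 1) (complex_of_real e) / complex_of_real (a 0) *
                (\<Sum>k\<in>{1..int p}. complex_of_real (v k) * (varphi a b k (complex_of_real e))\<^sup>2))))"
proof -
  interpret perturbed_jacobi a b q p v
    by unfold_locales (use assms(1,5,6) assms(3)[of 0] in auto)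
  let ?G = "{k \<in> {1..q - 1}. gap a b q k \<noteq> {}}"
  have ne: "lm k < lp k" if "k \<in> ?G" for k using that gap_eq[of k] by auto
  have "\<forall>k\<in>?G. \<exists>t0 Sm Sp. t0 > 0 \<and> (\<forall>t\<in>{0<..<t0}. gap_state_pair k t (Sm t) (Sp t)) \<and>
      edge_expansion k (lm k) Sm \<and> edge_expansion k (lp k) Sp"
    using gap_states ne by simp
  then obtain T Sm Sp where S: "\<And>k. k \<in> ?G \<Longrightarrow> T k > 0 \<and>
      (\<forall>t\<in>{0<..<T k}. gap_state_pair k t (Sm k t) (Sp k t)) \<and>
      edge_expansion k (lm k) (Sm k) \<and> edge_expansion k (lp k) (Sp k)"
    unfolding bchoice_iff by blast
  \<comment> \<open>There are finitely many gaps; the inserted 1 serves the case that all of them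
    are closed.\<close>
  define t0 where "t0 = Min (insert 1 (T ` ?G))"
  have pos: "t0 > 0" using S by (auto simp: t0_def)
  have t0: "t0 \<le> T k" if "k \<in> ?G" for k using that by (auto simp: t0_def)
  have pair: "gap_state_pair k t (Sm k t) (Sp k t)"
    if "t \<in> {0<..<t0}" "k \<in> {1..q - 1}" "gap a b q k \<noteq> {}" for t k
    using S[of k] t0[of k] that by auto
  hence pairs: "\<forall>t\<in>{0<..<t0}. \<forall>k\<in>{1..q - 1}. gap a b q k \<noteq> {} \<longrightarrow> gap_state_pair k t (Sm k t) (Sp k t)"
    by blast
  have expansions: "\<forall>n\<in>{1..q - 1}. gap a b q n \<noteq> {} \<longrightarrow>
       (\<forall>(e, S)\<in>{(lm n, Sm n), (lp n, Sp n)}. edge_expansion n e S)"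
    using S by simp
  have "\<exists>t0>0. \<exists>Sm Sp :: nat \<Rightarrow> real \<Rightarrow> complex \<times> complex.
    (\<forall>t\<in>{0<..<t0}. \<forall>k\<in>{1..q - 1}. gap a b q k \<noteq> {} \<longrightarrow> gap_state_pair k t (Sm k t) (Sp k t)) \<and>
    (\<forall>n\<in>{1..q - 1}. gap a b q n \<noteq> {} \<longrightarrow>
       (\<forall>(e, S)\<in>{(lm n, Sm n), (lp n, Sp n)}. edge_expansion n e S))"
    by (rule exI[of _ t0], rule conjI[OF pos], rule exI[of _ Sm], rule exI[of _ Sp], rule conjI[OF pairs expansions])
  thus ?thesis unfolding gap_state_pair_def edge_expansion_def .
qed

end
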